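(* Let $X$ and $Y$ be uniformly locally finite metric spaces, and assume that all sparse subspaces of $Y$ yield only compact ghost projections. If there is an embedding $\Phi:\mathrm{C}^*_u(X)\to\mathrm{C}^*_u(Y)$ such that $\Phi(\ell_\infty(X))$ is a coseparable Cartan subalgebra of $\mathrm{C}^*_u(Y)$ and $\Phi(\mathrm{C}^*_u(X))$ is strongly-cobounded in $\mathrm{C}^*_u(Y)$, then there is a uniformly finite-to-one coarse quotient map $X\to Y$.
   Context: U.l.f. metric space: balls of radius $r$ have uniformly bounded cardinality for each $r$. $\mathrm{C}^*_u(X)$: norm closure in $\mathcal B(\ell_2(X))$ of finite-propagation operators, $\mathrm{propg}(a)=\sup\{d(x,y):\langle a\delta_x,\delta_y\rangle\ne0\}$; $\ell_\infty(X)$ is the diagonal subalgebra. Embedding = injective $*$-homomorphism. A metric space $(X,d)$ is sparse if there is a partition $X=\bigsqcup_n X_n$ into finite sets with $d(X_n,X_m)\to\infty$ as $n+m\to\infty$. An operator $a$ on $\ell_2(X)$ is a ghost if for every $\varepsilon>0$ there is a finite $F\subset X$ with $|\langle a\delta_x,\delta_y\rangle|\le\varepsilon$ for $x,y\notin F$. $X$ yields only compact ghost projections if every ghost projection in $\mathrm{C}^*_u(X)$ is compact. Cartan subalgebra $B\subset A$: maximal abelian self-adjoint, contains an approximate unit of $A$, its normalizer $\{a\in A: aBa^*\subset B, a^*Ba\subset B\}$ generates $A$, and there is a faithful conditional expectation $A\to B$. $B\subset A$ is coseparable if there is a countable $S\subset A$ with $A=\mathrm{C}^*(B,S)$. For $A_1\subset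 A_2\subset \mathrm{C}^*_u(Y)$, $A_1$ is strongly-cobounded in $A_2$ if there is $k\in\mathbb N$ such that for every $\varepsilon>0$ and every contraction $b\in A_2$ there exist $a_1,\dots,a_k\in A_1$, $\|a_i\|\le k$, and $c_1,\dots,c_k\in A_2$, $\mathrm{propg}(c_i)\le k$, $\|c_i\|\le k$, with $\|b-\sum c_ia_i\|\le\varepsilon$. $f:X\to Y$ is uniformly finite-to-one if $\sup_{y\in Y}|f^{-1}(y)|<\infty$. $f$ is coarse if $\sup\{\partial(f(x),f(y)):d(x,y)\le t\}<\infty$ for all $t$; it is a coarse quotient if coarse and there is $K>0$ such that for every $\varepsilon>0$ there is $\delta>0$ with $B(f(x),\varepsilon)\subset f(B(x,\delta))^K$ for all $x$, where $A^K=\{y:\partial(y,A)\le K\}$ and balls are closed. *)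

theory Defs
  imports "HOL-Analysis.Analysis"
begin

(* Operators on l2(S) are represented by their matrices  a x y = <a delta_y, delta_x>.
   Carriers are explicit subsets S of a type; metrics are explicit functions d. *)

type_synonym 'a cmat = "'a \<Rightarrow> 'a \<Rightarrow> complex"
type_synonym 'a cvec = "'a \<Rightarrow> complex"

definition metric_on :: "'a set \<Rightarrow> ('a \<Rightarrow> 'a \<Rightarrow> real) \<Rightarrow> bool" where
  "metric_on X d \<longleftrightarrow> (\<forall>x\<in>X. \<forall>y\<in>X. d x y \<ge> 0 \<and> (d x y = 0 \<longleftrightarrow> x = y) \<and> d x y = d y x)
     \<and> (\<forall>x\<in>X. \<forall>y\<in>X. \<forall>z\<in>X. d x z \<le> d x y + d y z)"

definition cball_on :: "'a set \<Rightarrow> ('a \<Rightarrow> 'a \<Rightarrow> real) \<Rightarrow> 'a \<Rightarrow> real \<Rightarrow> 'a set" where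
  "cball_on X d x r = {y \<in> X. d x y \<le> r}"

definition ulf :: "'a set \<Rightarrow> ('a \<Rightarrow> 'a \<Rightarrow> real) \<Rightarrow> bool" where
  "ulf X d \<longleftrightarrow> (\<forall>r. \<exists>N::nat. \<forall>x\<in>X. finite (cball_on X d x r) \<and> card (cball_on X d x r) \<le> N)"

definition l2vec :: "'a set \<Rightarrow> 'a cvec \<Rightarrow> bool" where
  "l2vec S f \<longleftrightarrow> (\<forall>x. x \<notin> S \<longrightarrow> f x = 0) \<and> (\<lambda>x. (cmod (f x))^2) summable_on UNIV"

definition l2norm :: "'a cvec \<Rightarrow> real" where
  "l2norm f = sqrt (infsum (\<lambda>x. (cmod (f x))^2) UNIV)"

definition vsub :: "'a cvec \<Rightarrow> 'a cvec \<Rightarrow> 'a cvec" where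
  "vsub f g = (\<lambda>x. f x - g x)"

definition mvec :: "'a cmat \<Rightarrow> 'a cvec \<Rightarrow> 'a cvec" where
  "mvec a f = (\<lambda>x. infsum (\<lambda>y. a x y * f y) UNIV)"

definition bounded_op :: "'a set \<Rightarrow> 'a cmat \<Rightarrow> bool" where
  "bounded_op S a \<longleftrightarrow> (\<forall>x y. (x \<notin> S \<or> y \<notin> S) \<longrightarrow> a x y = 0) \<and>
     (\<exists>C. \<forall>f. l2vec S f \<longrightarrow> (\<forall>x. (\<lambda>y. a x y * f y) summable_on UNIV) \<and>
           l2vec S (mvec a f) \<and> l2norm (mvec a f) \<le> C * l2norm f)"

definition opnorm :: "'a set \<Rightarrow> 'a cmat \<Rightarrow> real" where
  "opnorm S a = Sup {l2norm (mvec a f) | f. l2vec S f \<and> l2norm f \<le> 1}"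

definition mzero :: "'a cmat" where "mzero = (\<lambda>x y. 0)"
definition madd :: "'a cmat \<Rightarrow> 'a cmat \<Rightarrow> 'a cmat" where "madd a b = (\<lambda>x y. a x y + b x y)"
definition msub :: "'a cmat \<Rightarrow> 'a cmat \<Rightarrow> 'a cmat" where "msub a b = (\<lambda>x y. a x y - b x y)"
definition msmul :: "complex \<Rightarrow> 'a cmat \<Rightarrow> 'a cmat" where "msmul c a = (\<lambda>x y. c * a x y)"
definition mmul :: "'a cmat \<Rightarrow> 'a cmat \<Rightarrow> 'a cmat" where
  "mmul a b = (\<lambda>x z. infsum (\<lambda>y. a x y * b y z) UNIV)"
definition madj :: "'a cmat \<Rightarrow> 'a cmat" where "madj a = (\<lambda>x y. cnj (a y x))"

definition propg_le :: "('a \<Rightarrow> 'a \<Rightarrow> real) \<Rightarrow> 'a cmat \<Rightarrow> real \<Rightarrow> bool" where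
  "propg_le d a r \<longleftrightarrow> (\<forall>x y. a x y \<noteq> 0 \<longrightarrow> d x y \<le> r)"

definition fin_prop :: "('a \<Rightarrow> 'a \<Rightarrow> real) \<Rightarrow> 'a cmat \<Rightarrow> bool" where
  "fin_prop d a \<longleftrightarrow> (\<exists>r. propg_le d a r)"

definition roe :: "'a set \<Rightarrow> ('a \<Rightarrow> 'a \<Rightarrow> real) \<Rightarrow> 'a cmat set" where
  "roe X d = {a. bounded_op X a \<and> (\<forall>e>0. \<exists>b. bounded_op X b \<and> fin_prop d b \<and> opnorm X (msub a b) \<le> e)}"

definition linf :: "'a set \<Rightarrow> 'a cmat set" where
  "linf X = {a. bounded_op X a \<and> (\<forall>x y. x \<noteq> y \<longrightarrow> a x y = 0)}"

definition star_subalg :: "'a set \<Rightarrow> 'a cmat set \<Rightarrow> bool" where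
  "star_subalg S C \<longleftrightarrow> C \<subseteq> {a. bounded_op S a} \<and> mzero \<in> C \<and>
     (\<forall>a\<in>C. \<forall>b\<in>C. madd a b \<in> C \<and> mmul a b \<in> C) \<and>
     (\<forall>c. \<forall>a\<in>C. msmul c a \<in> C) \<and> (\<forall>a\<in>C. madj a \<in> C)"

definition norm_closed :: "'a set \<Rightarrow> 'a cmat set \<Rightarrow> bool" where
  "norm_closed S C \<longleftrightarrow> (\<forall>a. bounded_op S a \<and> (\<forall>e>0. \<exists>b\<in>C. opnorm S (msub a b) \<le> e) \<longrightarrow> a \<in> C)"

definition cstar_subalg :: "'a set \<Rightarrow> 'a cmat set \<Rightarrow> bool" where
  "cstar_subalg S C \<longleftrightarrow> star_subalg S C \<and> norm_closed S C"

definition cstar_gen :: "'a set \<Rightarrow> 'a cmat set \<Rightarrow> 'a cmat set" where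
  "cstar_gen S G = \<Inter> {C. cstar_subalg S C \<and> G \<subseteq> C}"

definition abelian :: "'a cmat set \<Rightarrow> bool" where
  "abelian C \<longleftrightarrow> (\<forall>a\<in>C. \<forall>b\<in>C. mmul a b = mmul b a)"

definition positive_in :: "'a cmat set \<Rightarrow> 'a cmat \<Rightarrow> bool" where
  "positive_in A p \<longleftrightarrow> (\<exists>c\<in>A. p = mmul (madj c) c)"

definition normalizer :: "'a cmat set \<Rightarrow> 'a cmat set \<Rightarrow> 'a cmat set" where
  "normalizer A B = {a\<in>A. \<forall>b\<in>B. mmul (mmul a b) (madj a) \<in> B \<and> mmul (mmul (madj a) b) a \<in> B}"

definition cond_exp :: "'a set \<Rightarrow> 'a cmat set \<Rightarrow> 'a cmat set \<Rightarrow> ('a cmat \<Rightarrow> 'a cmat) \<Rightarrow> bool" where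
  "cond_exp S A B E \<longleftrightarrow> (\<forall>a\<in>A. E a \<in> B) \<and> (\<forall>b\<in>B. E b = b) \<and>
     (\<forall>a\<in>A. \<forall>a'\<in>A. E (madd a a') = madd (E a) (E a')) \<and>
     (\<forall>c. \<forall>a\<in>A. E (msmul c a) = msmul c (E a)) \<and>
     (\<forall>a\<in>A. opnorm S (E a) \<le> opnorm S a) \<and>
     (\<forall>a\<in>A. positive_in A a \<longrightarrow> positive_in A (E a)) \<and>
     (\<forall>a\<in>A. \<forall>b\<in>B. \<forall>c\<in>B. E (mmul b (mmul a c)) = mmul b (mmul (E a) c))"

definition faithful :: "'a cmat set \<Rightarrow> ('a cmat \<Rightarrow> 'a cmat) \<Rightarrow> bool" where
  "faithful A E \<longleftrightarrow> (\<forall>a\<in>A. E (mmul (madj a) a) = mzero \<longrightarrow> a = mzero)"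

(* approximate unit of A inside B, as a (generalised) net = filter on matrices *)
definition has_approx_unit_in :: "'a set \<Rightarrow> 'a cmat set \<Rightarrow> 'a cmat set \<Rightarrow> bool" where
  "has_approx_unit_in S A B \<longleftrightarrow> (\<exists>F :: 'a cmat filter. F \<noteq> bot \<and>
     eventually (\<lambda>e. e \<in> B \<and> positive_in A e \<and> opnorm S e \<le> 1) F \<and>
     (\<forall>a\<in>A. ((\<lambda>e. opnorm S (msub (mmul e a) a)) \<longlongrightarrow> 0) F \<and>
             ((\<lambda>e. opnorm S (msub (mmul a e) a)) \<longlongrightarrow> 0) F))"

definition cartan :: "'a set \<Rightarrow> 'a cmat set \<Rightarrow> 'a cmat set \<Rightarrow> bool" where
  "cartan S A B \<longleftrightarrow> cstar_subalg S B \<and> B \<subseteq> A \<and> abelian B \<and>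
     (\<forall>C. star_subalg S C \<and> abelian C \<and> B \<subseteq> C \<and> C \<subseteq> A \<longrightarrow> C = B) \<and>
     has_approx_unit_in S A B \<and>
     cstar_gen S (normalizer A B) = A \<and>
     (\<exists>E. cond_exp S A B E \<and> faithful A E)"

definition coseparable :: "'a set \<Rightarrow> 'a cmat set \<Rightarrow> 'a cmat set \<Rightarrow> bool" where
  "coseparable S A B \<longleftrightarrow> (\<exists>G. countable G \<and> G \<subseteq> A \<and> A = cstar_gen S (B \<union> G))"

definition strongly_cobounded :: "'a set \<Rightarrow> ('a \<Rightarrow> 'a \<Rightarrow> real) \<Rightarrow> 'a cmat set \<Rightarrow> 'a cmat set \<Rightarrow> bool" where
  "strongly_cobounded Y d A1 A2 \<longleftrightarrow> (\<exists>k::nat. \<forall>e>0. \<forall>b\<in>A2. opnorm Y b \<le> 1 \<longrightarrow>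
     (\<exists>a c :: nat \<Rightarrow> 'a cmat.
        (\<forall>i\<in>{1..k}. a i \<in> A1 \<and> opnorm Y (a i) \<le> real k \<and>
                      c i \<in> A2 \<and> propg_le d (c i) (real k) \<and> opnorm Y (c i) \<le> real k) \<and>
        opnorm Y (msub b (foldr (\<lambda>i acc. madd (mmul (c i) (a i)) acc) [1..<Suc k] mzero)) \<le> e))"

definition cstar_embedding :: "'a set \<Rightarrow> ('a \<Rightarrow> 'a \<Rightarrow> real) \<Rightarrow> 'b set \<Rightarrow> ('b \<Rightarrow> 'b \<Rightarrow> real)
     \<Rightarrow> ('a cmat \<Rightarrow> 'b cmat) \<Rightarrow> bool" where
  "cstar_embedding X dX Y dY \<Phi> \<longleftrightarrow> \<Phi> ` roe X dX \<subseteq> roe Y dY \<and> inj_on \<Phi> (roe X dX) \<and>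
     (\<forall>a\<in>roe X dX. \<forall>b\<in>roe X dX. \<Phi> (madd a b) = madd (\<Phi> a) (\<Phi> b) \<and> \<Phi> (mmul a b) = mmul (\<Phi> a) (\<Phi> b)) \<and>
     (\<forall>c. \<forall>a\<in>roe X dX. \<Phi> (msmul c a) = msmul c (\<Phi> a)) \<and>
     (\<forall>a\<in>roe X dX. \<Phi> (madj a) = madj (\<Phi> a))"

definition ghost :: "'a cmat \<Rightarrow> bool" where
  "ghost a \<longleftrightarrow> (\<forall>e>0. \<exists>F. finite F \<and> (\<forall>x y. x \<notin> F \<and> y \<notin> F \<longrightarrow> cmod (a x y) \<le> e))"

definition projection :: "'a cmat \<Rightarrow> bool" where
  "projection p \<longleftrightarrow> mmul p p = p \<and> madj p = p"

(* compact: the image of the unit ball is relatively compact (= totally bounded in l2) *)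
definition compact_op :: "'a set \<Rightarrow> 'a cmat \<Rightarrow> bool" where
  "compact_op S a \<longleftrightarrow> (\<forall>e>0. \<exists>G. finite G \<and> (\<forall>g\<in>G. l2vec S g) \<and>
     (\<forall>f. l2vec S f \<and> l2norm f \<le> 1 \<longrightarrow> (\<exists>g\<in>G. l2norm (vsub (mvec a f) g) \<le> e)))"

definition only_compact_ghost_projections :: "'a set \<Rightarrow> ('a \<Rightarrow> 'a \<Rightarrow> real) \<Rightarrow> bool" where
  "only_compact_ghost_projections Z d \<longleftrightarrow>
     (\<forall>p\<in>roe Z d. ghost p \<and> projection p \<longrightarrow> compact_op Z p)"

definition sparse :: "'a set \<Rightarrow> ('a \<Rightarrow> 'a \<Rightarrow> real) \<Rightarrow> bool" where
  "sparse Z d \<longleftrightarrow> (\<exists>P :: nat \<Rightarrow> 'a set. (\<forall>n. finite (P n)) \<and> disjoint_family P \<and> (\<Union>n. P n) = Z \<and>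
     (\<forall>R. \<exists>N. \<forall>n m. n \<noteq> m \<and> N \<le> n + m \<longrightarrow> (\<forall>x\<in>P n. \<forall>y\<in>P m. R < d x y)))"

definition unif_fin_to_one :: "'a set \<Rightarrow> 'b set \<Rightarrow> ('a \<Rightarrow> 'b) \<Rightarrow> bool" where
  "unif_fin_to_one X Y f \<longleftrightarrow> (\<exists>N::nat. \<forall>y\<in>Y. finite {x\<in>X. f x = y} \<and> card {x\<in>X. f x = y} \<le> N)"

definition coarse_map :: "'a set \<Rightarrow> ('a \<Rightarrow> 'a \<Rightarrow> real) \<Rightarrow> ('b \<Rightarrow> 'b \<Rightarrow> real) \<Rightarrow> ('a \<Rightarrow> 'b) \<Rightarrow> bool" where
  "coarse_map X dX dY f \<longleftrightarrow> (\<forall>t. \<exists>s. \<forall>x\<in>X. \<forall>y\<in>X. dX x y \<le> t \<longrightarrow> dY (f x) (f y) \<le> s)"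

definition setdist :: "('b \<Rightarrow> 'b \<Rightarrow> real) \<Rightarrow> 'b \<Rightarrow> 'b set \<Rightarrow> real" where
  "setdist d y A = Inf {d y a | a. a \<in> A}"

definition thicken :: "'b set \<Rightarrow> ('b \<Rightarrow> 'b \<Rightarrow> real) \<Rightarrow> real \<Rightarrow> 'b set \<Rightarrow> 'b set" where
  "thicken Y d K A = {y\<in>Y. setdist d y A \<le> K}"

definition coarse_quotient :: "'a set \<Rightarrow> ('a \<Rightarrow> 'a \<Rightarrow> real) \<Rightarrow> 'b set \<Rightarrow> ('b \<Rightarrow> 'b \<Rightarrow> real)
     \<Rightarrow> ('a \<Rightarrow> 'b) \<Rightarrow> bool" where
  "coarse_quotient X dX Y dY f \<longleftrightarrow> coarse_map X dX dY f \<and>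
     (\<exists>K>0. \<forall>e>0. \<exists>\<delta>>0. \<forall>x\<in>X.
        cball_on Y dY (f x) e \<subseteq> thicken Y dY K (f ` cball_on X dX x \<delta>))"

end

theory Submission
  imports Defs
begin

text \<open>
  Let \<open>e\<^sub>x\<close> be the diagonal matrix units of \<open>X\<close>. Maximality of the abelian subalgebra \<open>\<Phi>(\<ell>\<^sub>\<infinity>(X))\<close> forces each
  \<open>\<Phi>(e\<^sub>x)\<close> to be a rank one projection onto a unit vector \<open>\<xi>\<^sub>x\<close>, and faithfulness of the conditional expectation
  makes \<open>(\<xi>\<^sub>x)\<close> an orthonormal basis of \<open>\<ell>\<^sub>2(Y)\<close>. Hence \<open>\<Phi>(a) = U a U\<^sup>*\<close> for the unitary \<open>U\<close> with columns \<open>\<xi>\<^sub>x\<close>.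

  The hypothesis on ghost projections gives \<open>f : X \<rightarrow> Y\<close> with \<open>|\<xi>\<^sub>x(f x)| \<ge> \<delta>\<close> for a fixed \<open>\<delta> > 0\<close>; as the rows of
  \<open>U\<close> are unit vectors, \<open>f\<close> is uniformly finite-to-one. A gliding hump argument makes the approximation of
  \<open>U a U\<^sup>*\<close> by operators of finite propagation uniform over partial translations \<open>a\<close> of bounded propagation, which
  shows that \<open>f\<close> is coarse and that both the columns and the rows of \<open>U\<close> are uniformly concentrated along the
  graph of \<open>f\<close>.

  If \<open>f\<close> were not a coarse quotient, there would be \<open>x\<^sub>n\<close>, \<open>y\<^sub>n\<close> with \<open>y\<^sub>n\<close> within bounded distance of \<open>f x\<^sub>n\<close> but far
  from \<open>f\<close> of growing balls around \<open>x\<^sub>n\<close>. Strong coboundedness approximates the partial translation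
  \<open>f x\<^sub>n \<mapsto> y\<^sub>n\<close> by \<open>\<Sum> c\<^sub>i \<Phi>(a\<^sub>i)\<close>, whose matrix coefficient between \<open>\<xi>\<close> at \<open>x\<^sub>n\<close> and \<open>y\<^sub>n\<close> is small by the concentration
  of the rows near \<open>y\<^sub>n\<close>, a contradiction.
\<close>

section \<open>Bounded kernels on square summable families\<close>

text \<open>Matrices over X and over Y have different index types, and \<open>U\<close> is a
  rectangular kernel between them; norm bounds are therefore stated by finite tests that make sense
  for every kernel. Sparse subspaces suffice because thin columns can be picked one after another,
  each almost supported beyond any given finite set. The obstacle to coarseness is that, for a given
  error, each image \<open>U a U*\<close> comes with its own propagation. A common radius exists
  because the rows of \<open>U\<close> are square summable: up to a small error, a coefficient
  tested at one point of Y does not see what \<open>a\<close> does outside a finite set, so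
  independent failures can be put into one operator. Strong coboundedness treats one operator at a
  time, so all bad pairs must form a single partial translation; this forces injective subsequences
  of both \<open>f x_n\<close> and \<open>y_n\<close>. Its constant \<open>k\<close> does not depend
  on the error or on the operator, so \<open>K\<close> can be fixed in advance. The propagation of
  approximants of the finitely many \<open>a_i\<close> is not controlled, but it only has to be
  beaten by the growing radius \<open>n\<close>.\<close>

definition l2 :: "('i \<Rightarrow> complex) \<Rightarrow> bool" where
  "l2 f \<longleftrightarrow> (\<lambda>x. (cmod (f x))\<^sup>2) summable_on UNIV"

abbreviation fnorm :: "('i \<Rightarrow> complex) \<Rightarrow> 'i set \<Rightarrow> real" where
  "fnorm f T \<equiv> L2_set (\<lambda>x. cmod (f x)) T"

text \<open>The matrix product with three independent index types, as required by products such as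
  \<open>U a U*\<close> with \<open>a\<close> on X and \<open>U\<close> from X to Y.\<close>

definition rmul :: "('i \<Rightarrow> 'j \<Rightarrow> complex) \<Rightarrow> ('j \<Rightarrow> 'k \<Rightarrow> complex) \<Rightarrow> 'i \<Rightarrow> 'k \<Rightarrow> complex" where
  "rmul a b = (\<lambda>x z. infsum (\<lambda>y. a x y * b y z) UNIV)"

definition kapp :: "('i \<Rightarrow> 'j \<Rightarrow> complex) \<Rightarrow> ('j \<Rightarrow> complex) \<Rightarrow> 'i \<Rightarrow> complex" where
  "kapp a f = (\<lambda>x. infsum (\<lambda>y. a x y * f y) UNIV)"

definition kadj :: "('i \<Rightarrow> 'j \<Rightarrow> complex) \<Rightarrow> 'j \<Rightarrow> 'i \<Rightarrow> complex" where
  "kadj a = (\<lambda>y x. cnj (a x y))"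

text \<open>Operator norm at most \<open>C\<close>, tested on finite sets. No series has to converge
  for this to make sense, the bilinear pairing makes it symmetric under transposition, and each test
  is continuous in finitely many entries.\<close>

definition bnd :: "real \<Rightarrow> ('i \<Rightarrow> 'j \<Rightarrow> complex) \<Rightarrow> bool" where
  "bnd C K \<longleftrightarrow> 0 \<le> C \<and> (\<forall>A B f g. finite A \<longrightarrow> finite B \<longrightarrow>
     cmod (\<Sum>x\<in>A. \<Sum>y\<in>B. g x * K x y * f y) \<le> C * fnorm g A * fnorm f B)"

section \<open>Square summable families and their finite truncations\<close>

lemma fnorm_sq: "(fnorm f T)\<^sup>2 = (\<Sum>x\<in>T. (cmod (f x))\<^sup>2)"
  by (simp add: L2_set_def real_sqrt_pow2 sum_nonneg)

lemma fnorm_mono: "finite T \<Longrightarrow> S \<subseteq> T \<Longrightarrow> fnorm f S \<le> fnorm f T"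
  unfolding L2_set_def by (intro real_sqrt_le_mono sum_mono2) auto

lemma fnorm_add: "fnorm (\<lambda>x. f x + g x) T \<le> fnorm f T + fnorm g T"
proof -
  have "fnorm (\<lambda>x. f x + g x) T \<le> L2_set (\<lambda>x. cmod (f x) + cmod (g x)) T"
    by (intro L2_set_mono norm_triangle_ineq) auto
  also have "\<dots> \<le> fnorm f T + fnorm g T" by (rule L2_set_triangle_ineq)
  finally show ?thesis .
qed

lemma fnorm_scale: "fnorm (\<lambda>x. c * f x) T = cmod c * fnorm f T"
  by (simp add: norm_mult L2_set_right_distrib)

lemma fnorm_CS: "cmod (\<Sum>x\<in>T. f x * g x) \<le> fnorm f T * fnorm g T"
proof -
  have "cmod (\<Sum>x\<in>T. f x * g x) \<le> (\<Sum>x\<in>T. \<bar>cmod (f x)\<bar> * \<bar>cmod (g x)\<bar>)"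
    by (rule order_trans[OF norm_sum]) (simp add: norm_mult)
  also have "\<dots> \<le> fnorm f T * fnorm g T" by (rule L2_set_mult_ineq)
  finally show ?thesis .
qed

lemma l2norm_nonneg [simp]: "0 \<le> l2norm f"
  unfolding l2norm_def by (simp add: infsum_nonneg)

lemma fnorm_le_l2norm:
  assumes "l2 f"
  shows "fnorm f T \<le> l2norm f"
proof (cases "finite T")
  case True
  then show ?thesis
    using assms unfolding l2_def l2norm_def L2_set_def
    by (intro real_sqrt_le_mono finite_sum_le_infsum) auto
qed simp

lemma l2norm_leI:
  assumes "\<And>T. finite T \<Longrightarrow> fnorm f T \<le> C"
  shows "l2 f" "l2norm f \<le> C"
proof -
  have C: "0 \<le> C" using assms[of "{}"] by simp
  have le: "(\<Sum>x\<in>T. (cmod (f x))\<^sup>2) \<le> C\<^sup>2" if "finite T" for T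
    using assms[OF that] by (metis L2_set_nonneg fnorm_sq power_mono)
  show s: "l2 f" unfolding l2_def
    by (rule nonneg_bdd_above_summable_on) (auto intro!: bdd_aboveI2[where M="C\<^sup>2"] le)
  have "infsum (\<lambda>x. (cmod (f x))\<^sup>2) UNIV \<le> C\<^sup>2"
    using s unfolding l2_def by (rule infsum_le_finite_sums) (use le in auto)
  then show "l2norm f \<le> C" unfolding l2norm_def
    using C by (simp add: real_le_lsqrt infsum_nonneg)
qed

lemma l2norm_sq: "(l2norm f)\<^sup>2 = infsum (\<lambda>x. (cmod (f x))\<^sup>2) UNIV"
  unfolding l2norm_def by (simp add: infsum_nonneg)

lemma l2_add: assumes "l2 f" "l2 g"
  shows "l2 (\<lambda>x. f x + g x)" "l2norm (\<lambda>x. f x + g x) \<le> l2norm f + l2norm g"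
proof -
  have "fnorm (\<lambda>x. f x + g x) T \<le> l2norm f + l2norm g" for T
    by (rule order_trans[OF fnorm_add]) (intro add_mono fnorm_le_l2norm assms)
  then show "l2 (\<lambda>x. f x + g x)" "l2norm (\<lambda>x. f x + g x) \<le> l2norm f + l2norm g"
    by (auto intro!: l2norm_leI(1) l2norm_leI(2))
qed

lemma l2_scale: assumes "l2 f"
  shows "l2 (\<lambda>x. c * f x)"
  using assms by (intro l2norm_leI(1)[where C="cmod c * l2norm f"])
    (simp add: fnorm_scale mult_left_mono fnorm_le_l2norm)

lemma l2norm_scale: "l2norm (\<lambda>x. c * f x) = cmod c * l2norm f"
  by (simp add: l2norm_def norm_mult power_mult_distrib infsum_cmult_right' real_sqrt_mult)

lemma l2_diff: assumes "l2 f" "l2 g"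
  shows "l2 (\<lambda>x. f x - g x)" "l2norm (\<lambda>x. f x - g x) \<le> l2norm f + l2norm g"
  using l2_add[OF assms(1) l2_scale[OF assms(2), of "-1"]] l2norm_scale[of "-1" g] by simp_all

lemma l2_cnj [simp]: "l2 (\<lambda>x. cnj (f x)) = l2 f"
  by (simp add: l2_def)

lemma l2norm_cnj [simp]: "l2norm (\<lambda>x. cnj (f x)) = l2norm f"
  by (simp add: l2norm_def)

lemma l2_dominated:
  assumes "l2 f" "\<And>x. cmod (g x) \<le> cmod (f x)"
  shows "l2 g" "l2norm g \<le> l2norm f"
proof -
  have "fnorm g T \<le> l2norm f" for T
    by (rule order_trans[OF L2_set_mono fnorm_le_l2norm[OF assms(1)]]) (use assms in auto)
  then show "l2 g" "l2norm g \<le> l2norm f" by (auto intro!: l2norm_leI(1) l2norm_leI(2))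
qed

lemma l2_finite_support:
  assumes "finite B" "\<And>x. x \<notin> B \<Longrightarrow> f x = 0"
  shows "l2 f" "l2norm f = fnorm f B"
proof -
  have "((\<lambda>x. (cmod (f x))\<^sup>2) has_sum (\<Sum>x\<in>B. (cmod (f x))\<^sup>2)) UNIV"
    by (rule has_sum_finite_neutralI) (use assms in auto)
  then show "l2 f" "l2norm f = fnorm f B"
    by (auto simp: l2_def l2norm_def L2_set_def has_sum_iff)
qed

lemma l2_prod:
  assumes "l2 f" "l2 g"
  shows "(\<lambda>x. f x * g x) summable_on UNIV"
    and "cmod (infsum (\<lambda>x. f x * g x) UNIV) \<le> l2norm f * l2norm g"
proof -
  have le: "(\<Sum>x\<in>T. norm (f x * g x)) \<le> l2norm f * l2norm g" for T
  proof -
    have "(\<Sum>x\<in>T. norm (f x * g x)) = (\<Sum>x\<in>T. \<bar>cmod (f x)\<bar> * \<bar>cmod (g x)\<bar>)"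
      by (simp add: norm_mult)
    also have "\<dots> \<le> fnorm f T * fnorm g T" by (rule L2_set_mult_ineq)
    also have "\<dots> \<le> l2norm f * l2norm g"
      by (intro mult_mono fnorm_le_l2norm assms) auto
    finally show ?thesis .
  qed
  have abs: "(\<lambda>x. norm (f x * g x)) summable_on UNIV"
    by (rule nonneg_bdd_above_summable_on) (auto intro!: bdd_aboveI2 le)
  then show "(\<lambda>x. f x * g x) summable_on UNIV" by (rule abs_summable_summable)
  have "cmod (infsum (\<lambda>x. f x * g x) UNIV) \<le> infsum (\<lambda>x. norm (f x * g x)) UNIV"
    using abs by (rule norm_infsum_bound)
  also have "\<dots> \<le> l2norm f * l2norm g"
    by (rule infsum_le_finite_sums[OF abs]) (use le in auto)
  finally show "cmod (infsum (\<lambda>x. f x * g x) UNIV) \<le> l2norm f * l2norm g" .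
qed

text \<open>The bound holds for every larger cutoff set, so the set may be enlarged later. Choosing
  \<open>B0\<close> inside the support places it in X or Y when \<open>f\<close> is a row or a
  column of \<open>U\<close>.\<close>

lemma l2_tail:
  assumes "l2 f" "e > 0"
  obtains B0 where "finite B0" "B0 \<subseteq> {x. f x \<noteq> 0}"
    "\<And>B. B0 \<subseteq> B \<Longrightarrow> l2norm (\<lambda>x. if x \<in> B then 0 else f x) \<le> e"
proof -
  let ?h = "\<lambda>x. (cmod (f x))\<^sup>2"
  have s: "?h summable_on {x. f x \<noteq> 0}" 
    using assms(1) unfolding l2_def by (rule summable_on_subset_banach) auto
  obtain B0 where B0: "finite B0" "B0 \<subseteq> {x. f x \<noteq> 0}" "dist (sum ?h B0) (infsum ?h {x. f x \<noteq> 0}) \<le> e\<^sup>2"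
    using infsum_finite_approximation[OF s, of "e\<^sup>2"] assms(2) by auto
  have tot: "infsum ?h {x. f x \<noteq> 0} = infsum ?h UNIV" by (rule infsum_cong_neutral) auto
  have "fnorm (\<lambda>x. if x \<in> B then 0 else f x) T \<le> e" if "B0 \<subseteq> B" "finite T" for B T
  proof -
    have "(\<Sum>x\<in>T. (cmod (if x \<in> B then 0 else f x))\<^sup>2) = (\<Sum>x\<in>T - B. ?h x)"
      using that(2) by (intro sum.mono_neutral_cong_right) auto
    also have "\<dots> = sum ?h ((T - B) \<union> B0) - sum ?h B0"
      using that B0(1) by (subst sum.union_disjoint) auto
    also have "\<dots> \<le> infsum ?h UNIV - sum ?h B0"
      using assms(1) that B0(1) unfolding l2_def by (intro diff_right_mono finite_sum_le_infsum) auto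
    also have "\<dots> \<le> e\<^sup>2" using B0(3) tot by (simp add: dist_real_def)
    finally show ?thesis using assms(2) unfolding L2_set_def by (intro real_le_lsqrt) (auto intro: sum_nonneg)
  qed
  then have "l2norm (\<lambda>x. if x \<in> B then 0 else f x) \<le> e" if "B0 \<subseteq> B" for B
    using that by (intro l2norm_leI(2)) auto
  with B0(1,2) show thesis by (rule that)
qed

section \<open>Calculus of bounds for kernels\<close>

lemma bndD:
  "bnd C K \<Longrightarrow> finite A \<Longrightarrow> finite B \<Longrightarrow>
     cmod (\<Sum>x\<in>A. \<Sum>y\<in>B. g x * K x y * f y) \<le> C * fnorm g A * fnorm f B"
  unfolding bnd_def by blast

lemma bnd_nonneg: "bnd C K \<Longrightarrow> 0 \<le> C"
  by (simp add: bnd_def)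

lemma bnd_mono: assumes "bnd C K" "C \<le> D" shows "bnd D K"
  unfolding bnd_def
proof (intro conjI allI impI)
  fix A B f g assume "finite (A::'a set)" "finite (B::'b set)"
  from bndD[OF assms(1) this, of g f] 
  have "cmod (\<Sum>x\<in>A. \<Sum>y\<in>B. g x * K x y * f y) \<le> C * fnorm g A * fnorm f B" .
  also have "\<dots> \<le> D * fnorm g A * fnorm f B" using assms(2) by (intro mult_right_mono) auto
  finally show "cmod (\<Sum>x\<in>A. \<Sum>y\<in>B. g x * K x y * f y) \<le> D * fnorm g A * fnorm f B" .
qed (use assms bnd_nonneg in force)

lemma bndI:
  assumes "0 \<le> C"
    and "\<And>A B f. finite A \<Longrightarrow> finite B \<Longrightarrow> fnorm (\<lambda>x. \<Sum>y\<in>B. K x y * f y) A \<le> C * fnorm f B"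
  shows "bnd C K"
  unfolding bnd_def
proof (intro conjI allI impI)
  fix A B f g assume f: "finite (A::'a set)" "finite (B::'b set)"
  have "cmod (\<Sum>x\<in>A. \<Sum>y\<in>B. g x * K x y * f y) = cmod (\<Sum>x\<in>A. g x * (\<Sum>y\<in>B. K x y * f y))"
    by (simp add: sum_distrib_left mult.assoc)
  also have "\<dots> \<le> fnorm g A * fnorm (\<lambda>x. \<Sum>y\<in>B. K x y * f y) A" by (rule fnorm_CS)
  also have "\<dots> \<le> fnorm g A * (C * fnorm f B)" by (intro mult_left_mono assms f) auto
  finally show "cmod (\<Sum>x\<in>A. \<Sum>y\<in>B. g x * K x y * f y) \<le> C * fnorm g A * fnorm f B"
    by (simp add: ac_simps)
qed (fact assms(1))

lemma self_bound:
  fixes n :: real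
  assumes "n\<^sup>2 \<le> M * n" "0 \<le> n" "0 \<le> M" shows "n \<le> M"
  using assms by (cases "n = 0") (auto simp: power2_eq_square)

text \<open>The extremal test vector is \<open>g = cnj v\<close>, which gives
  \<open>(fnorm v A)^2\<close> on the left.\<close>

lemma fnorm_dual:
  assumes "0 \<le> M" "\<And>g. cmod (\<Sum>x\<in>A. g x * v x) \<le> M * fnorm g A"
  shows "fnorm v A \<le> M"
proof -
  have "(\<Sum>x\<in>A. cnj (v x) * v x) = of_real ((fnorm v A)\<^sup>2)"
    unfolding fnorm_sq of_real_sum by (intro sum.cong refl) (metis complex_norm_square mult.commute)
  then have "(fnorm v A)\<^sup>2 = cmod (\<Sum>x\<in>A. cnj (v x) * v x)"
    by (simp only: norm_of_real abs_power2)
  also have "\<dots> \<le> M * fnorm v A" using assms(2)[of "\<lambda>x. cnj (v x)"] by simp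
  finally show ?thesis by (rule self_bound) (use assms(1) in simp_all)
qed

lemma bnd_fnorm:
  assumes "bnd C K" "finite A" "finite B"
  shows "fnorm (\<lambda>x. \<Sum>y\<in>B. K x y * f y) A \<le> C * fnorm f B"
proof (rule fnorm_dual)
  fix g
  show "cmod (\<Sum>x\<in>A. g x * (\<Sum>y\<in>B. K x y * f y)) \<le> C * fnorm f B * fnorm g A"
    using bndD[OF assms, of g f] by (simp add: sum_distrib_left ac_simps)
qed (use assms bnd_nonneg in \<open>auto intro!: mult_nonneg_nonneg add_nonneg_nonneg\<close>)

lemma bnd_transpose:
  assumes "bnd C K" shows "bnd C (\<lambda>y x. K x y)"
  unfolding bnd_def
proof (intro conjI allI impI)
  fix A B f g assume f: "finite (A::'b set)" "finite (B::'a set)"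
  have "(\<Sum>y\<in>A. \<Sum>x\<in>B. g y * K x y * f x) = (\<Sum>x\<in>B. \<Sum>y\<in>A. f x * K x y * g y)"
    by (subst sum.swap) (simp add: ac_simps)
  then show "cmod (\<Sum>y\<in>A. \<Sum>x\<in>B. g y * K x y * f x) \<le> C * fnorm g A * fnorm f B"
    using bndD[OF assms f(2,1), of f g] by (simp only: ac_simps)
qed (use assms bnd_nonneg in auto)

lemma bnd_cnj: assumes "bnd C K" shows "bnd C (\<lambda>x y. cnj (K x y))"
proof (rule bndI)
  fix A B f assume f: "finite (A::'a set)" "finite (B::'b set)"
  have "fnorm (\<lambda>x. \<Sum>y\<in>B. cnj (K x y) * f y) A = fnorm (\<lambda>x. \<Sum>y\<in>B. K x y * cnj (f y)) A"
  proof (intro L2_set_cong refl)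
    fix x
    have "(\<Sum>y\<in>B. cnj (K x y) * f y) = cnj (\<Sum>y\<in>B. K x y * cnj (f y))" by simp
    then show "cmod (\<Sum>y\<in>B. cnj (K x y) * f y) = cmod (\<Sum>y\<in>B. K x y * cnj (f y))" by (metis complex_mod_cnj)
  qed
  also have "\<dots> \<le> C * fnorm f B" using bnd_fnorm[OF assms f, of "\<lambda>y. cnj (f y)"] by simp
  finally show "fnorm (\<lambda>x. \<Sum>y\<in>B. cnj (K x y) * f y) A \<le> C * fnorm f B" .
qed (use assms bnd_nonneg in \<open>auto intro!: mult_nonneg_nonneg add_nonneg_nonneg\<close>)

lemma bnd_adj: "bnd C K \<Longrightarrow> bnd C (kadj K)"
  unfolding kadj_def by (rule bnd_cnj[OF bnd_transpose])

lemma bnd_row: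
  assumes "bnd C K"
  shows "l2 (K x)" "l2norm (K x) \<le> C"
proof -
  have "fnorm (K x) T \<le> C" if "finite T" for T
  proof (rule fnorm_dual)
    show "cmod (\<Sum>y\<in>T. g y * K x y) \<le> C * fnorm g T" for g
      using bndD[OF assms, of "{x}" T "\<lambda>_. 1" g] that by (simp add: ac_simps)
  qed (use assms bnd_nonneg in \<open>auto intro!: mult_nonneg_nonneg add_nonneg_nonneg\<close>)
  then show "l2 (K x)" "l2norm (K x) \<le> C" by (auto intro: l2norm_leI(1) l2norm_leI(2))
qed

lemma bnd_col:
  assumes "bnd C K"
  shows "l2 (\<lambda>x. K x y)" "l2norm (\<lambda>x. K x y) \<le> C"
  using bnd_row[OF bnd_transpose[OF assms]] .

lemma bnd_entry: assumes "bnd C K" shows "cmod (K x y) \<le> C"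
  using bnd_row(2)[OF assms, of x] fnorm_le_l2norm[OF bnd_row(1)[OF assms, of x], of "{y}"] by simp

lemma kapp_summable: "bnd C K \<Longrightarrow> l2 f \<Longrightarrow> (\<lambda>y. K x y * f y) summable_on UNIV"
  by (rule l2_prod(1)[OF bnd_row(1)])

lemma has_sum_sum:
  fixes h :: "'a \<Rightarrow> 'i \<Rightarrow> complex"
  assumes "\<And>a. a \<in> A \<Longrightarrow> (h a has_sum s a) S"
  shows "((\<lambda>x. \<Sum>a\<in>A. h a x) has_sum (\<Sum>a\<in>A. s a)) S"
  using assms by (induction A rule: infinite_finite_induct) (auto intro: has_sum_add)

lemma has_sum_norm_le:
  fixes h :: "'i \<Rightarrow> complex"
  assumes "(h has_sum s) UNIV" "\<And>B. finite B \<Longrightarrow> cmod (sum h B) \<le> M"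
  shows "cmod s \<le> M"
proof (rule tendsto_upperbound)
  show "((\<lambda>B. cmod (sum h B)) \<longlongrightarrow> cmod s) (finite_subsets_at_top UNIV)"
    using assms(1) unfolding has_sum_def by (intro tendsto_norm)
  show "\<forall>\<^sub>F B in finite_subsets_at_top UNIV. cmod (sum h B) \<le> M"
    using assms(2) by (intro eventually_finite_subsets_at_top_weakI) auto
qed simp

lemma kapp_l2:
  assumes "bnd C K" "l2 f"
  shows "l2 (kapp K f)" "l2norm (kapp K f) \<le> C * l2norm f"
proof -
  have "fnorm (kapp K f) A \<le> C * l2norm f" if A: "finite A" for A
  proof (rule fnorm_dual)
    fix g
    have "((\<lambda>y. \<Sum>x\<in>A. g x * (K x y * f y)) has_sum (\<Sum>x\<in>A. g x * kapp K f x)) UNIV"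
      unfolding kapp_def
      by (intro has_sum_sum has_sum_cmult_right has_sum_infsum kapp_summable[OF assms])
    then show "cmod (\<Sum>x\<in>A. g x * kapp K f x) \<le> C * l2norm f * fnorm g A"
    proof (rule has_sum_norm_le)
      fix B assume B: "finite (B::'b set)"
      have "cmod (\<Sum>y\<in>B. \<Sum>x\<in>A. g x * (K x y * f y)) \<le> C * fnorm g A * fnorm f B"
        using bndD[OF assms(1) A B, of g f] by (subst sum.swap) (simp add: ac_simps)
      also have "\<dots> \<le> C * fnorm g A * l2norm f"
        using bnd_nonneg[OF assms(1)] by (intro mult_left_mono fnorm_le_l2norm assms) auto
      finally show "cmod (\<Sum>y\<in>B. \<Sum>x\<in>A. g x * (K x y * f y)) \<le> C * l2norm f * fnorm g A"
        by (simp add: ac_simps)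
    qed
  qed (use assms bnd_nonneg in \<open>auto intro!: mult_nonneg_nonneg add_nonneg_nonneg\<close>)
  then show "l2 (kapp K f)" "l2norm (kapp K f) \<le> C * l2norm f"
    by (auto intro: l2norm_leI(1) l2norm_leI(2))
qed

lemma kapp_add:
  assumes "bnd C K" "l2 f" "l2 g"
  shows "kapp K (\<lambda>y. f y + g y) x = kapp K f x + kapp K g x"
  unfolding kapp_def using kapp_summable[OF assms(1,2), of x] kapp_summable[OF assms(1,3), of x]
  by (simp add: distrib_left infsum_add)

lemma kapp_finite_support:
  assumes "finite B" "\<And>y. y \<notin> B \<Longrightarrow> f y = 0"
  shows "kapp K f x = (\<Sum>y\<in>B. K x y * f y)"
  unfolding kapp_def by (rule infsumI, rule has_sum_finite_neutralI) (use assms in auto)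

lemma infsum_kapp_exchange:
  assumes "l2 g" "bnd D L" "l2 f"
  shows "infsum (\<lambda>x. g x * kapp L f x) UNIV = infsum (\<lambda>y. infsum (\<lambda>x. g x * L x y) UNIV * f y) UNIV"
    (is "?l = ?r")
proof -
  define h where "h = (\<lambda>y. infsum (\<lambda>x. g x * L x y) UNIV)"
  have hk: "h = kapp (\<lambda>y x. L x y) g" by (auto simp: h_def kapp_def mult.commute)
  have h: "l2 h" "l2norm h \<le> D * l2norm g"
    using kapp_l2[OF bnd_transpose[OF assms(2)] assms(1)] by (simp_all add: hk)
  have D: "0 \<le> D" using assms(2) by (rule bnd_nonneg)
  have *: "cmod (?l - ?r) \<le> 2 * D * l2norm g * e" if e: "e > 0" for e
  proof -
    obtain B where B: "finite B" "l2norm (\<lambda>x. if x \<in> B then 0 else f x) \<le> e"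
    proof (rule l2_tail[OF assms(3) e])
      fix B0 assume "finite B0" "\<And>B. B0 \<subseteq> B \<Longrightarrow> l2norm (\<lambda>x. if x \<in> B then 0 else f x) \<le> e"
      then show thesis by (intro that[of B0]) auto
    qed
    define f1 where "f1 = (\<lambda>x. if x \<in> B then f x else 0)"
    define f2 where "f2 = (\<lambda>x. if x \<in> B then 0 else f x)"
    have l1: "l2 f1" using B(1) by (rule l2_finite_support(1)) (auto simp: f1_def)
    have l2': "l2 f2" by (rule l2_dominated(1)[OF assms(3)]) (auto simp: f2_def)
    have n2: "l2norm f2 \<le> e" using B(2) by (simp add: f2_def)
    have feq: "f = (\<lambda>x. f1 x + f2 x)" by (auto simp: f1_def f2_def)
    have A: "kapp L f x = kapp L f1 x + kapp L f2 x" for x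
      by (subst feq) (rule kapp_add[OF assms(2) l1 l2'])
    have s: "(\<lambda>x. g x * kapp L f1 x) summable_on UNIV" "(\<lambda>x. g x * kapp L f2 x) summable_on UNIV"
      by (intro l2_prod assms kapp_l2(1)[OF assms(2)] l1 l2')+
    have lsplit: "?l = infsum (\<lambda>x. g x * kapp L f1 x) UNIV + infsum (\<lambda>x. g x * kapp L f2 x) UNIV"
      unfolding A by (simp add: distrib_left infsum_add s)
    have s': "(\<lambda>y. h y * f1 y) summable_on UNIV" "(\<lambda>y. h y * f2 y) summable_on UNIV"
      by (intro l2_prod h l1 l2')+
    have "?r = infsum (\<lambda>y. h y * f1 y + h y * f2 y) UNIV"
      unfolding h_def by (subst feq) (simp add: distrib_left)
    then have rsplit: "?r = infsum (\<lambda>y. h y * f1 y) UNIV + infsum (\<lambda>y. h y * f2 y) UNIV"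
      by (simp add: infsum_add s')
    have "((\<lambda>x. \<Sum>y\<in>B. g x * L x y * f1 y) has_sum (\<Sum>y\<in>B. h y * f1 y)) UNIV"
      unfolding h_def
      by (intro has_sum_sum has_sum_cmult_left has_sum_infsum l2_prod assms bnd_col(1)[OF assms(2)])
    then have "infsum (\<lambda>x. g x * kapp L f1 x) UNIV = (\<Sum>y\<in>B. h y * f1 y)"
    proof (intro infsumI)
      have "kapp L f1 x = (\<Sum>y\<in>B. L x y * f1 y)" for x
        by (rule kapp_finite_support[OF B(1)]) (simp add: f1_def)
      then show "((\<lambda>x. \<Sum>y\<in>B. g x * L x y * f1 y) has_sum s) UNIV \<Longrightarrow> ((\<lambda>x. g x * kapp L f1 x) has_sum s) UNIV" for s
        by (simp add: sum_distrib_left mult.assoc)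
    qed
    also have "\<dots> = infsum (\<lambda>y. h y * f1 y) UNIV"
      by (rule infsumI[symmetric], rule has_sum_finite_neutralI) (use B in \<open>auto simp: f1_def\<close>)
    finally have "?l - ?r = infsum (\<lambda>x. g x * kapp L f2 x) UNIV - infsum (\<lambda>y. h y * f2 y) UNIV"
      unfolding lsplit rsplit by simp
    also have "cmod \<dots> \<le> l2norm g * l2norm (kapp L f2) + l2norm h * l2norm f2"
      by (rule order_trans[OF norm_triangle_ineq4])
        (intro add_mono l2_prod(2) assms h kapp_l2(1)[OF assms(2)] l2')
    also have "\<dots> \<le> l2norm g * (D * e) + (D * l2norm g) * e"
      using D by (intro add_mono mult_mono h n2 order_trans[OF kapp_l2(2)[OF assms(2) l2']]) auto
    finally show ?thesis by (simp add: ac_simps)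
  qed
  \<comment> \<open>The estimate is used with \<open>e\<close> divided by its constant; the added 1
    covers a vanishing constant.\<close>
  have "cmod (?l - ?r) \<le> 0 + e" if "e > 0" for e
  proof -
    have p: "0 < 2 * D * l2norm g + 1" using D by (intro add_nonneg_pos mult_nonneg_nonneg) auto
    have "cmod (?l - ?r) \<le> 2 * D * l2norm g * (e / (2 * D * l2norm g + 1))"
      using p that by (intro *) simp
    also have "\<dots> \<le> e" using p that D by (simp add: field_simps)
    finally show ?thesis by simp
  qed
  then have "cmod (?l - ?r) \<le> 0" by (rule field_le_epsilon)
  then show ?thesis by simp
qed

lemma kapp_rmul:
  assumes "bnd C K" "bnd D L" "l2 f"
  shows "kapp K (kapp L f) = kapp (rmul K L) f"
proof
  fix x
  show "kapp K (kapp L f) x = kapp (rmul K L) f x"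
    using infsum_kapp_exchange[OF bnd_row(1)[OF assms(1), of x] assms(2,3)]
    by (simp add: kapp_def rmul_def)
qed

lemma rmul_kapp: "rmul K L x z = kapp K (\<lambda>y. L y z) x"
  by (simp add: rmul_def kapp_def)

lemma rmul_assoc:
  assumes "bnd C K" "bnd D L" "bnd E M"
  shows "rmul (rmul K L) M = rmul K (rmul L M)"
proof (intro ext)
  fix x z
  have "rmul (rmul K L) M x z = kapp K (kapp L (\<lambda>y. M y z)) x"
    unfolding rmul_kapp[of "rmul K L"] by (subst kapp_rmul[OF assms(1,2) bnd_col(1)[OF assms(3)]]) simp
  then show "rmul (rmul K L) M x z = rmul K (rmul L M) x z" by (simp add: rmul_def kapp_def)
qed

text \<open>A finite combination of columns of \<open>rmul K L\<close> is \<open>K\<close> applied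
  to the same combination \<open>v\<close> of columns of \<open>L\<close>. The vector
  \<open>v\<close> is square summable but in general not finitely supported, so the estimate goes
  through \<open>kapp_l2\<close>.\<close>

lemma bnd_rmul:
  assumes "bnd C K" "bnd D L"
  shows "bnd (C * D) (rmul K L)"
proof (rule bndI)
  fix A B f assume f: "finite (A::'a set)" "finite (B::'c set)"
  define v where "v = (\<lambda>y. \<Sum>z\<in>B. L y z * f z)"
  have v: "l2 v" "l2norm v \<le> D * fnorm f B"
    using bnd_fnorm[OF assms(2) _ f(2), of _ f] unfolding v_def
    by (auto intro!: l2norm_leI(1)[where C="D * fnorm f B"] l2norm_leI(2))
  have "(\<Sum>z\<in>B. rmul K L x z * f z) = kapp K v x" for x
  proof -
    have "((\<lambda>y. \<Sum>z\<in>B. K x y * L y z * f z) has_sum (\<Sum>z\<in>B. rmul K L x z * f z)) UNIV"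
      unfolding rmul_def
      by (intro has_sum_sum has_sum_cmult_left has_sum_infsum l2_prod bnd_row(1)[OF assms(1)] bnd_col(1)[OF assms(2)])
    then show ?thesis unfolding kapp_def v_def by (simp add: has_sum_iff sum_distrib_left mult.assoc)
  qed
  then have "fnorm (\<lambda>x. \<Sum>z\<in>B. rmul K L x z * f z) A = fnorm (kapp K v) A" by simp
  also have "\<dots> \<le> l2norm (kapp K v)" by (intro fnorm_le_l2norm kapp_l2(1)[OF assms(1)] v)
  also have "\<dots> \<le> C * l2norm v" by (rule kapp_l2[OF assms(1) v(1)])
  also have "\<dots> \<le> C * (D * fnorm f B)" using bnd_nonneg[OF assms(1)] v by (intro mult_left_mono) auto
  finally show "fnorm (\<lambda>x. \<Sum>z\<in>B. rmul K L x z * f z) A \<le> C * D * fnorm f B" by (simp add: mult.assoc)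
qed (use bnd_nonneg[OF assms(1)] bnd_nonneg[OF assms(2)] in simp)

lemma bnd_add:
  assumes "bnd C K" "bnd D L"
  shows "bnd (C + D) (\<lambda>x y. K x y + L x y)"
proof (rule bndI)
  fix A B f assume f: "finite (A::'a set)" "finite (B::'b set)"
  have "fnorm (\<lambda>x. \<Sum>y\<in>B. (K x y + L x y) * f y) A
    = fnorm (\<lambda>x. (\<Sum>y\<in>B. K x y * f y) + (\<Sum>y\<in>B. L x y * f y)) A"
    by (simp add: distrib_right sum.distrib)
  also have "\<dots> \<le> C * fnorm f B + D * fnorm f B"
    by (rule order_trans[OF fnorm_add]) (intro add_mono bnd_fnorm assms f)
  finally show "fnorm (\<lambda>x. \<Sum>y\<in>B. (K x y + L x y) * f y) A \<le> (C + D) * fnorm f B"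
    by (simp add: distrib_right)
qed (use assms bnd_nonneg in \<open>auto intro!: mult_nonneg_nonneg add_nonneg_nonneg\<close>)

lemma bnd_scale:
  assumes "bnd C K"
  shows "bnd (cmod c * C) (\<lambda>x y. c * K x y)"
proof (rule bndI)
  fix A B f assume f: "finite (A::'a set)" "finite (B::'b set)"
  have "fnorm (\<lambda>x. \<Sum>y\<in>B. c * K x y * f y) A = cmod c * fnorm (\<lambda>x. \<Sum>y\<in>B. K x y * f y) A"
    by (simp add: mult.assoc sum_distrib_left[symmetric] fnorm_scale)
  also have "\<dots> \<le> cmod c * (C * fnorm f B)" by (intro mult_left_mono bnd_fnorm assms f) auto
  finally show "fnorm (\<lambda>x. \<Sum>y\<in>B. c * K x y * f y) A \<le> cmod c * C * fnorm f B" by (simp add: mult.assoc)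
qed (use assms bnd_nonneg in \<open>auto intro!: mult_nonneg_nonneg add_nonneg_nonneg\<close>)

lemma bnd_diff:
  assumes "bnd C K" "bnd D L"
  shows "bnd (C + D) (\<lambda>x y. K x y - L x y)"
  using bnd_add[OF assms(1) bnd_scale[OF assms(2), of "-1"]] by simp

lemma bnd_restrict:
  assumes "bnd C K"
  shows "bnd C (\<lambda>x y. if x \<in> P \<and> y \<in> Q then K x y else 0)"
  unfolding bnd_def
proof (intro conjI allI impI)
  fix A B f g assume f: "finite (A::'a set)" "finite (B::'b set)"
  have "(\<Sum>x\<in>A. \<Sum>y\<in>B. g x * (if x \<in> P \<and> y \<in> Q then K x y else 0) * f y)
    = (\<Sum>x\<in>A \<inter> P. \<Sum>y\<in>B \<inter> Q. g x * K x y * f y)"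
    using f by (intro sum.mono_neutral_cong_right) (auto intro!: sum.mono_neutral_cong_right)
  then have "cmod (\<Sum>x\<in>A. \<Sum>y\<in>B. g x * (if x \<in> P \<and> y \<in> Q then K x y else 0) * f y)
     \<le> C * fnorm g (A \<inter> P) * fnorm f (B \<inter> Q)"
    using bndD[OF assms, of "A \<inter> P" "B \<inter> Q" g f] f by simp
  also have "\<dots> \<le> C * fnorm g A * fnorm f B"
    using bnd_nonneg[OF assms] f by (intro mult_mono fnorm_mono) auto
  finally show "cmod (\<Sum>x\<in>A. \<Sum>y\<in>B. g x * (if x \<in> P \<and> y \<in> Q then K x y else 0) * f y)
    \<le> C * fnorm g A * fnorm f B" .
qed (use assms bnd_nonneg in \<open>auto intro!: mult_nonneg_nonneg add_nonneg_nonneg\<close>)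

lemma bnd_rank1:
  assumes "l2 u" "l2 v"
  shows "bnd (l2norm u * l2norm v) (\<lambda>x y. u x * v y)"
proof (rule bndI)
  fix A B f assume f: "finite (A::'a set)" "finite (B::'b set)"
  have "fnorm (\<lambda>x. \<Sum>y\<in>B. u x * v y * f y) A = fnorm (\<lambda>x. (\<Sum>y\<in>B. v y * f y) * u x) A"
    by (simp add: sum_distrib_left ac_simps)
  also have "\<dots> = cmod (\<Sum>y\<in>B. v y * f y) * fnorm u A" by (rule fnorm_scale)
  also have "\<dots> \<le> (fnorm v B * fnorm f B) * fnorm u A"
    by (intro mult_right_mono fnorm_CS) auto
  also have "\<dots> \<le> (l2norm v * fnorm f B) * l2norm u"
    by (intro mult_mono fnorm_le_l2norm assms) auto
  finally show "fnorm (\<lambda>x. \<Sum>y\<in>B. u x * v y * f y) A \<le> l2norm u * l2norm v * fnorm f B"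
    by (simp add: ac_simps)
qed (auto)

text \<open>This lets a norm bound on all partial sums pass to a series that is only known to
  converge entrywise.\<close>

lemma bnd_limit:
  assumes "\<And>n. bnd C (K n)" "\<And>x y. (\<lambda>n::nat. K n x y) \<longlonglongrightarrow> L x y"
  shows "bnd C L"
  unfolding bnd_def
proof (intro conjI allI impI)
  fix A B f g assume f: "finite (A::'a set)" "finite (B::'b set)"
  show "cmod (\<Sum>x\<in>A. \<Sum>y\<in>B. g x * L x y * f y) \<le> C * fnorm g A * fnorm f B"
  proof (rule tendsto_upperbound)
    show "(\<lambda>n. cmod (\<Sum>x\<in>A. \<Sum>y\<in>B. g x * K n x y * f y)) \<longlonglongrightarrow> cmod (\<Sum>x\<in>A. \<Sum>y\<in>B. g x * L x y * f y)"
      by (intro tendsto_intros assms)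
    show "\<forall>\<^sub>F n in sequentially. cmod (\<Sum>x\<in>A. \<Sum>y\<in>B. g x * K n x y * f y) \<le> C * fnorm g A * fnorm f B"
      using bndD[OF assms(1) f] by simp
  qed simp
qed (use assms bnd_nonneg in blast)

text \<open>Weighted partial bijections. Weights of modulus at most 1, rather than equal to 1, admit
  diagonal matrices of signs and keep the class closed under cutting down and under joining pieces
  with disjoint rows and columns.\<close>

definition partial_perm :: "('i \<Rightarrow> 'j \<Rightarrow> complex) \<Rightarrow> bool" where
  "partial_perm a \<longleftrightarrow> (\<forall>x y. cmod (a x y) \<le> 1) \<and>
     (\<forall>x y y'. a x y \<noteq> 0 \<longrightarrow> a x y' \<noteq> 0 \<longrightarrow> y = y') \<and>
     (\<forall>x x' y. a x y \<noteq> 0 \<longrightarrow> a x' y \<noteq> 0 \<longrightarrow> x = x')"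

text \<open>The positions of nonzero entries project injectively to both coordinates, so
  Cauchy-Schwarz over these positions meets each coordinate of \<open>f\<close> and of
  \<open>g\<close> at most once.\<close>

lemma bnd_partial_perm:
  assumes "partial_perm a"
  shows "bnd 1 a"
  unfolding bnd_def
proof (intro conjI allI impI)
  fix A B f g assume f: "finite (A::'a set)" "finite (B::'b set)"
  define P where "P = {p \<in> A \<times> B. a (fst p) (snd p) \<noteq> 0}"
  have fP: "finite P" unfolding P_def using f by (intro finite_subset[OF _ finite_cartesian_product]) auto
  have i: "inj_on fst P" "inj_on snd P"
    using assms by (auto simp: inj_on_def P_def partial_perm_def)
  have "(\<Sum>x\<in>A. \<Sum>y\<in>B. g x * a x y * f y) = (\<Sum>p\<in>A \<times> B. g (fst p) * a (fst p) (snd p) * f (snd p))"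
    by (simp add: sum.cartesian_product case_prod_beta)
  also have "\<dots> = (\<Sum>p\<in>P. g (fst p) * (a (fst p) (snd p) * f (snd p)))"
    using f by (intro sum.mono_neutral_cong_right) (auto simp: P_def mult.assoc)
  finally have "cmod (\<Sum>x\<in>A. \<Sum>y\<in>B. g x * a x y * f y)
     \<le> fnorm (\<lambda>p. g (fst p)) P * fnorm (\<lambda>p. a (fst p) (snd p) * f (snd p)) P"
    by (simp add: fnorm_CS)
  also have "\<dots> \<le> fnorm (\<lambda>p. g (fst p)) P * fnorm (\<lambda>p. f (snd p)) P"
    using assms by (intro mult_left_mono L2_set_mono)
      (auto simp: norm_mult partial_perm_def intro!: mult_left_le_one_le)
  also have "fnorm (\<lambda>p. g (fst p)) P = fnorm g (fst ` P)"
    unfolding L2_set_def using i by (simp add: sum.reindex)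
  also have "fnorm (\<lambda>p. f (snd p)) P = fnorm f (snd ` P)"
    unfolding L2_set_def using i by (simp add: sum.reindex)
  also have "fnorm g (fst ` P) * fnorm f (snd ` P) \<le> fnorm g A * fnorm f B"
    using f by (intro mult_mono fnorm_mono) (auto simp: P_def)
  finally show "cmod (\<Sum>x\<in>A. \<Sum>y\<in>B. g x * a x y * f y) \<le> 1 * fnorm g A * fnorm f B" by simp
qed simp

section \<open>Operators and uniform Roe algebras\<close>

definition supp_on :: "'a set \<Rightarrow> 'a cmat \<Rightarrow> bool" where
  "supp_on S a \<longleftrightarrow> (\<forall>x y. a x y \<noteq> 0 \<longrightarrow> x \<in> S \<and> y \<in> S)"

lemma supp_on_add: "supp_on S a \<Longrightarrow> supp_on S b \<Longrightarrow> supp_on S (\<lambda>x y. a x y + b x y)"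
  unfolding supp_on_def by (metis add_0)

lemma supp_on_diff: "supp_on S a \<Longrightarrow> supp_on S b \<Longrightarrow> supp_on S (\<lambda>x y. a x y - b x y)"
  unfolding supp_on_def by (metis diff_self)

lemma mmul_rmul: "mmul a b = rmul a b"
  by (simp add: mmul_def rmul_def)

lemma mvec_kapp: "mvec a f = kapp a f"
  by (simp add: mvec_def kapp_def)

lemma madj_kadj: "madj a = kadj a"
  by (simp add: madj_def kadj_def)

lemma l2vec_iff: "l2vec S f \<longleftrightarrow> (\<forall>x. x \<notin> S \<longrightarrow> f x = 0) \<and> l2 f"
  by (simp add: l2vec_def l2_def)

lemma opnorm_le:
  assumes "bnd C a"
  shows "opnorm S a \<le> C"
  unfolding opnorm_def
proof (rule cSup_least)
  have "l2vec S (\<lambda>_. 0) \<and> l2norm (\<lambda>_. 0) \<le> 1" by (simp add: l2vec_def l2norm_def)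
  then show "{l2norm (mvec a f) |f. l2vec S f \<and> l2norm f \<le> 1} \<noteq> {}" by blast
  fix r assume "r \<in> {l2norm (mvec a f) |f. l2vec S f \<and> l2norm f \<le> 1}"
  then obtain f where f: "r = l2norm (kapp a f)" "l2 f" "l2norm f \<le> 1"
    by (auto simp: mvec_kapp l2vec_iff)
  have "r \<le> C * l2norm f" unfolding f(1) by (rule kapp_l2[OF assms f(2)])
  also have "\<dots> \<le> C" using f(3) bnd_nonneg[OF assms] by (simp add: mult_left_le)
  finally show "r \<le> C" .
qed

text \<open>\<open>opnorm\<close> is a supremum over the unit ball, finite because \<open>a\<close>
  is bounded; rescaling makes it a homogeneous estimate. A finite test vector is first cut down to
  \<open>S\<close>, which \<open>a\<close> does not notice.\<close>

lemma bounded_op_bnd: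
  assumes "bounded_op S a"
  shows "bnd (opnorm S a) a"
proof -
  have supp: "a x y = 0" if "x \<notin> S \<or> y \<notin> S" for x y
    using assms that by (auto simp: bounded_op_def)
  obtain C where C: "\<And>f. l2vec S f \<Longrightarrow> l2 (mvec a f) \<and> l2norm (mvec a f) \<le> C * l2norm f"
    using assms unfolding bounded_op_def l2vec_iff[of S "mvec a _"] by blast
  let ?M = "{l2norm (mvec a f) |f. l2vec S f \<and> l2norm f \<le> 1}"
  have bdd: "bdd_above ?M"
  proof (rule bdd_aboveI[of _ "\<bar>C\<bar>"])
    fix r assume "r \<in> ?M"
    then obtain f where f: "r = l2norm (mvec a f)" "l2vec S f" "l2norm f \<le> 1" by auto
    have "r \<le> C * l2norm f" using C[OF f(2)] f(1) by simp
    also have "\<dots> \<le> \<bar>C\<bar> * 1" using f(3) by (intro mult_mono) auto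
    finally show "r \<le> \<bar>C\<bar>" by simp
  qed
  have le: "l2norm (mvec a f) \<le> opnorm S a" if "l2vec S f" "l2norm f \<le> 1" for f
    unfolding opnorm_def by (rule cSup_upper[OF _ bdd]) (use that in auto)
  have nn: "0 \<le> opnorm S a"
    using le[of "\<lambda>_. 0"] by (simp add: l2vec_def l2norm_def mvec_def)
  have main: "l2norm (mvec a f) \<le> opnorm S a * l2norm f" if f: "l2vec S f" for f
  proof (cases "l2norm f = 0")
    case True
    then show ?thesis using C[OF f] by simp
  next
    case False
    define c where "c = complex_of_real (inverse (l2norm f))"
    have n: "l2norm f > 0" using False by (simp add: less_le)
    have "l2norm (mvec a (\<lambda>y. c * f y)) \<le> opnorm S a"
      using f n by (intro le) (auto simp: l2vec_iff l2_scale l2norm_scale c_def norm_inverse)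
    moreover have "mvec a (\<lambda>y. c * f y) = (\<lambda>x. c * mvec a f x)"
      by (simp add: mvec_def mult.left_commute infsum_cmult_right')
    ultimately have "cmod c * l2norm (mvec a f) \<le> opnorm S a" by (simp add: l2norm_scale)
    moreover have "cmod c = inverse (l2norm f)" using n by (simp add: c_def norm_inverse)
    ultimately show ?thesis using n by (simp add: field_simps)
  qed
  show ?thesis
  proof (rule bndI[OF nn])
    fix A B and f :: "'a \<Rightarrow> complex" assume fin: "finite (A::'a set)" "finite (B::'a set)"
    define f' where "f' = (\<lambda>y. if y \<in> B \<inter> S then f y else 0)"
    have f': "l2 f'" "l2norm f' = fnorm f' B"
      by (rule l2_finite_support[OF fin(2)], simp add: f'_def)+
    have v: "l2vec S f'" by (auto simp: l2vec_iff f') (simp add: f'_def)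
    have eq: "(\<Sum>y\<in>B. a x y * f y) = mvec a f' x" for x
    proof -
      have "mvec a f' x = (\<Sum>y\<in>B. a x y * f' y)" unfolding mvec_kapp
        by (rule kapp_finite_support[OF fin(2)]) (simp add: f'_def)
      then show ?thesis by (simp only:) (rule sum.cong, auto simp: f'_def supp)
    qed
    have "fnorm (\<lambda>x. \<Sum>y\<in>B. a x y * f y) A \<le> l2norm (mvec a f')"
      unfolding eq using C[OF v] by (intro fnorm_le_l2norm) simp
    also have "\<dots> \<le> opnorm S a * fnorm f' B" using main[OF v] f' by simp
    also have "\<dots> \<le> opnorm S a * fnorm f B"
      using nn by (intro mult_left_mono L2_set_mono) (auto simp: f'_def)
    finally show "fnorm (\<lambda>x. \<Sum>y\<in>B. a x y * f y) A \<le> opnorm S a * fnorm f B" .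
  qed
qed

lemma bounded_op_iff: "bounded_op S a \<longleftrightarrow> supp_on S a \<and> (\<exists>C. bnd C a)"
proof
  assume "bounded_op S a"
  then show "supp_on S a \<and> (\<exists>C. bnd C a)"
    using bounded_op_bnd by (auto simp: supp_on_def bounded_op_def)
next
  assume a: "supp_on S a \<and> (\<exists>C. bnd C a)"
  then obtain C where C: "bnd C a" by blast
  have z: "mvec a f x = 0" if "x \<notin> S" for f x
  proof -
    have "a x y = 0" for y using a that by (auto simp: supp_on_def)
    then show ?thesis by (simp add: mvec_def)
  qed
  have "\<forall>f. l2vec S f \<longrightarrow> (\<forall>x. (\<lambda>y. a x y * f y) summable_on UNIV) \<and>
           l2vec S (mvec a f) \<and> l2norm (mvec a f) \<le> C * l2norm f"
    using kapp_l2[OF C] kapp_summable[OF C] z by (simp add: l2vec_iff mvec_kapp)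
  with a show "bounded_op S a" by (auto simp: bounded_op_def supp_on_def)
qed

lemma bounded_opI: "supp_on S a \<Longrightarrow> bnd C a \<Longrightarrow> bounded_op S a"
  by (auto simp: bounded_op_iff)

lemma roeI:
  assumes "supp_on S a" "bnd C a"
    and "\<And>e. e > 0 \<Longrightarrow> \<exists>b D. supp_on S b \<and> bnd D b \<and> fin_prop d b \<and> bnd e (\<lambda>x y. a x y - b x y)"
  shows "a \<in> roe S d"
  unfolding roe_def mem_Collect_eq
proof (intro conjI allI impI bounded_opI[OF assms(1,2)])
  fix e :: real assume "e > 0"
  then obtain b D where "supp_on S b" "bnd D b" "fin_prop d b" "bnd e (\<lambda>x y. a x y - b x y)"
    using assms(3) by blast
  then show "\<exists>b. bounded_op S b \<and> fin_prop d b \<and> opnorm S (msub a b) \<le> e"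
    by (intro exI[of _ b]) (simp add: bounded_opI msub_def opnorm_le)
qed

lemma roe_approx:
  assumes "a \<in> roe S d" "e > 0"
  obtains b r where "supp_on S b" "bounded_op S b" "propg_le d b r" "bnd e (\<lambda>x y. a x y - b x y)"
proof -
  obtain b where b: "bounded_op S b" "fin_prop d b" "opnorm S (msub a b) \<le> e"
    using assms by (auto simp: roe_def)
  obtain C D where "bnd C a" "bnd D b" "supp_on S a" "supp_on S b"
    using assms(1) b(1) by (auto simp: roe_def bounded_op_iff)
  then have "bounded_op S (msub a b)"
    unfolding msub_def by (intro bounded_opI[OF _ bnd_diff] supp_on_diff)
  from bnd_mono[OF bounded_op_bnd[OF this] b(3)] have "bnd e (\<lambda>x y. a x y - b x y)"
    by (simp add: msub_def)
  with b that \<open>supp_on S b\<close> show thesis by (auto simp: fin_prop_def)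
qed

lemma roe_supp: "a \<in> roe S d \<Longrightarrow> supp_on S a"
  by (auto simp: roe_def bounded_op_iff)

lemma roe_bnd: "a \<in> roe S d \<Longrightarrow> bnd (opnorm S a) a"
  by (auto simp: roe_def bounded_op_bnd)

lemma fin_prop_roe:
  assumes "supp_on S a" "bnd C a" "fin_prop d a"
  shows "a \<in> roe S d"
  by (rule roeI[OF assms(1,2)])
    (use assms in \<open>auto intro!: exI[of _ a] bnd_mono[of 0] simp: bnd_def\<close>)

lemma fin_prop_finite:
  assumes "finite F" "\<And>x y. a x y \<noteq> 0 \<Longrightarrow> x \<in> F \<and> y \<in> F"
  shows "fin_prop d a"
proof -
  have "bdd_above ((\<lambda>p. d (fst p) (snd p)) ` (F \<times> F))"
    using assms(1) by (intro bdd_above_finite) auto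
  then obtain r where "\<And>p. p \<in> F \<times> F \<Longrightarrow> d (fst p) (snd p) \<le> r"
    unfolding bdd_above_def by blast
  then show ?thesis using assms(2) unfolding fin_prop_def propg_le_def
    by (intro exI[of _ r]) force
qed

lemma roe_limit:
  assumes "supp_on S a" and "\<And>e. e > 0 \<Longrightarrow> \<exists>b\<in>roe S d. bnd e (\<lambda>x y. a x y - b x y)"
  shows "a \<in> roe S d"
proof -
  obtain b where b: "b \<in> roe S d" "bnd 1 (\<lambda>x y. a x y - b x y)" using assms(2)[of 1] by auto
  have C: "bnd (opnorm S b + 1) a" using bnd_add[OF roe_bnd[OF b(1)] b(2)] by simp
  show ?thesis
  proof (rule roeI[OF assms(1) C])
    fix e :: real assume e: "e > 0"
    obtain b where b: "b \<in> roe S d" "bnd (e/2) (\<lambda>x y. a x y - b x y)" using assms(2)[of "e/2"] e by auto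
    obtain c r where c: "supp_on S c" "bounded_op S c" "propg_le d c r" "bnd (e/2) (\<lambda>x y. b x y - c x y)"
      using roe_approx[OF b(1), of "e/2"] e by auto
    have "bnd e (\<lambda>x y. a x y - c x y)" using bnd_add[OF b(2) c(4)] by simp
    with c show "\<exists>b D. supp_on S b \<and> bnd D b \<and> fin_prop d b \<and> bnd e (\<lambda>x y. a x y - b x y)"
      by (auto simp: bounded_op_iff fin_prop_def)
  qed
qed

text \<open>Truncating both vectors to finite sets gives a finite matrix, which has finite
  propagation for any \<open>d\<close>, and changes the operator by little in norm.\<close>

lemma roe_rank1:
  assumes "l2vec S u" "l2vec S v"
  shows "(\<lambda>x y. u x * v y) \<in> roe S d"
proof (rule roeI)
  have u: "l2 u" "\<And>x. u x \<noteq> 0 \<Longrightarrow> x \<in> S" and v: "l2 v" "\<And>x. v x \<noteq> 0 \<Longrightarrow> x \<in> S"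
    using assms by (auto simp: l2vec_iff)
  show "supp_on S (\<lambda>x y. u x * v y)" using u v by (auto simp: supp_on_def)
  show "bnd (l2norm u * l2norm v) (\<lambda>x y. u x * v y)" by (rule bnd_rank1[OF u(1) v(1)])
  fix e :: real assume e: "e > 0"
  \<comment> \<open>Truncating each vector with error \<open>k\<close> costs at most
    \<open>k * (l2norm u + l2norm v)\<close>; the added 1 keeps the denominator positive.\<close>
  define k where "k = e / (l2norm u + l2norm v + 1)"
  have den: "l2norm u + l2norm v + 1 > 0" by (simp add: add_nonneg_pos)
  have k: "k > 0" using e den by (simp add: k_def)
  have ex: "\<exists>B. finite B \<and> l2norm (\<lambda>x. if x \<in> B then 0 else w x) \<le> k" if "l2 w" for w :: "'a \<Rightarrow> complex"
    using l2_tail[OF that k] by (metis order_refl)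
  obtain B1 B2 where B: "finite B1" "l2norm (\<lambda>x. if x \<in> B1 then 0 else u x) \<le> k"
      "finite B2" "l2norm (\<lambda>x. if x \<in> B2 then 0 else v x) \<le> k"
    using ex[OF u(1)] ex[OF v(1)] by blast
  define u1 where "u1 = (\<lambda>x. if x \<in> B1 then 0 else u x)"
  define u2 where "u2 = (\<lambda>x. if x \<in> B1 then u x else 0)"
  define v1 where "v1 = (\<lambda>x. if x \<in> B2 then 0 else v x)"
  define v2 where "v2 = (\<lambda>x. if x \<in> B2 then v x else 0)"
  have l: "l2 u1" "l2 u2" "l2norm u2 \<le> l2norm u"
    by (auto intro: l2_dominated(1)[OF u(1)] l2_dominated(2)[OF u(1)] simp: u1_def u2_def)
  have l': "l2 v1" "l2 v2"
    by (auto intro: l2_dominated(1)[OF v(1)] simp: v1_def v2_def)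
  have ue: "u = (\<lambda>x. u1 x + u2 x)" and ve: "v = (\<lambda>x. v1 x + v2 x)"
    by (auto simp: u1_def u2_def v1_def v2_def)
  have 1: "supp_on S (\<lambda>x y. u2 x * v2 y)" using u v by (auto simp: supp_on_def u2_def v2_def)
  have 2: "bnd (l2norm u2 * l2norm v2) (\<lambda>x y. u2 x * v2 y)" by (rule bnd_rank1[OF l(2) l'(2)])
  have 3: "fin_prop d (\<lambda>x y. u2 x * v2 y)"
    by (rule fin_prop_finite[of "B1 \<union> B2"]) (use B in \<open>auto simp: u2_def v2_def split: if_splits\<close>)
  have eq: "u x * v y - u2 x * v2 y = u1 x * v y + u2 x * v1 y" for x y
    by (simp add: u1_def u2_def v1_def v2_def)
  have "bnd (l2norm u1 * l2norm v + l2norm u2 * l2norm v1) (\<lambda>x y. u x * v y - u2 x * v2 y)"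
    unfolding eq by (intro bnd_add bnd_rank1 l l' v)
  moreover have "l2norm u1 * l2norm v + l2norm u2 * l2norm v1 \<le> e"
  proof -
    have "l2norm u1 * l2norm v + l2norm u2 * l2norm v1 \<le> k * l2norm v + l2norm u * k"
      using B l by (intro add_mono mult_mono) (auto simp: u1_def v1_def k less_imp_le)
    also have "\<dots> = k * (l2norm u + l2norm v)" by (simp add: algebra_simps)
    also have "\<dots> \<le> k * (l2norm u + l2norm v + 1)" using k by (intro mult_left_mono) auto
    also have "\<dots> = e" using den by (simp add: k_def)
    finally show ?thesis .
  qed
  ultimately have "bnd e (\<lambda>x y. u x * v y - u2 x * v2 y)" by (rule bnd_mono)
  with 1 2 3 show "\<exists>b D. supp_on S b \<and> bnd D b \<and> fin_prop d b \<and> bnd e (\<lambda>x y. u x * v y - b x y)"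
    by blast
qed

lemma roe_add:
  assumes "a \<in> roe S d" "b \<in> roe S d"
  shows "madd a b \<in> roe S d"
  unfolding madd_def
proof (rule roeI)
  show "supp_on S (\<lambda>x y. a x y + b x y)" by (intro supp_on_add roe_supp[OF assms(1)] roe_supp[OF assms(2)])
  show "bnd (opnorm S a + opnorm S b) (\<lambda>x y. a x y + b x y)"
    by (intro bnd_add roe_bnd[OF assms(1)] roe_bnd[OF assms(2)])
  fix e :: real assume e: "e > 0"
  obtain a' r where a': "supp_on S a'" "bounded_op S a'" "propg_le d a' r" "bnd (e/2) (\<lambda>x y. a x y - a' x y)"
    using roe_approx[OF assms(1), of "e/2"] e by auto
  obtain b' r' where b': "supp_on S b'" "bounded_op S b'" "propg_le d b' r'" "bnd (e/2) (\<lambda>x y. b x y - b' x y)"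
    using roe_approx[OF assms(2), of "e/2"] e by auto
  have "supp_on S (\<lambda>x y. a' x y + b' x y)" using a'(1) b'(1) by (rule supp_on_add)
  moreover obtain D where "bnd D (\<lambda>x y. a' x y + b' x y)"
    using bnd_add[OF bounded_op_bnd[OF a'(2)] bounded_op_bnd[OF b'(2)]] by blast
  moreover have "propg_le d (\<lambda>x y. a' x y + b' x y) (max r r')"
    using a'(3) b'(3) unfolding propg_le_def by (metis add.right_neutral add_0 max.coboundedI1 max.coboundedI2)
  moreover have "bnd e (\<lambda>x y. a x y + b x y - (a' x y + b' x y))"
    using bnd_add[OF a'(4) b'(4)] by (simp add: algebra_simps)
  ultimately show "\<exists>c D. supp_on S c \<and> bnd D c \<and> fin_prop d c \<and> bnd e (\<lambda>x y. a x y + b x y - c x y)"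
    by (auto simp: fin_prop_def)
qed

lemma roe_scale:
  assumes "a \<in> roe S d"
  shows "msmul c a \<in> roe S d"
  unfolding msmul_def
proof (rule roeI)
  show "supp_on S (\<lambda>x y. c * a x y)" using roe_supp[OF assms] by (auto simp: supp_on_def)
  show "bnd (cmod c * opnorm S a) (\<lambda>x y. c * a x y)" by (rule bnd_scale[OF roe_bnd[OF assms]])
  fix e :: real assume e: "e > 0"
  have p: "cmod c + 1 > 0" by (simp add: add_nonneg_pos)
  have pe: "e / (cmod c + 1) > 0" using p e by simp
  obtain a' r where a': "supp_on S a'" "bounded_op S a'" "propg_le d a' r"
      "bnd (e / (cmod c + 1)) (\<lambda>x y. a x y - a' x y)"
    by (rule roe_approx[OF assms pe])
  have "bnd (cmod c * (e / (cmod c + 1))) (\<lambda>x y. c * (a x y - a' x y))" by (rule bnd_scale[OF a'(4)])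
  moreover have "cmod c * (e / (cmod c + 1)) \<le> e" using p e by (simp add: field_simps)
  ultimately have "bnd e (\<lambda>x y. c * a x y - c * a' x y)"
    using bnd_mono by (fastforce simp: right_diff_distrib)
  moreover have "supp_on S (\<lambda>x y. c * a' x y)" using a'(1) by (auto simp: supp_on_def)
  moreover have "propg_le d (\<lambda>x y. c * a' x y) r" using a'(3) by (auto simp: propg_le_def)
  ultimately show "\<exists>b D. supp_on S b \<and> bnd D b \<and> fin_prop d b \<and> bnd e (\<lambda>x y. c * a x y - b x y)"
    using bnd_scale[OF bounded_op_bnd[OF a'(2)], of c] by (auto simp: fin_prop_def)
qed

lemma linf_subset_roe:
  assumes "metric_on X d"
  shows "linf X \<subseteq> roe X d"
proof
  fix a assume "a \<in> linf X"
  then have a: "supp_on X a" "bnd (opnorm X a) a" "\<And>x y. x \<noteq> y \<Longrightarrow> a x y = 0"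
    using bounded_op_bnd by (auto simp: linf_def bounded_op_iff)
  have "propg_le d a 0"
    using a(1,3) assms unfolding propg_le_def supp_on_def metric_on_def by (metis order_refl)
  then show "a \<in> roe X d" by (intro fin_prop_roe[OF a(1,2)]) (auto simp: fin_prop_def)
qed

lemma rmul_add_left:
  assumes "bnd C a" "bnd D b" "bnd E c"
  shows "rmul (\<lambda>x y. a x y + b x y) c = (\<lambda>x y. rmul a c x y + rmul b c x y)"
  unfolding rmul_def
  by (intro ext, subst infsum_add[symmetric])
    (auto intro!: l2_prod(1) bnd_row(1)[OF assms(1)] bnd_row(1)[OF assms(2)] bnd_col(1)[OF assms(3)] simp: distrib_right)

lemma rmul_add_right:
  assumes "bnd C a" "bnd D b" "bnd E c"
  shows "rmul c (\<lambda>x y. a x y + b x y) = (\<lambda>x y. rmul c a x y + rmul c b x y)"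
  unfolding rmul_def
  by (intro ext, subst infsum_add[symmetric])
    (auto intro!: l2_prod(1) bnd_col(1)[OF assms(1)] bnd_col(1)[OF assms(2)] bnd_row(1)[OF assms(3)] simp: distrib_left)

lemma rmul_scale_left: "rmul (\<lambda>x y. k * a x y) c = (\<lambda>x y. k * rmul a c x y)"
  by (auto simp: rmul_def mult.assoc infsum_cmult_right')

lemma rmul_scale_right: "rmul c (\<lambda>x y. k * a x y) = (\<lambda>x y. k * rmul c a x y)"
  by (auto simp: rmul_def mult.left_commute infsum_cmult_right')

section \<open>Embeddings with Cartan image are unitarily implemented\<close>

definition eunit :: "'a \<Rightarrow> 'a \<Rightarrow> 'a cmat" where
  "eunit x y = (\<lambda>s t. if s = x \<and> t = y then 1 else 0)"

definition kid :: "'a set \<Rightarrow> 'a cmat" where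
  "kid S = (\<lambda>s t. if s = t \<and> s \<in> S then 1 else 0)"

lemma infsum_single:
  assumes "\<And>y. y \<noteq> z \<Longrightarrow> f y = (0::complex)"
  shows "infsum f UNIV = f z"
  by (rule infsumI, rule has_sum_finite_neutralI[of "{z}"]) (use assms in auto)

lemma rmul_kid_left: assumes "\<And>x y. x \<notin> S \<Longrightarrow> a x y = 0" shows "rmul (kid S) a = a"
proof (intro ext)
  fix x y
  have "rmul (kid S) a x y = kid S x x * a x y"
    unfolding rmul_def by (rule infsum_single) (auto simp: kid_def)
  then show "rmul (kid S) a x y = a x y" using assms by (auto simp: kid_def)
qed

lemma rmul_kid_right: assumes "\<And>x y. y \<notin> S \<Longrightarrow> a x y = 0" shows "rmul a (kid S) = a"
proof (intro ext)
  fix x y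
  have "rmul a (kid S) x y = a x y * kid S y y"
    unfolding rmul_def by (rule infsum_single) (auto simp: kid_def)
  then show "rmul a (kid S) x y = a x y" using assms by (auto simp: kid_def)
qed

lemma kapp_kid: assumes "\<And>x. x \<notin> S \<Longrightarrow> f x = 0" shows "kapp (kid S) f = f"
  using rmul_kid_left[of S "\<lambda>x (_::unit). f x"] assms by (auto simp: fun_eq_iff rmul_kapp)

section \<open>Products with matrix units\<close>

lemma eunit_roe: "x \<in> S \<Longrightarrow> y \<in> S \<Longrightarrow> eunit x y \<in> roe S d"
proof -
  assume xy: "x \<in> S" "y \<in> S"
  have l: "l2vec S (\<lambda>s. if s = z then 1 else 0)" if "z \<in> S" for z
    using that l2_finite_support(1)[of "{z}" "\<lambda>s. if s = z then 1 else 0"] by (auto simp: l2vec_iff)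
  have "eunit x y = (\<lambda>s t. (if s = x then 1 else 0) * (if t = y then 1 else 0))"
    by (auto simp: eunit_def fun_eq_iff)
  then show ?thesis using roe_rank1[OF l[OF xy(1)] l[OF xy(2)]] by simp
qed

lemma eunit_linf: "x \<in> S \<Longrightarrow> eunit x x \<in> linf S"
  using eunit_roe[of x S x "\<lambda>_ _. 0"] by (auto simp: linf_def roe_def eunit_def)

lemma madj_eunit: "madj (eunit x y) = eunit y x"
  by (auto simp: madj_def eunit_def fun_eq_iff)

lemma mmul_eunit_left: "mmul (eunit x y) a = (\<lambda>s t. (if s = x then 1 else 0) * a y t)"
proof (intro ext)
  fix s t
  have "mmul (eunit x y) a s t = eunit x y s y * a y t"
    unfolding mmul_def by (rule infsum_single) (auto simp: eunit_def)
  then show "mmul (eunit x y) a s t = (if s = x then 1 else 0) * a y t" by (auto simp: eunit_def)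
qed

lemma mmul_eunit_right: "mmul a (eunit x y) = (\<lambda>s t. (if t = y then 1 else 0) * a s x)"
proof (intro ext)
  fix s t
  have "mmul a (eunit x y) s t = a s x * eunit x y x t"
    unfolding mmul_def by (rule infsum_single) (auto simp: eunit_def)
  then show "mmul a (eunit x y) s t = (if t = y then 1 else 0) * a s x" by (auto simp: eunit_def)
qed

lemma mmul_eunit_eunit: "mmul (eunit x y) (eunit z w) = (if y = z then eunit x w else mzero)"
  unfolding mmul_eunit_left by (auto simp: eunit_def mzero_def fun_eq_iff)

lemma mmul_linf_eunit: "a \<in> linf X \<Longrightarrow> mmul a (eunit x x) = msmul (a x x) (eunit x x)"
  unfolding mmul_eunit_right by (auto simp: eunit_def linf_def msmul_def fun_eq_iff)

lemma mmul_eunit_mid: "mmul (mmul (eunit x x) a) (eunit y y) = msmul (a x y) (eunit x y)"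
  unfolding mmul_eunit_right mmul_eunit_left by (auto simp: eunit_def msmul_def fun_eq_iff)

lemma infsum_norm_sq:
  assumes "l2 f" shows "infsum (\<lambda>x. f x * cnj (f x)) UNIV = of_real ((l2norm f)\<^sup>2)"
proof -
  have "(\<lambda>x. f x * cnj (f x)) = (\<lambda>x. of_real ((cmod (f x))\<^sup>2))"
    by (intro ext) (simp add: complex_norm_square del: of_real_power)
  moreover have "((\<lambda>x. (cmod (f x))\<^sup>2) has_sum (l2norm f)\<^sup>2) UNIV"
    using assms by (simp add: l2norm_sq l2_def)
  ultimately show ?thesis by (simp only: infsumI[OF has_sum_of_real])
qed

lemma l2norm_eq_0: assumes "l2 f" "l2norm f = 0" shows "f x = 0"
  using fnorm_le_l2norm[OF assms(1), of "{x}"] assms(2) by simp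

text \<open>Expanding the square norm of a finite combination of columns gives their Gram matrix
  \<open>kid X\<close>. Coefficients at points outside X drop out, so the outcome is an inequality
  rather than an equality.\<close>

lemma bnd_isometry:
  assumes "\<And>x. l2 (\<lambda>y. U y x)" "rmul (kadj U) U = kid X"
  shows "bnd 1 U"
proof (rule bndI)
  fix A B and f :: "'a \<Rightarrow> complex" assume fin: "finite (A::'b set)" "finite (B::'a set)"
  define w where "w = (\<lambda>y. \<Sum>x\<in>B. U y x * f x)"
  have w: "l2 w" unfolding w_def using fin(2)
  proof (induction B rule: finite_induct)
    case empty
    then show ?case by (simp add: l2_def)
  next
    case (insert b B)
    then show ?case using l2_add(1)[OF l2_scale[OF assms(1), of "f b" b] insert.IH] by (simp add: mult.commute)
  qed
  have "of_real ((l2norm w)\<^sup>2) = infsum (\<lambda>y. w y * cnj (w y)) UNIV" by (simp add: infsum_norm_sq[OF w])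
  also have "(\<lambda>y. w y * cnj (w y)) = (\<lambda>y. \<Sum>x\<in>B. \<Sum>x'\<in>B. f x' * cnj (f x) * (kadj U x y * U y x'))"
    by (intro ext) (simp add: w_def kadj_def cnj_sum sum_product ac_simps, subst sum.swap, simp)
  also have "infsum \<dots> UNIV = (\<Sum>x\<in>B. \<Sum>x'\<in>B. f x' * cnj (f x) * rmul (kadj U) U x x')"
    unfolding rmul_def
    by (intro infsumI has_sum_sum has_sum_cmult_right has_sum_infsum l2_prod(1) assms(1))
      (simp add: kadj_def assms(1))
  also have "\<dots> = (\<Sum>x\<in>B. if x \<in> X then f x * cnj (f x) else 0)"
    unfolding assms(2) kid_def using fin(2)
    by (intro sum.cong refl) (simp add: if_distrib if_distribR sum.delta cong: if_cong)
  also have "\<dots> = of_real (\<Sum>x\<in>B. if x \<in> X then (cmod (f x))\<^sup>2 else 0)"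
    unfolding of_real_sum by (intro sum.cong refl) (simp add: complex_norm_square del: of_real_power)
  finally have "(l2norm w)\<^sup>2 = (\<Sum>x\<in>B. if x \<in> X then (cmod (f x))\<^sup>2 else 0)"
    by (simp only: of_real_eq_iff)
  also have "\<dots> \<le> (fnorm f B)\<^sup>2" unfolding fnorm_sq by (intro sum_mono) auto
  finally have "l2norm w \<le> fnorm f B" by (rule power2_le_imp_le) simp
  then show "fnorm (\<lambda>y. \<Sum>x\<in>B. U y x * f x) A \<le> 1 * fnorm f B"
    using fnorm_le_l2norm[OF w, of A] by (simp add: w_def)
qed simp

text \<open>The shape of an entry of a product of two rank one matrices: the outer vectors come out
  and an inner product stays.\<close>

lemma infsum_pull:
  "infsum (\<lambda>r. c * f r * (g r * e)) UNIV = c * e * infsum (\<lambda>r. f r * g r :: complex) UNIV"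
  by (subst infsum_cmult_right'[symmetric]) (simp add: ac_simps)

text \<open>The base point \<open>x0\<close> serves as reference: the vector found for
  \<open>eunit x0 x0\<close> is carried to every other point by
  \<open>\<Phi> (eunit x x0)\<close>.\<close>

locale cartan_embedding =
  fixes X :: "'a set" and dX :: "'a \<Rightarrow> 'a \<Rightarrow> real"
    and Y :: "'b set" and dY :: "'b \<Rightarrow> 'b \<Rightarrow> real"
    and \<Phi> :: "'a cmat \<Rightarrow> 'b cmat" and x0 :: 'a
  assumes met: "metric_on X dX"
    and emb: "cstar_embedding X dX Y dY \<Phi>"
    and car: "cartan Y (roe Y dY) (\<Phi> ` linf X)"
    and x0: "x0 \<in> X"
begin

abbreviation "A \<equiv> roe X dX"
abbreviation "R \<equiv> roe Y dY"
abbreviation "B \<equiv> \<Phi> ` linf X"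

lemma linf_subset_A: "linf X \<subseteq> A" by (rule linf_subset_roe[OF met])

lemma Phi_roe: "a \<in> A \<Longrightarrow> \<Phi> a \<in> R"
  using emb by (auto simp: cstar_embedding_def)
lemma Phi_mul: "a \<in> A \<Longrightarrow> b \<in> A \<Longrightarrow> \<Phi> (mmul a b) = mmul (\<Phi> a) (\<Phi> b)"
  using emb by (auto simp: cstar_embedding_def)
lemma Phi_smul: "a \<in> A \<Longrightarrow> \<Phi> (msmul c a) = msmul c (\<Phi> a)"
  using emb by (auto simp: cstar_embedding_def)
lemma Phi_adj: "a \<in> A \<Longrightarrow> \<Phi> (madj a) = madj (\<Phi> a)"
  using emb by (auto simp: cstar_embedding_def)
lemma eunit_in_A [simp]: "x \<in> X \<Longrightarrow> y \<in> X \<Longrightarrow> eunit x y \<in> A" by (rule eunit_roe)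

lemma Phi_zero: "\<Phi> mzero = mzero"
  using Phi_smul[OF eunit_in_A[OF x0 x0], of 0] by (simp add: msmul_def mzero_def)

lemma zero_A: "mzero \<in> A"
  using roe_scale[OF eunit_in_A[OF x0 x0], of 0] by (simp add: msmul_def mzero_def)

lemma Phi_nonzero: "a \<in> A \<Longrightarrow> a \<noteq> mzero \<Longrightarrow> \<Phi> a \<noteq> mzero"
  using emb Phi_zero zero_A unfolding cstar_embedding_def inj_on_def by metis

text \<open>\<open>eunit x x\<close> is a minimal projection of the diagonal algebra, so the
  diagonal acts on it by the scalar \<open>g x x\<close>, and \<open>\<Phi>\<close> transports this
  relation.\<close>

lemma B_eunit:
  assumes "g \<in> linf X" "x \<in> X"
  shows "mmul (\<Phi> g) (\<Phi> (eunit x x)) = msmul (g x x) (\<Phi> (eunit x x))"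
proof -
  have "mmul (\<Phi> g) (\<Phi> (eunit x x)) = \<Phi> (mmul g (eunit x x))"
    by (rule Phi_mul[symmetric]) (use assms linf_subset_A in auto)
  also have "\<dots> = msmul (g x x) (\<Phi> (eunit x x))"
    using assms by (simp add: mmul_linf_eunit Phi_smul)
  finally show ?thesis .
qed

lemma B_star: "star_subalg Y B" and B_R: "B \<subseteq> R" and B_abel: "abelian B"
  and B_masa: "\<And>C. star_subalg Y C \<Longrightarrow> abelian C \<Longrightarrow> B \<subseteq> C \<Longrightarrow> C \<subseteq> R \<Longrightarrow> C = B"
  using car by (auto simp: cartan_def cstar_subalg_def)

text \<open>For \<open>p = \<Phi> e\<close> with \<open>e\<close> a diagonal matrix unit and \<open>v\<close> a nonzero column of \<open>p\<close>, the rank one operator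
  \<open>v v\<^sup>*\<close> commutes with the masa \<open>B\<close>, hence lies in \<open>B\<close> and is a multiple of \<open>p\<close>.\<close>

lemma rank_one:
  obtains \<xi> where "l2vec Y \<xi>" "l2norm \<xi> = 1" "\<Phi> (eunit x0 x0) = (\<lambda>s t. \<xi> s * cnj (\<xi> t))"
proof -
  define p where "p = \<Phi> (eunit x0 x0)"
  have pR: "p \<in> R" using x0 by (simp add: p_def Phi_roe)
  obtain Cp where pb: "bnd Cp p" using roe_bnd[OF pR] by blast
  have pp: "mmul p p = p" unfolding p_def
    using x0 by (simp add: Phi_mul[symmetric] mmul_eunit_eunit)
  have pa: "madj p = p" unfolding p_def
    using x0 by (simp add: Phi_adj[symmetric] madj_eunit)
  have pcnj: "cnj (p s t) = p t s" for s t using fun_cong[OF fun_cong[OF pa, of t], of s] by (simp add: madj_def)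
  have "p \<noteq> mzero" unfolding p_def
    by (rule Phi_nonzero) (use x0 in \<open>auto simp: mzero_def fun_eq_iff\<close>, auto simp: eunit_def)
  then obtain r z where rz: "p r z \<noteq> 0" by (auto simp: mzero_def fun_eq_iff)
  define v where "v = (\<lambda>s. p s z)"
  have vl: "l2 v" unfolding v_def by (rule bnd_col(1)[OF pb])
  have vY: "l2vec Y v" using vl roe_supp[OF pR] by (auto simp: l2vec_iff v_def supp_on_def)
  define m where "m = (l2norm v)\<^sup>2"
  have m0: "m > 0" unfolding m_def using l2norm_eq_0[OF vl, of r] rz by (auto simp: v_def)
  have vv: "infsum (\<lambda>s. cnj (v s) * v s) UNIV = of_real m"
    using infsum_norm_sq[OF vl] by (simp add: m_def mult.commute)
  have pzz: "p z z = of_real m"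
    using fun_cong[OF fun_cong[OF pp, of z], of z] vv by (simp add: mmul_def v_def pcnj)
  define h where "h = (\<lambda>s t. v s * cnj (v t))"
  have "l2vec Y (\<lambda>t. cnj (v t))" using vY by (simp add: l2vec_iff)
  then have hR: "h \<in> R" unfolding h_def by (rule roe_rank1[OF vY])
  obtain Ch where hb: "bnd Ch h" using roe_bnd[OF hR] by blast
  \<comment> \<open>The vector \<open>v\<close> is a column of \<open>p\<close>, hence an
    eigenvector of every element of \<open>B\<close>.\<close>
  have Bh: "mmul (\<Phi> g) h = msmul (g x0 x0) h" if "g \<in> linf X" for g
  proof (intro ext)
    fix s t
    have "mmul (\<Phi> g) h s t = mmul (\<Phi> g) p s z * cnj (v t)"
      by (simp add: mmul_def h_def v_def infsum_cmult_left' mult.assoc[symmetric])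
    also have "\<dots> = msmul (g x0 x0) h s t"
      using B_eunit[OF that x0] by (simp add: p_def[symmetric] msmul_def h_def v_def)
    finally show "mmul (\<Phi> g) h s t = msmul (g x0 x0) h s t" .
  qed
  have ladj: "madj g \<in> linf X" if "g \<in> linf X" for g
    using that bnd_adj by (auto simp: linf_def bounded_op_iff madj_kadj) (auto simp: kadj_def supp_on_def)
  have hB: "mmul h (\<Phi> g) = msmul (g x0 x0) h" if g: "g \<in> linf X" for g
  proof (intro ext)
    fix s t
    have "mmul h (\<Phi> g) s t = cnj (mmul (madj (\<Phi> g)) h t s)"
      by (simp add: mmul_def h_def madj_def infsum_cnj[symmetric] ac_simps del: infsum_cnj)
    also have "madj (\<Phi> g) = \<Phi> (madj g)" using g linf_subset_A by (auto simp: Phi_adj)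
    also have "cnj (mmul (\<Phi> (madj g)) h t s) = msmul (g x0 x0) h s t"
      unfolding Bh[OF ladj[OF g]] by (simp add: msmul_def madj_def h_def)
    finally show "mmul h (\<Phi> g) s t = msmul (g x0 x0) h s t" .
  qed
  have hh: "mmul h h = msmul (of_real m) h"
    unfolding mmul_def h_def msmul_def infsum_pull vv by (simp add: ac_simps)
  \<comment> \<open>The span of \<open>B\<close> and \<open>h\<close> is the competitor in the
    maximality of \<open>B\<close>. The product formula below shows that it is closed under
    multiplication, and its coefficient of \<open>h\<close> is symmetric in the two factors, which
    gives commutativity.\<close>
  define C where "C = {madd b (msmul c h) | b c. b \<in> B}"
  have prod: "mmul (madd (\<Phi> g) (msmul c h)) (madd (\<Phi> g') (msmul c' h))
     = madd (mmul (\<Phi> g) (\<Phi> g')) (msmul (c' * g x0 x0 + c * g' x0 x0 + c * c' * of_real m) h)"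
    if g: "g \<in> linf X" "g' \<in> linf X" for g g' c c'
  proof -
    obtain D D' where D: "bnd D (\<Phi> g)" "bnd D' (\<Phi> g')"
      using roe_bnd[OF Phi_roe] g linf_subset_A by blast
    note s = bnd_scale[OF hb, of c] bnd_scale[OF hb, of c']
    have "mmul (madd (\<Phi> g) (msmul c h)) (madd (\<Phi> g') (msmul c' h))
      = (\<lambda>x y. mmul (\<Phi> g) (\<Phi> g') x y + c' * mmul (\<Phi> g) h x y
         + (c * mmul h (\<Phi> g') x y + c * (c' * mmul h h x y)))"
      unfolding mmul_rmul madd_def msmul_def
      by (simp only: rmul_add_left[OF D(1) s(1) bnd_add[OF D(2) s(2)]] rmul_add_right[OF D(2) s(2) D(1)]
        rmul_add_right[OF D(2) s(2) s(1)] rmul_scale_left rmul_scale_right) 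
    then show ?thesis unfolding Bh[OF g(1)] hB[OF g(2)] hh
      by (simp add: madd_def msmul_def algebra_simps)
  qed
  have Bc: "mzero \<in> B" "\<And>a b. a \<in> B \<Longrightarrow> b \<in> B \<Longrightarrow> madd a b \<in> B \<and> mmul a b \<in> B"
    "\<And>c a. a \<in> B \<Longrightarrow> msmul c a \<in> B" "\<And>a. a \<in> B \<Longrightarrow> madj a \<in> B"
    using B_star by (auto simp: star_subalg_def)
  have CR: "C \<subseteq> R" unfolding C_def using B_R by (auto intro!: roe_add roe_scale hR)
  have "star_subalg Y C"
    unfolding star_subalg_def
  proof (intro conjI ballI allI)
    show "C \<subseteq> {a. bounded_op Y a}" using CR by (auto simp: roe_def)
    have "mzero = madd mzero (msmul 0 h)" by (simp add: mzero_def madd_def msmul_def)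
    then show "mzero \<in> C" unfolding C_def using Bc(1) by blast
    fix a assume "a \<in> C"
    then obtain b c where a: "a = madd b (msmul c h)" "b \<in> B" by (auto simp: C_def)
    { fix a' assume "a' \<in> C"
      then obtain b' c' where a': "a' = madd b' (msmul c' h)" "b' \<in> B" by (auto simp: C_def)
      have "madd a a' = madd (madd b b') (msmul (c + c') h)"
        unfolding a a' by (simp add: madd_def msmul_def algebra_simps)
      then show "madd a a' \<in> C" unfolding C_def using Bc(2)[OF a(2) a'(2)] by blast
      obtain g g' where "g \<in> linf X" "g' \<in> linf X" "b = \<Phi> g" "b' = \<Phi> g'" using a(2) a'(2) by auto
      then have "mmul a a' = madd (mmul b b') (msmul (c' * g x0 x0 + c * g' x0 x0 + c * c' * of_real m) h)"
        unfolding a a' using prod by simp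
      then show "mmul a a' \<in> C" unfolding C_def using Bc(2)[OF a(2) a'(2)] by blast }
    fix k
    have "msmul k a = madd (msmul k b) (msmul (k * c) h)"
      unfolding a by (simp add: madd_def msmul_def algebra_simps)
    then show "msmul k a \<in> C" unfolding C_def using Bc(3)[OF a(2)] by blast
    have "madj a = madd (madj b) (msmul (cnj c) h)"
      unfolding a by (simp add: madj_def madd_def msmul_def h_def algebra_simps)
    then show "madj a \<in> C" unfolding C_def using Bc(4)[OF a(2)] by blast
  qed
  moreover have "abelian C" unfolding abelian_def
  proof (intro ballI)
    fix a a' assume "a \<in> C" "a' \<in> C"
    then obtain g c g' c' where a: "a = madd (\<Phi> g) (msmul c h)" "g \<in> linf X"
      "a' = madd (\<Phi> g') (msmul c' h)" "g' \<in> linf X" by (auto simp: C_def)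
    have "mmul (\<Phi> g) (\<Phi> g') = mmul (\<Phi> g') (\<Phi> g)" using B_abel a unfolding abelian_def by blast
    then show "mmul a a' = mmul a' a"
      unfolding a prod[OF a(2,4)] prod[OF a(4,2)] by (simp add: ac_simps)
  qed
  moreover have "B \<subseteq> C"
  proof
    fix b assume "b \<in> B"
    moreover have "b = madd b (msmul 0 h)" by (simp add: madd_def msmul_def)
    ultimately show "b \<in> C" unfolding C_def by blast
  qed
  ultimately have "C = B" using CR by (rule B_masa)
  moreover have "h \<in> C"
  proof -
    have "h = madd mzero (msmul 1 h)" by (simp add: madd_def msmul_def mzero_def)
    then show ?thesis unfolding C_def using Bc(1) by blast
  qed
  ultimately obtain g where g: "g \<in> linf X" "h = \<Phi> g" by auto
  \<comment> \<open>Right multiplication by \<open>p\<close> fixes \<open>h\<close>, since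
    \<open>v\<close> is in the range of the projection \<open>p\<close>; on an element of
    \<open>B\<close> it gives a multiple of \<open>p\<close>. Comparing the two computations yields
    \<open>h\<close> as a multiple of \<open>p\<close>.\<close>
  have "mmul h p = h"
  proof (intro ext)
    fix s t
    have "mmul h p s t = v s * infsum (\<lambda>r. cnj (v r) * p r t) UNIV"
      by (simp add: mmul_def h_def mult.assoc infsum_cmult_right')
    also have "infsum (\<lambda>r. cnj (v r) * p r t) UNIV = mmul p p z t"
      by (simp add: mmul_def v_def pcnj)
    finally show "mmul h p s t = h s t" unfolding pp h_def by (simp add: v_def pcnj)
  qed
  then have hp: "h = msmul (g x0 x0) p" using B_eunit[OF g(1) x0] g(2) by (simp add: p_def)
  \<comment> \<open>The diagonal entry at \<open>z\<close> identifies the multiple: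
    \<open>v z = p z z\<close> equals the square norm \<open>m\<close> of \<open>v\<close>.\<close>
  have "of_real m * of_real m = g x0 x0 * complex_of_real m"
    using fun_cong[OF fun_cong[OF hp, of z], of z] pzz by (simp add: h_def v_def msmul_def)
  then have gm: "g x0 x0 = of_real m" using m0 by simp
  define \<xi> where "\<xi> = (\<lambda>s. of_real (inverse (sqrt m)) * v s)"
  show thesis
  proof (rule that)
    show "l2vec Y \<xi>" using vY by (auto simp: l2vec_iff \<xi>_def intro: l2_scale)
    show "l2norm \<xi> = 1" unfolding \<xi>_def l2norm_scale using m0 by (simp add: m_def norm_inverse)
    have "p = (\<lambda>s t. \<xi> s * cnj (\<xi> t))"
    proof (intro ext)
      fix s t
      have "v s * cnj (v t) = of_real m * p s t"
        using fun_cong[OF fun_cong[OF hp, of s], of t] gm by (simp add: h_def msmul_def)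
      moreover have "complex_of_real (inverse (sqrt m)) * of_real (inverse (sqrt m)) = of_real (inverse m)"
        using m0 unfolding of_real_mult[symmetric] of_real_eq_iff
        by (simp add: inverse_mult_distrib[symmetric] del: inverse_mult_distrib)
      then have "\<xi> s * cnj (\<xi> t) = of_real (inverse m) * (v s * cnj (v t))"
        by (simp add: \<xi>_def mult.assoc[symmetric])
      ultimately show "p s t = \<xi> s * cnj (\<xi> t)" using m0 by (simp add: field_simps)
    qed
    then show "\<Phi> (eunit x0 x0) = (\<lambda>s t. \<xi> s * cnj (\<xi> t))" by (simp add: p_def)
  qed
qed


text \<open>Matrix unit relations turn the vectors \<open>\<Phi> (eunit x x0) \<xi>\<close> into an
  orthonormal system, and the expectation forces completeness. Compressing \<open>\<Phi> a\<close>
  between two diagonal units isolates one entry of \<open>a\<close>, so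
  \<open>U* (\<Phi> a) U = a\<close> is checked entry by entry.\<close>

lemma implementing_unitary:
  obtains U :: "'b \<Rightarrow> 'a \<Rightarrow> complex" where "\<And>y x. U y x \<noteq> 0 \<Longrightarrow> y \<in> Y \<and> x \<in> X" "bnd 1 U"
    "rmul (kadj U) U = kid X" "rmul U (kadj U) = kid Y"
    "\<And>a. a \<in> A \<Longrightarrow> \<Phi> a = rmul U (rmul a (kadj U))"
proof -
  obtain \<xi> where \<xi>: "l2vec Y \<xi>" "l2norm \<xi> = 1" "\<Phi> (eunit x0 x0) = (\<lambda>s t. \<xi> s * cnj (\<xi> t))"
    by (rule rank_one)
  have \<xi>l: "l2 \<xi>" using \<xi>(1) by (simp add: l2vec_iff)
  have \<xi>\<xi>: "infsum (\<lambda>r. \<xi> r * cnj (\<xi> r)) UNIV = 1" "infsum (\<lambda>r. cnj (\<xi> r) * \<xi> r) UNIV = 1"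
    using infsum_norm_sq[OF \<xi>l] \<xi>(2) by (simp_all add: mult.commute)
  obtain s0 where s0: "\<xi> s0 \<noteq> 0" using \<xi>\<xi>(1) by fastforce
  define U where "U = (\<lambda>y x. if x \<in> X then kapp (\<Phi> (eunit x x0)) \<xi> y else 0)"
  have w: "\<Phi> (eunit x x0) = (\<lambda>s t. U s x * cnj (\<xi> t))" if x: "x \<in> X" for x
  proof (intro ext)
    fix s t
    have "\<Phi> (eunit x x0) s t = mmul (\<Phi> (eunit x x0)) (\<Phi> (eunit x0 x0)) s t"
      using x x0 by (simp add: Phi_mul[symmetric] mmul_eunit_eunit)
    also have "\<dots> = U s x * cnj (\<xi> t)"
      unfolding \<xi>(3) using x by (simp add: mmul_def U_def kapp_def infsum_cmult_left' mult.assoc[symmetric])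
    finally show "\<Phi> (eunit x x0) s t = U s x * cnj (\<xi> t)" .
  qed
  have P: "\<Phi> (eunit x x') = (\<lambda>s t. U s x * cnj (U t x'))" if x: "x \<in> X" "x' \<in> X" for x x'
  proof (intro ext)
    fix s t
    have "\<Phi> (eunit x x') s t = mmul (\<Phi> (eunit x x0)) (madj (\<Phi> (eunit x' x0))) s t"
      using x x0 by (simp add: Phi_mul[symmetric] Phi_adj[symmetric] mmul_eunit_eunit madj_eunit)
    also have "\<dots> = infsum (\<lambda>r. U s x * cnj (\<xi> r) * (\<xi> r * cnj (U t x'))) UNIV"
      by (simp add: w x mmul_def madj_def mult.commute)
    also have "\<dots> = U s x * cnj (U t x')" unfolding infsum_pull \<xi>\<xi> by simp
    finally show "\<Phi> (eunit x x') s t = U s x * cnj (U t x')" .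
  qed
  have Usupp: "y \<in> Y \<and> x \<in> X" if "U y x \<noteq> 0" for y x
  proof -
    have x: "x \<in> X" using that by (auto simp: U_def split: if_splits)
    have "\<Phi> (eunit x x0) y s0 \<noteq> 0" using that s0 by (simp add: w[OF x])
    then have "y \<in> Y" using roe_supp[OF Phi_roe[OF eunit_in_A[OF x x0]]] by (auto simp: supp_on_def)
    with x show ?thesis by simp
  qed
  have Ul: "l2 (\<lambda>y. U y x)" for x
  proof (cases "x \<in> X")
    case True
    then show ?thesis unfolding U_def
      using kapp_l2(1)[OF roe_bnd[OF Phi_roe[OF eunit_in_A[OF True x0]]] \<xi>l] by simp
  qed (simp add: U_def l2_def)
  have orth: "rmul (kadj U) U = kid X"
  proof (intro ext)
    fix x x'
    show "rmul (kadj U) U x x' = kid X x x'"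
    proof (cases "x \<in> X \<and> x' \<in> X")
      case True
      have z: "\<Phi> mzero s0 s0 = 0" unfolding Phi_zero by (simp add: mzero_def)
      have "mmul (madj (\<Phi> (eunit x x0))) (\<Phi> (eunit x' x0)) = \<Phi> (mmul (eunit x0 x) (eunit x' x0))"
        using True x0 by (simp add: Phi_mul[symmetric] Phi_adj[symmetric] madj_eunit)
      then have "mmul (madj (\<Phi> (eunit x x0))) (\<Phi> (eunit x' x0)) s0 s0 = kid X x x' * (\<xi> s0 * cnj (\<xi> s0))"
        using True z by (auto simp: mmul_eunit_eunit \<xi>(3) kid_def)
      moreover have "mmul (madj (\<Phi> (eunit x x0))) (\<Phi> (eunit x' x0)) s0 s0
        = infsum (\<lambda>r. \<xi> s0 * cnj (U r x) * (U r x' * cnj (\<xi> s0))) UNIV"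
        using True by (simp add: w mmul_def madj_def mult.commute)
      ultimately have "\<xi> s0 * cnj (\<xi> s0) * rmul (kadj U) U x x' = kid X x x' * (\<xi> s0 * cnj (\<xi> s0))"
        unfolding infsum_pull by (simp add: rmul_def kadj_def)
      then show ?thesis using s0 by simp
    next
      case False
      then show ?thesis by (auto simp: rmul_def kadj_def U_def kid_def)
    qed
  qed
  have Ub: "bnd 1 U" by (rule bnd_isometry[OF Ul orth])
  have Uab: "bnd 1 (kadj U)" by (rule bnd_adj[OF Ub])
  have col1: "\<exists>s. U s x \<noteq> 0" if "x \<in> X" for x
  proof (rule ccontr)
    assume "\<not> ?thesis"
    then have "rmul (kadj U) U x x = 0" by (simp add: rmul_def kadj_def)
    then show False using orth that by (simp add: kid_def)
  qed
  obtain E where E: "cond_exp Y R B E" "faithful R E" using car by (auto simp: cartan_def)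
  \<comment> \<open>Suppose \<open>\<eta>\<close> is orthogonal to all columns. Then
    \<open>q = \<eta> \<eta>*\<close> is annihilated by each \<open>\<Phi> (eunit x x)\<close>. The
    bimodule property passes this to \<open>E q\<close>, which lies in
    \<open>\<Phi> (linf X)\<close> and so has all its diagonal coefficients zero. As
    \<open>q* q\<close> is a multiple of \<open>q\<close>, faithfulness gives
    \<open>q = 0\<close>.\<close>
  have complete: "\<eta> y = 0" if \<eta>: "l2vec Y \<eta>" "\<And>x. x \<in> X \<Longrightarrow> kapp (kadj U) \<eta> x = 0" for \<eta> y
  proof -
    have \<eta>l: "l2 \<eta>" using \<eta>(1) by (simp add: l2vec_iff)
    define q where "q = (\<lambda>s t. \<eta> s * cnj (\<eta> t))"
    have "l2vec Y (\<lambda>t. cnj (\<eta> t))" using \<eta>(1) by (simp add: l2vec_iff)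
    then have qR: "q \<in> R" unfolding q_def by (rule roe_rank1[OF \<eta>(1)])
    have E0: "E mzero = mzero"
    proof -
      have "E (msmul 0 q) = msmul 0 (E q)" using E(1) qR unfolding cond_exp_def by blast
      then show ?thesis by (simp add: msmul_def mzero_def)
    qed
    have "E q \<in> B" using E(1) qR by (simp add: cond_exp_def)
    then obtain g where g: "g \<in> linf X" "E q = \<Phi> g" by auto
    have "g x x = 0" if x: "x \<in> X" for x
    proof -
      let ?p = "\<Phi> (eunit x x)"
      have pB: "?p \<in> B" using eunit_linf[OF x] by blast
      have "mmul q ?p = mzero"
      proof (intro ext)
        fix s t
        have "mmul q ?p s t = infsum (\<lambda>r. \<eta> s * cnj (\<eta> r) * (U r x * cnj (U t x))) UNIV"
          by (simp add: mmul_def q_def P[OF x x])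
        also have "\<dots> = \<eta> s * cnj (U t x) * cnj (kapp (kadj U) \<eta> x)"
          unfolding infsum_pull kapp_def kadj_def infsum_cnj[symmetric] complex_cnj_mult complex_cnj_cnj
          by (simp add: mult.commute)
        finally show "mmul q ?p s t = mzero s t" using \<eta>(2)[OF x] by (simp add: mzero_def)
      qed
      then have "mmul ?p (mmul q ?p) = mzero" by (simp add: mmul_def mzero_def)
      moreover have "E (mmul ?p (mmul q ?p)) = mmul ?p (mmul (E q) ?p)"
        using E(1) qR pB unfolding cond_exp_def by blast
      ultimately have "mmul ?p (mmul (E q) ?p) = mzero" by (simp add: E0)
      moreover have "mmul (E q) ?p = msmul (g x x) ?p" unfolding g(2) by (rule B_eunit[OF g(1) x])
      moreover have "mmul ?p ?p = ?p" using x by (simp add: Phi_mul[symmetric] mmul_eunit_eunit)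
      ultimately have "msmul (g x x) ?p = mzero"
        by (simp add: mmul_rmul msmul_def rmul_scale_right)
      moreover obtain s where "U s x \<noteq> 0" using col1[OF x] by blast
      ultimately show ?thesis by (auto simp: fun_eq_iff P[OF x x] msmul_def mzero_def)
    qed
    moreover have "supp_on X g" "\<And>s t. s \<noteq> t \<Longrightarrow> g s t = 0" using g(1) by (auto simp: linf_def bounded_op_iff)
    ultimately have "g s t = 0" for s t unfolding supp_on_def by (cases "s = t") blast+
    then have "g = mzero" by (simp add: mzero_def fun_eq_iff)
    then have Eq: "E q = mzero" using g(2) Phi_zero by simp
    have "mmul (madj q) q = msmul (of_real ((l2norm \<eta>)\<^sup>2)) q"
    proof (intro ext)
      fix s t
      have "mmul (madj q) q s t = infsum (\<lambda>r. \<eta> s * cnj (\<eta> r) * (\<eta> r * cnj (\<eta> t))) UNIV"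
        by (simp add: mmul_def q_def madj_def mult.commute)
      also have "\<dots> = msmul (of_real ((l2norm \<eta>)\<^sup>2)) q s t"
        unfolding infsum_pull using infsum_norm_sq[OF \<eta>l] by (simp add: msmul_def q_def mult.commute)
      finally show "mmul (madj q) q s t = msmul (of_real ((l2norm \<eta>)\<^sup>2)) q s t" .
    qed
    moreover have "E (msmul (of_real ((l2norm \<eta>)\<^sup>2)) q) = msmul (of_real ((l2norm \<eta>)\<^sup>2)) (E q)"
      using E(1) qR unfolding cond_exp_def by blast
    ultimately have "E (mmul (madj q) q) = mzero" by (simp add: Eq msmul_def mzero_def)
    then have "q = mzero" using E(2) qR unfolding faithful_def by blast
    then show ?thesis by (auto simp: fun_eq_iff q_def mzero_def)
  qed
  have UU: "rmul U (kadj U) = kid Y"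
  proof (intro ext)
    fix z y
    show "rmul U (kadj U) z y = kid Y z y"
    proof (cases "y \<in> Y")
      case False
      then have "U y x = 0" for x using Usupp by blast
      then show ?thesis using False by (auto simp: rmul_def kadj_def kid_def)
    next
      case y: True
      define r where "r = (\<lambda>x. cnj (U y x))"
      have rl: "l2 r" unfolding r_def using bnd_row(1)[OF Ub] by simp
      define \<delta> where "\<delta> = (\<lambda>z. if z = y then 1 else (0::complex))"
      have \<delta>l: "l2 \<delta>" by (rule l2_finite_support(1)[of "{y}"]) (auto simp: \<delta>_def)
      \<comment> \<open>The part of the point mass at \<open>y\<close> orthogonal to the range of
        \<open>U\<close>; its vanishing is the \<open>y\<close>-th column of the identity
        \<open>U U* = kid Y\<close>.\<close>
      define \<eta> where "\<eta> = (\<lambda>z. \<delta> z + (-1) * kapp U r z)"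
      have l: "l2 (\<lambda>z. (-1) * kapp U r z)" by (rule l2_scale[OF kapp_l2(1)[OF Ub rl]])
      have "kapp U r z = 0" if "z \<notin> Y" for z
      proof -
        have "U z x = 0" for x using Usupp that by blast
        then show ?thesis by (simp add: kapp_def)
      qed
      then have "l2vec Y \<eta>" unfolding l2vec_iff \<eta>_def
        using l2_add(1)[OF \<delta>l l] y by (auto simp: \<delta>_def)
      moreover have "kapp (kadj U) \<eta> x = 0" if x: "x \<in> X" for x
      proof -
        have "kapp (kadj U) \<eta> x = kapp (kadj U) \<delta> x + kapp (kadj U) (\<lambda>z. (-1) * kapp U r z) x"
          unfolding \<eta>_def by (rule kapp_add[OF Uab \<delta>l l])
        also have "kapp (kadj U) \<delta> x = r x"
          using kapp_finite_support[of "{y}" \<delta> "kadj U" x] by (simp add: \<delta>_def r_def kadj_def)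
        also have "kapp (kadj U) (\<lambda>z. (-1) * kapp U r z) x = - kapp (kadj U) (kapp U r) x"
          by (simp add: kapp_def infsum_uminus)
        also have "kapp (kadj U) (kapp U r) = r"
          unfolding kapp_rmul[OF Uab Ub rl] orth by (rule kapp_kid) (use Usupp in \<open>force simp: r_def\<close>)
        finally show ?thesis by simp
      qed
      ultimately have "\<eta> z = 0" by (rule complete)
      then show ?thesis using y
        by (auto simp: \<eta>_def \<delta>_def rmul_kapp kid_def kadj_def r_def split: if_splits)
    qed
  qed
  have "\<Phi> a = rmul U (rmul a (kadj U))" if a: "a \<in> A" for a
  proof -
    note b = roe_bnd[OF Phi_roe[OF a]]
    \<comment> \<open>Both expressions for the compression of \<open>\<Phi> a\<close> carry the same
      rank one factor, which is cancelled at a position \<open>(s, t)\<close> where it does not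
      vanish.\<close>
    have "rmul (rmul (kadj U) (\<Phi> a)) U = a"
    proof (intro ext)
      fix x x'
      show "rmul (rmul (kadj U) (\<Phi> a)) U x x' = a x x'"
      proof (cases "x \<in> X \<and> x' \<in> X")
        case True
        then have x: "x \<in> X" "x' \<in> X" by auto
        obtain s t where st: "U s x \<noteq> 0" "U t x' \<noteq> 0" using col1 x by blast
        have "l2vec X (a x)" using bnd_row(1)[OF roe_bnd[OF a]] roe_supp[OF a]
          by (auto simp: l2vec_iff supp_on_def)
        moreover have "l2vec X (\<lambda>s. if s = x then 1 else 0)"
          using x l2_finite_support(1)[of "{x}" "\<lambda>s. if s = x then 1 else 0"] by (auto simp: l2vec_iff)
        ultimately have m: "mmul (eunit x x) a \<in> A" unfolding mmul_eunit_left by (intro roe_rank1)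
        have "mmul (mmul (\<Phi> (eunit x x)) (\<Phi> a)) (\<Phi> (eunit x' x'))
          = \<Phi> (mmul (mmul (eunit x x) a) (eunit x' x'))"
          using x a m by (simp add: Phi_mul)
        also have "\<dots> = msmul (a x x') (\<Phi> (eunit x x'))" unfolding mmul_eunit_mid using x by (simp add: Phi_smul)
        finally have "mmul (mmul (\<Phi> (eunit x x)) (\<Phi> a)) (\<Phi> (eunit x' x')) s t = a x x' * (U s x * cnj (U t x'))"
          using P[OF x] by (simp add: msmul_def)
        moreover have "mmul (\<Phi> (eunit x x)) (\<Phi> a) = (\<lambda>s r. U s x * rmul (kadj U) (\<Phi> a) x r)"
          by (simp add: P[OF x(1) x(1)] mmul_def rmul_def kadj_def mult.assoc infsum_cmult_right')
        then have "mmul (mmul (\<Phi> (eunit x x)) (\<Phi> a)) (\<Phi> (eunit x' x')) s t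
          = infsum (\<lambda>r. U s x * rmul (kadj U) (\<Phi> a) x r * (U r x' * cnj (U t x'))) UNIV"
          by (simp add: mmul_def P[OF x(2) x(2)])
        ultimately have "U s x * cnj (U t x') * rmul (rmul (kadj U) (\<Phi> a)) U x x' = a x x' * (U s x * cnj (U t x'))"
          unfolding infsum_pull by (simp add: rmul_def[of "rmul (kadj U) (\<Phi> a)"])
        then show ?thesis using st by simp
      next
        case False
        have "a x x' = 0" using False roe_supp[OF a] by (auto simp: supp_on_def)
        moreover have "rmul (rmul (kadj U) (\<Phi> a)) U x x' = 0"
          using False by (auto simp: rmul_def kadj_def U_def)
        ultimately show ?thesis by simp
      qed
    qed
    then have "rmul U (rmul a (kadj U)) = rmul U (rmul (rmul (rmul (kadj U) (\<Phi> a)) U) (kadj U))" by simp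
    also have "\<dots> = rmul U (rmul (rmul (kadj U) (\<Phi> a)) (kid Y))"
      unfolding rmul_assoc[OF bnd_rmul[OF Uab b] Ub Uab] UU ..
    also have "rmul (rmul (kadj U) (\<Phi> a)) (kid Y) = rmul (kadj U) (\<Phi> a)"
    proof (rule rmul_kid_right)
      fix x y assume "y \<notin> Y"
      then have "\<Phi> a r y = 0" for r using roe_supp[OF Phi_roe[OF a]] by (auto simp: supp_on_def)
      then show "rmul (kadj U) (\<Phi> a) x y = 0" by (simp add: rmul_def)
    qed
    also have "rmul U (rmul (kadj U) (\<Phi> a)) = rmul (kid Y) (\<Phi> a)"
      unfolding rmul_assoc[OF Ub Uab b, symmetric] UU ..
    also have "\<dots> = \<Phi> a"
      by (rule rmul_kid_left) (use roe_supp[OF Phi_roe[OF a]] in \<open>auto simp: supp_on_def\<close>)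
    finally show ?thesis by simp
  qed
  with Usupp Ub orth UU show thesis by (rule that)
qed

end

section \<open>Columns are bounded below in sup norm\<close>

lemma bnd_sum:
  assumes "finite I" "\<And>i. i \<in> I \<Longrightarrow> bnd (C i) (K i)"
  shows "bnd (\<Sum>i\<in>I. C i) (\<lambda>x y. \<Sum>i\<in>I. K i x y)"
  using assms
proof (induction I rule: finite_induct)
  case empty
  then show ?case by (simp add: bnd_def)
next
  case (insert i I)
  then show ?case using bnd_add[of "C i" "K i" "sum C I"] by simp
qed

lemma roe_sum:
  assumes "finite I" "\<And>i. i \<in> I \<Longrightarrow> a i \<in> roe S d" "mzero \<in> roe S d"
  shows "(\<lambda>x y. \<Sum>i\<in>I. a i x y) \<in> roe S d"
  using assms(1,2)
proof (induction I rule: finite_induct)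
  case empty
  then show ?case using assms(3) by (simp add: mzero_def)
next
  case (insert i I)
  then show ?case using roe_add[of "a i" S d "\<lambda>x y. \<Sum>i\<in>I. a i x y"] by (simp add: madd_def)
qed

lemma mzero_roe: "mzero \<in> roe S d"
  by (rule fin_prop_roe[of _ _ 0]) (auto simp: supp_on_def bnd_def mzero_def fin_prop_def propg_le_def)

lemma roe_diff: "a \<in> roe S d \<Longrightarrow> b \<in> roe S d \<Longrightarrow> (\<lambda>x y. a x y - b x y) \<in> roe S d"
  using roe_add[OF _ roe_scale[of b S d "-1"], of a] by (simp add: madd_def msmul_def)

lemma roe_restrict:
  assumes "a \<in> roe S d" "supp_on Z a" "Z \<subseteq> S"
  shows "a \<in> roe Z d"
proof (rule roeI[OF assms(2) roe_bnd[OF assms(1)]])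
  fix e :: real assume e: "e > 0"
  obtain b r where b: "bounded_op S b" "propg_le d b r" "bnd e (\<lambda>x y. a x y - b x y)"
    using roe_approx[OF assms(1) e] by metis
  define b' where "b' = (\<lambda>x y. if x \<in> Z \<and> y \<in> Z then b x y else 0)"
  have "supp_on Z b'" by (auto simp: supp_on_def b'_def)
  moreover have "bnd (opnorm S b) b'" unfolding b'_def by (rule bnd_restrict[OF bounded_op_bnd[OF b(1)]])
  moreover have "propg_le d b' r" using b(2) by (auto simp: propg_le_def b'_def)
  moreover have "(\<lambda>x y. a x y - b' x y) = (\<lambda>x y. if x \<in> Z \<and> y \<in> Z then a x y - b x y else 0)"
    using assms(2) by (auto simp: b'_def supp_on_def fun_eq_iff)
  then have "bnd e (\<lambda>x y. a x y - b' x y)" using bnd_restrict[OF b(3), of Z Z] by simp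
  ultimately show "\<exists>b D. supp_on Z b \<and> bnd D b \<and> fin_prop d b \<and> bnd e (\<lambda>x y. a x y - b x y)"
    by (auto simp: fin_prop_def)
qed

lemma partial_perm_roe:
  assumes "partial_perm a" "supp_on S a" "propg_le d a r"
  shows "a \<in> roe S d"
  using assms by (intro fin_prop_roe[OF _ bnd_partial_perm]) (auto simp: fin_prop_def)

text \<open>All that is kept of the embedding from here on: a unitary kernel from X to Y whose
  conjugation maps one uniform Roe algebra into the other.\<close>

locale roe_unitary =
  fixes X :: "'a set" and dX :: "'a \<Rightarrow> 'a \<Rightarrow> real"
    and Y :: "'b set" and dY :: "'b \<Rightarrow> 'b \<Rightarrow> real"
    and U :: "'b \<Rightarrow> 'a \<Rightarrow> complex"
  assumes metX: "metric_on X dX" and ulfX: "ulf X dX"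
    and metY: "metric_on Y dY" and ulfY: "ulf Y dY"
    and Usupp: "\<And>y x. U y x \<noteq> 0 \<Longrightarrow> y \<in> Y \<and> x \<in> X"
    and Ub: "bnd 1 U"
    and orth: "rmul (kadj U) U = kid X" and UU: "rmul U (kadj U) = kid Y"
    and img: "\<And>a. a \<in> roe X dX \<Longrightarrow> rmul U (rmul a (kadj U)) \<in> roe Y dY"
begin

lemma Uab: "bnd 1 (kadj U)" by (rule bnd_adj[OF Ub])

lemma col_l2: "l2 (\<lambda>y. U y x)" by (rule bnd_col(1)[OF Ub])

lemma row_l2: "l2 (\<lambda>x. U y x)" by (rule bnd_row(1)[OF Ub])

lemma col_norm: "x \<in> X \<Longrightarrow> l2norm (\<lambda>y. U y x) = 1"
proof -
  assume "x \<in> X"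
  then have "infsum (\<lambda>y. U y x * cnj (U y x)) UNIV = 1"
    using fun_cong[OF fun_cong[OF orth, of x], of x] by (simp add: rmul_def kadj_def kid_def mult.commute)
  then have "complex_of_real ((l2norm (\<lambda>y. U y x))\<^sup>2) = of_real 1" using infsum_norm_sq[OF col_l2, of x] by simp
  then have "(l2norm (\<lambda>y. U y x))\<^sup>2 = 1" by (simp only: of_real_eq_iff)
  then show ?thesis using l2norm_nonneg[of "\<lambda>y. U y x"] by (simp add: power2_eq_1_iff)
qed

lemma row_norm: "y \<in> Y \<Longrightarrow> l2norm (\<lambda>x. U y x) = 1"
proof -
  assume "y \<in> Y"
  then have "infsum (\<lambda>x. U y x * cnj (U y x)) UNIV = 1"
    using fun_cong[OF fun_cong[OF UU, of y], of y] by (simp add: rmul_def kadj_def kid_def)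
  then have "complex_of_real ((l2norm (\<lambda>x. U y x))\<^sup>2) = of_real 1" using infsum_norm_sq[OF row_l2, of y] by simp
  then have "(l2norm (\<lambda>x. U y x))\<^sup>2 = 1" by (simp only: of_real_eq_iff)
  then show ?thesis using l2norm_nonneg[of "\<lambda>x. U y x"] by (simp add: power2_eq_1_iff)
qed

lemma cballY_finite: "y \<in> Y \<Longrightarrow> finite (cball_on Y dY y r)"
  using ulfY by (auto simp: ulf_def)

lemma cballX_finite: "x \<in> X \<Longrightarrow> finite (cball_on X dX x r)"
  using ulfX by (auto simp: ulf_def)

lemma dX_self: "x \<in> X \<Longrightarrow> dX x x = 0"
  using metX by (simp add: metric_on_def)

lemma dY_self: "y \<in> Y \<Longrightarrow> dY y y = 0"
  using metY by (simp add: metric_on_def)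

lemma dY_sym: "y \<in> Y \<Longrightarrow> z \<in> Y \<Longrightarrow> dY y z = dY z y"
  using metY by (simp add: metric_on_def)

lemma dY_tri: "x \<in> Y \<Longrightarrow> y \<in> Y \<Longrightarrow> z \<in> Y \<Longrightarrow> dY x z \<le> dY x y + dY y z"
  using metY by (simp add: metric_on_def)

text \<open>A column with very small entries carries little mass on any prescribed finite set
  \<open>W\<close>, so its finite truncation can be chosen to avoid \<open>W\<close>.\<close>

lemma thin_column:
  assumes thin: "\<forall>\<delta>>0. \<exists>x\<in>X. \<forall>y. cmod (U y x) < \<delta>"
    and "finite W" "\<delta> > 0" "\<epsilon> > 0"
  shows "\<exists>x T. x \<in> X \<and> finite T \<and> T \<subseteq> Y - W \<and> (\<forall>y. cmod (U y x) < \<delta>) \<and>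
    l2norm (\<lambda>y. if y \<in> T then 0 else U y x) \<le> \<epsilon>"
proof -
  \<comment> \<open>Entries below \<open>k\<close> have norm at most
    \<open>sqrt (card W) * k\<close> on \<open>W\<close>, that is at most \<epsilon>/2; the other
    half of \<epsilon> pays for the tail.\<close>
  define k where "k = min \<delta> (\<epsilon> / (2 * (sqrt (card W) + 1)))"
  have sp: "sqrt (card W) + 1 > 0" by (simp add: add_nonneg_pos)
  then have "k > 0" using assms by (simp add: k_def)
  from thin[rule_format, OF this] obtain x where x: "x \<in> X" "\<And>y. cmod (U y x) < k" by blast
  have e2: "\<epsilon> / 2 > 0" using assms by simp
  obtain T0 where T0: "finite T0" "T0 \<subseteq> {y. U y x \<noteq> 0}"
     "l2norm (\<lambda>y. if y \<in> T0 then 0 else U y x) \<le> \<epsilon> / 2"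
    by (rule l2_tail[OF col_l2[of x] e2]) (metis order_refl)
  define f1 where "f1 = (\<lambda>y. if y \<in> T0 then 0 else U y x)"
  define f2 where "f2 = (\<lambda>y. if y \<in> W \<inter> T0 then U y x else 0)"
  have l1: "l2 f1" by (rule l2_dominated(1)[OF col_l2[of x]]) (auto simp: f1_def)
  have l2: "l2 f2" "l2norm f2 = fnorm f2 W"
    by (rule l2_finite_support[OF assms(2)], simp add: f2_def)+
  have "fnorm f2 W \<le> L2_set (\<lambda>_. k) W"
    using x(2) \<open>k > 0\<close> by (intro L2_set_mono) (auto simp: f2_def less_imp_le)
  also have "\<dots> = sqrt (card W) * k" using \<open>k > 0\<close> by (simp add: L2_set_constant)
  also have "\<dots> \<le> (sqrt (card W) + 1) * (\<epsilon> / (2 * (sqrt (card W) + 1)))"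
    using \<open>k > 0\<close> by (intro mult_mono) (auto simp: k_def)
  also have "\<dots> = \<epsilon> / 2" using sp by (simp add: field_simps)
  finally have n2: "l2norm f2 \<le> \<epsilon> / 2" using l2(2) by simp
  have eq: "(\<lambda>y. if y \<in> T0 - W then 0 else U y x) = (\<lambda>y. f1 y + f2 y)"
    by (auto simp: f1_def f2_def)
  have "l2norm (\<lambda>y. if y \<in> T0 - W then 0 else U y x) \<le> \<epsilon> / 2 + \<epsilon> / 2"
    unfolding eq by (rule order_trans[OF l2_add(2)[OF l1 l2(1)]]) (intro add_mono n2 T0(3)[folded f1_def])
  moreover have "T0 - W \<subseteq> Y - W" using T0(2) Usupp by blast
  moreover have "\<forall>y. cmod (U y x) < \<delta>" using x(2) by (simp add: k_def)
  ultimately show ?thesis using x(1) T0(1) by (intro exI[of _ x] exI[of _ "T0 - W"]) auto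
qed

text \<open>The state of the recursion also carries a finite set \<open>V\<close> containing all
  truncation sets chosen so far; the next column avoids a ball around each point of
  \<open>V\<close>. The errors decay geometrically so that they can be summed over all
  columns.\<close>

lemma thin_sequence:
  assumes thin: "\<forall>\<delta>>0. \<exists>x\<in>X. \<forall>y. cmod (U y x) < \<delta>"
  obtains x :: "nat \<Rightarrow> 'a" and T :: "nat \<Rightarrow> 'b set"
  where "\<And>n. x n \<in> X" "\<And>n. finite (T n)" "\<And>n. T n \<subseteq> Y" "\<And>n y. cmod (U y (x n)) < (1/2)^n"
    "\<And>n. l2norm (\<lambda>y. if y \<in> T n then 0 else U y (x n)) \<le> (1/2)^(n+3)"
    "\<And>m n s t. m < n \<Longrightarrow> s \<in> T m \<Longrightarrow> t \<in> T n \<Longrightarrow> dY s t > real n"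
proof -
  let ?P = "\<lambda>n (x, T, V). x \<in> X \<and> finite T \<and> T \<subseteq> V \<and> finite V \<and> V \<subseteq> Y \<and> (\<forall>y. cmod (U y x) < (1/2)^n) \<and>
    l2norm (\<lambda>y. if y \<in> T then 0 else U y x) \<le> (1/2)^(n+3)"
  \<comment> \<open>The gap is indexed by the later of the two stages, hence
    \<open>Suc n\<close>.\<close>
  let ?Q = "\<lambda>n (x, T, V) (x', T', V'). V \<subseteq> V' \<and> (\<forall>s\<in>V. \<forall>t\<in>T'. dY s t > real (Suc n))"
  have "\<exists>S. \<forall>n. ?P n (S n) \<and> ?Q n (S n) (S (Suc n))"
  proof (rule dependent_nat_choice)
    have "\<exists>x T. x \<in> X \<and> finite T \<and> T \<subseteq> Y - {} \<and> (\<forall>y. cmod (U y x) < (1/2)^0) \<and>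
      l2norm (\<lambda>y. if y \<in> T then 0 else U y x) \<le> (1/2)^(0+3)"
      by (rule thin_column[OF thin]) auto
    then obtain x T where "x \<in> X" "finite T" "T \<subseteq> Y - {}" "\<forall>y. cmod (U y x) < (1/2)^0"
      "l2norm (\<lambda>y. if y \<in> T then 0 else U y x) \<le> (1/2)^(0+3)" by blast
    then show "\<exists>S. ?P 0 S" by (intro exI[of _ "(x, T, T)"]) auto
  next
    fix S n assume "?P n S"
    then obtain x T V where S: "S = (x, T, V)" "finite V" "V \<subseteq> Y" by (cases S) auto
    define W where "W = (\<Union>v\<in>V. cball_on Y dY v (Suc n))"
    have W: "finite W" unfolding W_def using S by (auto intro!: cballY_finite)
    have "\<exists>x T. x \<in> X \<and> finite T \<and> T \<subseteq> Y - W \<and> (\<forall>y. cmod (U y x) < (1/2)^(Suc n)) \<and>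
      l2norm (\<lambda>y. if y \<in> T then 0 else U y x) \<le> (1/2)^(Suc n+3)"
      by (rule thin_column[OF thin W]) auto
    then obtain x' T' where xT: "x' \<in> X" "finite T'" "T' \<subseteq> Y - W" "\<forall>y. cmod (U y x') < (1/2)^(Suc n)"
      "l2norm (\<lambda>y. if y \<in> T' then 0 else U y x') \<le> (1/2)^(Suc n+3)" by blast
    have "dY s t > real (Suc n)" if "s \<in> V" "t \<in> T'" for s t
    proof (rule ccontr)
      assume "\<not> ?thesis"
      then have "t \<in> W" using that xT(3) by (force simp: W_def cball_on_def)
      then show False using that xT(3) by blast
    qed
    then show "\<exists>S'. ?P (Suc n) S' \<and> ?Q n S S'"
      using xT S by (intro exI[of _ "(x', T', V \<union> T')"]) auto
  qed
  then obtain S where S: "\<forall>n. ?P n (S n) \<and> ?Q n (S n) (S (Suc n))" ..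
  define x where "x = (\<lambda>n. fst (S n))"
  define T where "T = (\<lambda>n. fst (snd (S n)))"
  define V where "V = (\<lambda>n. snd (snd (S n)))"
  have P: "x n \<in> X \<and> finite (T n) \<and> T n \<subseteq> V n \<and> V n \<subseteq> Y \<and> (\<forall>y. cmod (U y (x n)) < (1/2)^n) \<and>
    l2norm (\<lambda>y. if y \<in> T n then 0 else U y (x n)) \<le> (1/2)^(n+3)" for n
    using S[rule_format, of n] by (auto simp: x_def T_def V_def split: prod.splits cong: if_cong)
  have Q: "V n \<subseteq> V (Suc n)" "\<forall>s\<in>V n. \<forall>t\<in>T (Suc n). dY s t > real (Suc n)" for n
    using S[rule_format, of n] by (auto simp: T_def V_def split: prod.splits)
  have Vm: "V m \<subseteq> V n" if "m \<le> n" for m n using lift_Suc_mono_le[of V, OF Q(1) that] .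
  have gap: "dY s t > real n" if "m < n" "s \<in> T m" "t \<in> T n" for m n s t
  proof -
    obtain k where k: "n = Suc k" "m \<le> k" using \<open>m < n\<close> by (cases n) auto
    have "s \<in> V k" using that P[of m] Vm[OF k(2)] by blast
    then show ?thesis using Q(2)[of k] that k by blast
  qed
  show thesis by (rule that[of x T]) (use P gap in auto)
qed

text \<open>If the columns of \<open>U\<close> are not uniformly bounded below in sup norm, thin columns \<open>\<xi>\<close> that are almost supported
  on sets drifting apart can be cut off to \<open>\<eta>\<close>, and \<open>\<Sum> \<eta> \<eta>\<^sup>*\<close> is a noncompact ghost projection.\<close>

lemma columns_bounded_below:
  assumes gh: "\<forall>Z. Z \<subseteq> Y \<and> sparse Z dY \<longrightarrow> only_compact_ghost_projections Z dY"
  shows "\<exists>\<delta>>0. \<forall>x\<in>X. \<exists>y. \<delta> \<le> cmod (U y x)"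
proof (rule ccontr)
  assume "\<not> ?thesis"
  then have thin: "\<forall>\<delta>>0. \<exists>x\<in>X. \<forall>y. cmod (U y x) < \<delta>" by (meson not_le)
  obtain x T where xX: "\<And>n. x n \<in> X" and Tf: "\<And>n. finite (T n)" and TY: "\<And>n. T n \<subseteq> Y"
    and sup: "\<And>n y. cmod (U y (x n)) < (1/2)^n"
    and tail: "\<And>n. l2norm (\<lambda>y. if y \<in> T n then 0 else U y (x n)) \<le> (1/2)^(n+3)"
    and gap: "\<And>m n s t. m < n \<Longrightarrow> s \<in> T m \<Longrightarrow> t \<in> T n \<Longrightarrow> dY s t > real n"
    by (rule thin_sequence[OF thin]) (rule that)
  have disj: "m = n" if "s \<in> T m" "s \<in> T n" for m n s
  proof (rule ccontr)
    assume "m \<noteq> n"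
    have "dY s s = 0" using dY_self that TY by blast
    with \<open>m \<noteq> n\<close> gap[of m n s s] gap[of n m s s] that show False by (cases m n rule: linorder_cases) auto
  qed
  define u where "u = (\<lambda>n y. U y (x n))"
  define w where "w = (\<lambda>n y. if y \<in> T n then U y (x n) else 0)"
  define c where "c = (\<lambda>n. l2norm (w n))"
  have ul: "l2 (u n)" and un: "l2norm (u n) = 1" for n
    using col_l2 col_norm[OF xX] by (auto simp: u_def)
  have wl: "l2 (w n)" for n by (rule l2_dominated(1)[OF ul[of n]]) (auto simp: u_def w_def)
  have tl: "l2norm (\<lambda>y. u n y - w n y) \<le> (1/2)^(n+3)" for n
  proof -
    have "(\<lambda>y. u n y - w n y) = (\<lambda>y. if y \<in> T n then 0 else U y (x n))" by (auto simp: u_def w_def)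
    then show ?thesis using tail by simp
  qed
  have c1: "c n \<le> 1" for n
    using l2_dominated(2)[OF ul[of n], of "w n"] un by (auto simp: c_def u_def w_def)
  have c2: "c n \<ge> 1 - (1/2)^(n+3)" for n
    using l2_add(2)[OF wl[of n] l2_diff(1)[OF ul[of n] wl[of n]]] un[of n] tl[of n] by (simp add: c_def)
  have p8: "(1/2::real)^(n+3) \<le> 1/8" for n
    using power_decreasing[of 3 "n+3" "1/2::real"] by (simp add: power3_eq_cube)
  have c3: "c n \<ge> 7/8" for n using c2[of n] p8[of n] by linarith
  \<comment> \<open>A column chosen twice would carry most of its mass on two disjoint sets: the 7/8
    kept at stage \<open>m\<close> would have to fit into the tail of at most 1/8 at stage
    \<open>n\<close>.\<close>
  have xinj: "inj x"
  proof (rule injI, rule ccontr)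
    fix m n assume mn: "x m = x n" "m \<noteq> n"
    have "c m \<le> l2norm (\<lambda>y. u n y - w n y)"
      unfolding c_def using mn disj by (intro l2_dominated(2) l2_diff(1) ul wl) (auto simp: u_def w_def)
    then show False using tl[of n] p8[of n] c3[of m] by linarith
  qed
  define \<eta> where "\<eta> = (\<lambda>n y. of_real (inverse (c n)) * w n y)"
  have \<eta>l: "l2 (\<eta> n)" for n unfolding \<eta>_def by (rule l2_scale[OF wl])
  have ci: "cmod (of_real (inverse (c n))) = inverse (c n)" for n using c3[of n] by (simp add: norm_inverse)
  have \<eta>n: "l2norm (\<eta> n) = 1" for n
    unfolding \<eta>_def l2norm_scale ci using c3[of n] by (simp add: c_def)
  have \<eta>0: "y \<notin> T n \<Longrightarrow> \<eta> n y = 0" for n y by (simp add: \<eta>_def w_def)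
  have close: "l2norm (\<lambda>y. u n y - \<eta> n y) \<le> (1/2)^(n+2)" for n
  proof -
    have "(\<lambda>y. u n y - \<eta> n y) = (\<lambda>y. (u n y - w n y) + of_real (1 - inverse (c n)) * w n y)"
      by (auto simp: \<eta>_def algebra_simps)
    then have "l2norm (\<lambda>y. u n y - \<eta> n y) \<le> l2norm (\<lambda>y. u n y - w n y) + cmod (of_real (1 - inverse (c n))) * c n"
      using l2_add(2)[OF l2_diff(1)[OF ul[of n] wl[of n]] l2_scale[OF wl[of n], of "of_real (1 - inverse (c n))"]]
      by (simp add: l2norm_scale c_def)
    also have "cmod (of_real (1 - inverse (c n))) * c n = 1 - c n"
    proof -
      have "1 - inverse (c n) \<le> 0" using c1[of n] c3[of n] by (simp add: one_le_inverse_iff)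
      then show ?thesis unfolding norm_of_real using c3[of n] by (simp add: algebra_simps)
    qed
    also have "l2norm (\<lambda>y. u n y - w n y) + (1 - c n) \<le> (1/2)^(n+3) + (1/2)^(n+3)"
      using tl[of n] c2[of n] by linarith
    also have "\<dots> = (1/2)^(n+2)" by (simp add: power_add power3_eq_cube power2_eq_square)
    finally show ?thesis .
  qed
  \<comment> \<open>The sets \<open>T n\<close> are disjoint, so this sum has at most one term and
    no convergence question arises.\<close>
  define q where "q = (\<lambda>s t. \<Sum>n | s \<in> T n. \<eta> n s * cnj (\<eta> n t))"
  have uniq: "{n. s \<in> T n} = {n}" if "s \<in> T n" for s n using that disj by blast
  have qrow: "q s t = \<eta> n s * cnj (\<eta> n t)" if "s \<in> T n" for s t n
    using that by (simp add: q_def uniq)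
  have q0: "q s t = 0" if "\<And>n. s \<notin> T n" for s t using that by (simp add: q_def)
  have qcol: "q s t = \<eta> n s * cnj (\<eta> n t)" if "t \<in> T n" for s t n
  proof (cases "\<exists>m. s \<in> T m")
    case True
    then obtain m where m: "s \<in> T m" by blast
    show ?thesis
    proof (cases "m = n")
      case False
      then have "s \<notin> T n" "t \<notin> T m" using disj m that by blast+
      then show ?thesis using qrow[OF m] by (simp add: \<eta>0)
    qed (use qrow m in simp)
  next
    case False
    then show ?thesis using q0[of s] \<eta>0 by auto
  qed
  define Z where "Z = (\<Union>n. T n)"
  have ZY: "Z \<subseteq> Y" using TY by (auto simp: Z_def)
  have qsupp: "supp_on Z q"
  proof -
    have "s \<in> Z \<and> t \<in> Z" if "q s t \<noteq> 0" for s t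
    proof -
      have "\<exists>n. s \<in> T n" by (rule ccontr) (use q0[of s t] that in simp)
      then obtain n where n: "s \<in> T n" ..
      then have "t \<in> T n" using that qrow[OF n] \<eta>0 by auto
      with n show ?thesis by (auto simp: Z_def)
    qed
    then show ?thesis by (auto simp: supp_on_def)
  qed
  text \<open>\<open>\<Sum> \<xi> \<xi>\<^sup>*\<close> is the image of a diagonal projection, and \<open>\<Sum> (\<xi> \<xi>\<^sup>* - \<eta> \<eta>\<^sup>*)\<close> converges in norm.\<close>
  define S where "S = range x"
  define p where "p = rmul U (rmul (kid S) (kadj U))"
  have "kid S \<in> roe X dX"
  proof (rule partial_perm_roe[where r=0])
    show "propg_le dX (kid S) 0"
      using xX dX_self by (auto simp: kid_def S_def propg_le_def split: if_splits)
  qed (use xX in \<open>auto simp: partial_perm_def kid_def supp_on_def S_def split: if_splits\<close>)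
  then have pR: "p \<in> roe Y dY" unfolding p_def by (rule img)
  have psums: "(\<lambda>n. u n s * cnj (u n t)) sums p s t" for s t
  proof -
    have k: "rmul (kid S) (kadj U) z t = (if z \<in> S then cnj (U t z) else 0)" for z
    proof -
      have "rmul (kid S) (kadj U) z t = kid S z z * kadj U z t"
        unfolding rmul_def by (rule infsum_single) (auto simp: kid_def)
      then show ?thesis by (auto simp: kid_def kadj_def)
    qed
    have l: "l2 (\<lambda>z. if z \<in> S then cnj (U t z) else 0)"
      by (rule l2_dominated(1)[OF row_l2[of t]]) auto
    have "((\<lambda>z. U s z * (if z \<in> S then cnj (U t z) else 0)) has_sum p s t) UNIV"
      unfolding p_def rmul_def[of U] k by (rule has_sum_infsum, rule l2_prod(1)[OF row_l2 l])
    then have "((\<lambda>z. U s z * cnj (U t z)) has_sum p s t) (x ` UNIV)"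
      by (subst (asm) has_sum_cong_neutral[where S="UNIV" and T="x ` UNIV" and g="\<lambda>z. U s z * cnj (U t z)"])
        (auto simp: S_def)
    then have "((\<lambda>n. u n s * cnj (u n t)) has_sum p s t) UNIV"
      unfolding has_sum_reindex[OF xinj] by (simp add: o_def u_def)
    then show ?thesis by (rule has_sum_imp_sums)
  qed
  have qsums: "(\<lambda>n. \<eta> n s * cnj (\<eta> n t)) sums q s t" for s t
  proof (cases "\<exists>n. s \<in> T n")
    case True
    then obtain n where n: "s \<in> T n" by blast
    have "\<eta> m s * cnj (\<eta> m t) = 0" if "m \<notin> {n}" for m using that disj[OF n, of m] \<eta>0[of s m] by auto
    then have "(\<lambda>n. \<eta> n s * cnj (\<eta> n t)) sums (\<Sum>m\<in>{n}. \<eta> m s * cnj (\<eta> m t))"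
      by (intro sums_finite) auto
    then show ?thesis using qrow[OF n] by simp
  next
    case False
    then show ?thesis using q0[of s t] \<eta>0 by simp
  qed
  define D where "D = (\<lambda>n s t. u n s * cnj (u n t) - \<eta> n s * cnj (\<eta> n t))"
  have uY: "l2vec Y (u n)" "l2vec Y (\<lambda>y. cnj (u n y))" for n
    using ul Usupp by (auto simp: l2vec_iff u_def)
  have "\<eta> n y = 0" if "y \<notin> Y" for n y using that TY[of n] by (intro \<eta>0) blast
  then have \<eta>Y: "l2vec Y (\<eta> n)" "l2vec Y (\<lambda>y. cnj (\<eta> n y))" for n
    using \<eta>l by (auto simp: l2vec_iff)
  have DR: "D n \<in> roe Y dY" for n
    unfolding D_def by (intro roe_diff roe_rank1 uY \<eta>Y)
  have Dn: "bnd ((1/2)^(n+1)) (D n)" for n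
  proof -
    have eq: "D n = (\<lambda>s t. (u n s - \<eta> n s) * cnj (u n t) + \<eta> n s * cnj (u n t - \<eta> n t))"
      by (auto simp: D_def algebra_simps)
    have l: "l2 (\<lambda>y. u n y - \<eta> n y)" by (rule l2_diff(1)[OF ul \<eta>l])
    have "bnd (l2norm (\<lambda>y. u n y - \<eta> n y) * l2norm (\<lambda>y. cnj (u n y)) + l2norm (\<eta> n) * l2norm (\<lambda>y. cnj (u n y - \<eta> n y))) (D n)"
      unfolding eq by (intro bnd_add bnd_rank1 l \<eta>l) (simp_all only: l2_cnj ul l)
    then have "bnd (2 * l2norm (\<lambda>y. u n y - \<eta> n y)) (D n)"
      unfolding l2norm_cnj by (simp add: un \<eta>n)
    then show ?thesis by (rule bnd_mono) (use close[of n] in \<open>simp add: power_add power2_eq_square\<close>)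
  qed
  have "(\<lambda>s t. p s t - q s t) \<in> roe Y dY"
  proof (rule roe_limit)
    have "supp_on Y q" using qsupp ZY by (auto simp: supp_on_def)
    then show "supp_on Y (\<lambda>s t. p s t - q s t)" by (intro supp_on_diff roe_supp[OF pR])
    fix e :: real assume "e > 0"
    then obtain N where N: "(1/2)^N < e" using real_arch_pow_inv[of e "1/2"] by auto
    \<comment> \<open>The blocks from \<open>N\<close> on have norms summing to at most
      \<open>(1/2)^N\<close>, uniformly in the number of blocks; the entrywise limit keeps the
      bound.\<close>
    have "bnd ((1/2)^N) (\<lambda>s t. (p s t - q s t) - (\<Sum>n<N. D n s t))"
    proof (rule bnd_limit)
      fix M
      have "bnd (\<Sum>n\<in>{N..<N+M}. (1/2)^(n+1)) (\<lambda>s t. \<Sum>n\<in>{N..<N+M}. D n s t)"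
        by (rule bnd_sum) (use Dn in auto)
      moreover have "(\<Sum>n\<in>{N..<N+M}. (1/2::real)^(n+1)) \<le> (1/2)^N"
      proof -
        have "(\<Sum>n\<in>{N..<N+M}. (1/2::real)^(n+1)) = (1/2)^N - (1/2)^(N+M)"
          by (induction M) simp_all
        then show ?thesis by simp
      qed
      ultimately have "bnd ((1/2)^N) (\<lambda>s t. \<Sum>n\<in>{N..<N+M}. D n s t)" by (rule bnd_mono)
      moreover have "(\<Sum>n\<in>{N..<N+M}. D n s t) = (\<Sum>n<M+N. D n s t) - (\<Sum>n<N. D n s t)" for s t
        using sum.atLeastLessThan_concat[of 0 N "M+N" "\<lambda>n. D n s t"]
        by (simp add: lessThan_atLeast0 add.commute) (simp add: algebra_simps)
      ultimately show "bnd ((1/2)^N) (\<lambda>s t. (\<Sum>n<M+N. D n s t) - (\<Sum>n<N. D n s t))" by simp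
    next
      fix s t
      have "(\<lambda>n. D n s t) sums (p s t - q s t)"
        unfolding D_def by (rule sums_diff[OF psums qsums])
      then have "(\<lambda>M. \<Sum>n<M. D n s t) \<longlonglongrightarrow> p s t - q s t" by (simp add: sums_def)
      then have "(\<lambda>M. \<Sum>n<M+N. D n s t) \<longlonglongrightarrow> p s t - q s t" by (rule LIMSEQ_ignore_initial_segment)
      then show "(\<lambda>M. (\<Sum>n<M+N. D n s t) - (\<Sum>n<N. D n s t)) \<longlonglongrightarrow> p s t - q s t - (\<Sum>n<N. D n s t)"
        by (intro tendsto_diff tendsto_const)
    qed
    then have "bnd e (\<lambda>s t. (p s t - q s t) - (\<Sum>n<N. D n s t))" by (rule bnd_mono) (use N in simp)
    moreover have "(\<lambda>s t. \<Sum>n<N. D n s t) \<in> roe Y dY"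
      by (rule roe_sum) (use DR mzero_roe in auto)
    ultimately show "\<exists>b\<in>roe Y dY. bnd e (\<lambda>s t. (p s t - q s t) - b s t)" by (rule bexI)
  qed
  from roe_diff[OF pR this] have "q \<in> roe Y dY" by simp
  then have qZ: "q \<in> roe Z dY" by (rule roe_restrict[OF _ qsupp ZY])
  have "sparse Z dY" unfolding sparse_def
  proof (intro exI[of _ T] conjI allI)
    show "disjoint_family T" using disj by (auto simp: disjoint_family_on_def)
    show "(\<Union>n. T n) = Z" by (simp add: Z_def)
    fix r :: real
    \<comment> \<open>If \<open>n + m\<close> is at least \<open>2 * k\<close>, the larger index
      exceeds \<open>k\<close>, and the gap is governed by the larger index.\<close>
    obtain k :: nat where k: "r \<le> k" using real_arch_simple by blast
    have "r < dY s t" if "m < n" "2 * k \<le> n + m" "s \<in> T m" "t \<in> T n" for m n s t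
      using gap[OF that(1,3,4)] that(1,2) k by linarith
    moreover have "dY s t = dY t s" if "s \<in> T m" "t \<in> T n" for s t m n
      using dY_sym that TY by blast
    ultimately have "\<forall>n m. n \<noteq> m \<and> 2 * k \<le> n + m \<longrightarrow> (\<forall>x\<in>T n. \<forall>y\<in>T m. r < dY x y)"
      by (metis add.commute linorder_neqE_nat)
    then show "\<exists>N. \<forall>n m. n \<noteq> m \<and> N \<le> n + m \<longrightarrow> (\<forall>x\<in>T n. \<forall>y\<in>T m. r < dY x y)" by blast
  qed (rule Tf)
  moreover have "ghost q" unfolding ghost_def
  proof (intro allI impI)
    fix e :: real assume "e > 0"
    then obtain N where N: "(1/2)^N < e/2" using real_arch_pow_inv[of "e/2" "1/2"] by auto
    have "cmod (q s t) \<le> e" if "s \<notin> (\<Union>n<N. T n)" for s t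
    proof (cases "\<exists>n. s \<in> T n")
      case True
      then obtain n where n: "s \<in> T n" by blast
      then have nN: "N \<le> n" using that by (meson UN_I lessThan_iff not_le)
      have "cmod (\<eta> n t) \<le> 1" using fnorm_le_l2norm[OF \<eta>l, of n "{t}"] \<eta>n[of n] by simp
      then have "cmod (q s t) \<le> cmod (\<eta> n s)" unfolding qrow[OF n] norm_mult complex_mod_cnj
        by (simp add: mult_left_le)
      also have "\<dots> = inverse (c n) * cmod (U s (x n))" unfolding \<eta>_def norm_mult ci using n by (simp add: w_def)
      also have "\<dots> \<le> 2 * (1/2)^n"
        using sup[of s n] c3[of n] by (intro mult_mono) (auto simp: field_simps)
      also have "\<dots> \<le> 2 * (1/2)^N" using power_decreasing[OF nN, of "1/2::real"] by simp
      finally show ?thesis using N by simp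
    next
      case False
      then show ?thesis using q0[of s t] \<open>e > 0\<close> by simp
    qed
    then show "\<exists>F. finite F \<and> (\<forall>x y. x \<notin> F \<and> y \<notin> F \<longrightarrow> cmod (q x y) \<le> e)"
      using Tf by (intro exI[of _ "\<Union>n<N. T n"]) auto
  qed
  moreover have "projection q" unfolding projection_def
  proof
    have \<eta>\<eta>: "infsum (\<lambda>r. cnj (\<eta> n r) * \<eta> n r) UNIV = 1" for n
      using infsum_norm_sq[OF \<eta>l[of n]] \<eta>n[of n] by (simp add: mult.commute)
    show "mmul q q = q"
    proof (intro ext)
      fix s t
      show "mmul q q s t = q s t"
      proof (cases "\<exists>n. s \<in> T n")
        case True
        then obtain n where n: "s \<in> T n" by blast
        have "q s r * q r t = \<eta> n s * cnj (\<eta> n r) * (\<eta> n r * cnj (\<eta> n t))" for r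
          unfolding qrow[OF n] using qrow[of r n] \<eta>0[of r n] by (cases "r \<in> T n") auto
        then have "mmul q q s t = \<eta> n s * cnj (\<eta> n t)" unfolding mmul_def by (simp only: infsum_pull \<eta>\<eta> mult_1_right)
        then show ?thesis using qrow[OF n] by simp
      next
        case False
        then have "q s r = 0" for r using q0[of s r] by simp
        then show ?thesis by (simp add: mmul_def)
      qed
    qed
    show "madj q = q"
    proof (intro ext)
      fix s t
      show "madj q s t = q s t"
      proof (cases "\<exists>n. s \<in> T n")
        case True
        then obtain n where n: "s \<in> T n" by blast
        show ?thesis unfolding madj_def qrow[OF n] qcol[OF n] by simp
      next
        case False
        then have "q t s = 0" "q s t = 0" using qsupp by (auto simp: supp_on_def Z_def)
        then show ?thesis by (simp add: madj_def)
      qed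
    qed
  qed
  ultimately have "compact_op Z q"
    using gh ZY qZ unfolding only_compact_ghost_projections_def by blast
  \<comment> \<open>The unit vectors \<open>\<eta> n\<close> are fixed by \<open>q\<close> and have
    disjoint supports. With a finite 1/4-net two of them share a net point and are within 1/2 of
    each other, while on \<open>T n\<close> their difference already has norm 1.\<close>
  then have "\<exists>G. finite G \<and> (\<forall>g\<in>G. l2vec Z g) \<and>
     (\<forall>f. l2vec Z f \<and> l2norm f \<le> 1 \<longrightarrow> (\<exists>g\<in>G. l2norm (vsub (mvec q f) g) \<le> 1/4))"
    unfolding compact_op_def by (elim allE[of _ "1/4"]) simp
  then obtain G where G: "finite G" "\<And>g. g \<in> G \<Longrightarrow> l2vec Z g"
    "\<And>f. l2vec Z f \<Longrightarrow> l2norm f \<le> 1 \<Longrightarrow> \<exists>g\<in>G. l2norm (vsub (mvec q f) g) \<le> 1/4"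
    by blast
  have q\<eta>: "mvec q (\<eta> n) = \<eta> n" for n
  proof
    fix s
    have "q s r * \<eta> n r = \<eta> n s * cnj (\<eta> n r) * (\<eta> n r * 1)" for r
      using qcol[of r n s] \<eta>0[of r n] by (cases "r \<in> T n") auto
    then have "mvec q (\<eta> n) s = \<eta> n s * 1 * infsum (\<lambda>r. cnj (\<eta> n r) * \<eta> n r) UNIV"
      unfolding mvec_def by (simp only: infsum_pull)
    then show "mvec q (\<eta> n) s = \<eta> n s"
      using infsum_norm_sq[OF \<eta>l[of n]] \<eta>n[of n] by (simp add: mult.commute)
  qed
  have "\<exists>g\<in>G. l2norm (vsub (\<eta> n) g) \<le> 1/4" for n
  proof -
    have "l2vec Z (\<eta> n)" using \<eta>l \<eta>0 by (auto simp: l2vec_iff Z_def)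
    from G(3)[OF this] show ?thesis using \<eta>n[of n] q\<eta>[of n] by simp
  qed
  then obtain g where g: "\<And>n. g n \<in> G" "\<And>n. l2norm (vsub (\<eta> n) (g n)) \<le> 1/4" by metis
  have "\<not> inj g"
  proof
    assume "inj g"
    then have "finite (UNIV :: nat set)" using G(1) g(1) by (metis finite_imageD finite_subset image_subsetI)
    then show False by simp
  qed
  then obtain m n where mn: "m \<noteq> n" "g m = g n" by (auto simp: inj_def)
  have gl: "l2 (g n)" for n using G(2) g(1) by (auto simp: l2vec_iff)
  have eq: "(\<lambda>y. \<eta> n y - \<eta> m y) = (\<lambda>y. (\<eta> n y - g n y) - (\<eta> m y - g m y))" using mn by auto
  have "l2norm (\<lambda>y. \<eta> n y - \<eta> m y) \<le> 1/4 + 1/4"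
    unfolding eq
    by (rule order_trans[OF l2_diff(2)]) (use g(2)[of n] g(2)[of m] in \<open>auto intro!: l2_diff(1) \<eta>l gl simp: vsub_def\<close>)
  moreover have "fnorm (\<lambda>y. \<eta> n y - \<eta> m y) (T n) = fnorm (\<eta> n) (T n)"
  proof (intro L2_set_cong refl)
    fix y assume "y \<in> T n"
    then have "y \<notin> T m" using mn disj by blast
    then show "cmod (\<eta> n y - \<eta> m y) = cmod (\<eta> n y)" by (simp add: \<eta>0)
  qed
  moreover have "fnorm (\<eta> n) (T n) = 1"
    using l2_finite_support(2)[OF Tf[of n], of "\<eta> n"] \<eta>0 \<eta>n[of n] by simp
  ultimately show False using fnorm_le_l2norm[OF l2_diff(1)[OF \<eta>l[of n] \<eta>l[of m]], of "T n"] by simp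
qed

end

section \<open>Uniform approximation by a gliding hump\<close>

lemma fnorm_sum: "fnorm (\<lambda>z. \<Sum>i\<in>I. f i z) T \<le> (\<Sum>i\<in>I. fnorm (f i) T)"
proof (induction I rule: infinite_finite_induct)
  case (insert i I)
  then show ?case using fnorm_add[of "f i" "\<lambda>z. \<Sum>i\<in>I. f i z" T] by simp
qed (simp_all add: L2_set_def)

text \<open>By the parallelogram law the square norms of \<open>w a + v\<close> and
  \<open>w a - v\<close> average to the sum of the two square norms, so one of the signs loses
  nothing when a term is added.\<close>

lemma exists_signs:
  fixes w :: "'a \<Rightarrow> 'b \<Rightarrow> complex"
  assumes "finite S"
  shows "\<exists>\<sigma>. (\<forall>x. cmod (\<sigma> x) = 1) \<and> (\<Sum>x\<in>S. \<Sum>z\<in>T. (cmod (w x z))\<^sup>2) \<le> (\<Sum>z\<in>T. (cmod (\<Sum>x\<in>S. \<sigma> x * w x z))\<^sup>2)"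
  using assms
proof (induction S rule: finite_induct)
  case empty
  then show ?case by (auto intro!: exI[of _ "\<lambda>_. 1"])
next
  case (insert a S)
  then obtain \<sigma> where \<sigma>: "\<And>x. cmod (\<sigma> x) = 1"
    "(\<Sum>x\<in>S. \<Sum>z\<in>T. (cmod (w x z))\<^sup>2) \<le> (\<Sum>z\<in>T. (cmod (\<Sum>x\<in>S. \<sigma> x * w x z))\<^sup>2)" by blast
  define v where "v = (\<lambda>z. \<Sum>x\<in>S. \<sigma> x * w x z)"
  have par: "(cmod (p + q))\<^sup>2 + (cmod (p - q))\<^sup>2 = 2 * (cmod q)\<^sup>2 + 2 * (cmod p)\<^sup>2" for p q
    by (simp add: cmod_power2 power2_sum power2_diff)
  have "(\<Sum>z\<in>T. (cmod (w a z + v z))\<^sup>2) + (\<Sum>z\<in>T. (cmod (w a z - v z))\<^sup>2)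
    = 2 * (\<Sum>z\<in>T. (cmod (v z))\<^sup>2) + 2 * (\<Sum>z\<in>T. (cmod (w a z))\<^sup>2)"
    unfolding sum.distrib[symmetric] par by (simp add: sum.distrib sum_distrib_left)
  then consider "(\<Sum>z\<in>T. (cmod (v z))\<^sup>2) + (\<Sum>z\<in>T. (cmod (w a z))\<^sup>2) \<le> (\<Sum>z\<in>T. (cmod (w a z + v z))\<^sup>2)"
    | "(\<Sum>z\<in>T. (cmod (v z))\<^sup>2) + (\<Sum>z\<in>T. (cmod (w a z))\<^sup>2) \<le> (\<Sum>z\<in>T. (cmod (w a z - v z))\<^sup>2)" by linarith
  then obtain k where k: "cmod k = 1"
    "(\<Sum>z\<in>T. (cmod (v z))\<^sup>2) + (\<Sum>z\<in>T. (cmod (w a z))\<^sup>2) \<le> (\<Sum>z\<in>T. (cmod (k * w a z + v z))\<^sup>2)"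
  proof cases
    case 1
    then show ?thesis by (intro that[of 1]) auto
  next
    case 2
    have "cmod (- 1 * w a z + v z) = cmod (w a z - v z)" for z by (simp add: norm_minus_commute)
    with 2 show ?thesis by (intro that[of "-1"]) (simp_all only:, simp)
  qed
  have v: "v z = (\<Sum>x\<in>S. (\<sigma>(a := k)) x * w x z)" for z
    unfolding v_def using insert.hyps by (intro sum.cong) auto
  have "(\<Sum>x\<in>insert a S. \<Sum>z\<in>T. (cmod (w x z))\<^sup>2) \<le> (\<Sum>z\<in>T. (cmod (k * w a z + v z))\<^sup>2)"
    using insert.hyps k(2) \<sigma>(2) by (simp add: v_def)
  also have "\<dots> = (\<Sum>z\<in>T. (cmod (\<Sum>x\<in>insert a S. (\<sigma>(a := k)) x * w x z))\<^sup>2)"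
    using insert.hyps by (subst v) simp
  finally show ?case using \<sigma>(1) k(1) by (intro exI[of _ "\<sigma>(a := k)"]) auto
qed

context roe_unitary
begin

definition cj :: "'a cmat \<Rightarrow> 'b cmat" where
  "cj a = rmul U (rmul a (kadj U))"

text \<open>Tails are tested on finite sets outside the closed ball, so that tail norms are finite
  sums.\<close>

definition far :: "'b \<Rightarrow> real \<Rightarrow> 'b set \<Rightarrow> bool" where
  "far y r T \<longleftrightarrow> finite T \<and> T \<subseteq> Y \<and> (\<forall>z\<in>T. dY y z > r)"

text \<open>Weighted partial translations of X with propagation at most \<open>t\<close>; an upper
  bound rather than an exact propagation keeps the class closed under removing entries.\<close>

definition pperm :: "real \<Rightarrow> 'a cmat \<Rightarrow> bool" where
  "pperm t a \<longleftrightarrow> partial_perm a \<and> supp_on X a \<and> propg_le dX a t"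

lemma far_mono: "far y r T \<Longrightarrow> r' \<le> r \<Longrightarrow> far y r' T"
  by (force simp: far_def)

lemma cj_add:
  assumes "bnd C a" "bnd D b"
  shows "cj (\<lambda>x x'. a x x' + b x x') z y = cj a z y + cj b z y"
  unfolding cj_def
  by (simp add: rmul_add_left[OF assms Uab] rmul_add_right[OF bnd_rmul[OF assms(1) Uab] bnd_rmul[OF assms(2) Uab] Ub])

lemma cj_finite:
  assumes "finite F" "supp_on F a"
  shows "cj a z y = (\<Sum>x\<in>F. \<Sum>x'\<in>F. a x x' * (U z x * cnj (U y x')))"
proof -
  have r: "rmul a (kadj U) x y = (\<Sum>x'\<in>F. a x x' * cnj (U y x'))" for x
    unfolding rmul_def by (rule infsumI, rule has_sum_finite_neutralI)
      (use assms in \<open>auto simp: supp_on_def kadj_def\<close>)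
  have "rmul a (kadj U) x y = 0" if "x \<notin> F" for x
    unfolding r using that assms(2) by (intro sum.neutral) (auto simp: supp_on_def)
  then have "cj a z y = (\<Sum>x\<in>F. U z x * rmul a (kadj U) x y)"
    unfolding cj_def rmul_def[of U] by (intro infsumI has_sum_finite_neutralI) (use assms in auto)
  then show ?thesis unfolding r by (simp add: sum_distrib_left ac_simps)
qed

lemma cj_eunit: "cj (eunit x x') z y = U z x * cnj (U y x')"
proof -
  have "cj (eunit x x') z y = (\<Sum>s\<in>{x, x'}. \<Sum>t\<in>{x, x'}. eunit x x' s t * (U z s * cnj (U y t)))"
    by (rule cj_finite) (auto simp: supp_on_def eunit_def)
  then show ?thesis by (cases "x = x'") (auto simp: eunit_def)
qed

text \<open>A finite propagation approximant vanishes on the far part of column \<open>y\<close>,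
  leaving only the norm error. The radius depends on \<open>c\<close> but not on
  \<open>y\<close>.\<close>

lemma roe_column_tail:
  assumes "c \<in> roe Y dY" "\<gamma> > 0"
  shows "\<exists>r. \<forall>y\<in>Y. \<forall>T. far y r T \<longrightarrow> fnorm (\<lambda>z. c z y) T \<le> \<gamma>"
proof -
  obtain b r where b: "propg_le dY b r" "bnd \<gamma> (\<lambda>x y. c x y - b x y)"
    using roe_approx[OF assms] by metis
  have "fnorm (\<lambda>z. c z y) T \<le> \<gamma>" if "y \<in> Y" "far y r T" for y T
  proof -
    have "b z y = 0" if "z \<in> T" for z
      using b(1) that \<open>y \<in> Y\<close> \<open>far y r T\<close> dY_sym[of y z] by (force simp: propg_le_def far_def)
    then have "fnorm (\<lambda>z. c z y) T = fnorm (\<lambda>z. c z y - b z y) T" by (intro L2_set_cong) auto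
    also have "\<dots> \<le> \<gamma>"
      using fnorm_le_l2norm[OF bnd_col(1)[OF b(2)]] bnd_col(2)[OF b(2)] by (rule order_trans)
    finally show ?thesis .
  qed
  then show ?thesis by blast
qed

text \<open>Operators on a finite block are combinations of finitely many matrix units with
  coefficients of modulus at most 1. One radius serves the images of all these units, with the error
  shared among the \<open>card F * card F\<close> terms.\<close>

lemma finite_block_tail:
  assumes "finite F" "F \<subseteq> X" "\<gamma> > 0"
  shows "\<exists>r. \<forall>y\<in>Y. \<forall>a. (\<forall>x x'. cmod (a x x') \<le> 1) \<and> supp_on F a \<longrightarrow>
    (\<forall>T. far y r T \<longrightarrow> fnorm (\<lambda>z. cj a z y) T \<le> \<gamma>)"
proof -
  define k where "k = \<gamma> / (real (card F * card F) + 1)"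
  have k: "k > 0" using assms by (simp add: k_def add_nonneg_pos)
  have "\<forall>p\<in>F \<times> F. \<exists>r. \<forall>y\<in>Y. \<forall>T. far y r T \<longrightarrow> fnorm (\<lambda>z. cj (eunit (fst p) (snd p)) z y) T \<le> k"
    using assms(2) k by (auto simp: cj_def intro!: roe_column_tail img eunit_roe)
  then obtain r where r: "\<And>p y T. p \<in> F \<times> F \<Longrightarrow> y \<in> Y \<Longrightarrow> far y (r p) T \<Longrightarrow>
     fnorm (\<lambda>z. cj (eunit (fst p) (snd p)) z y) T \<le> k" by metis
  have "bdd_above (r ` (F \<times> F))" using assms(1) by (intro bdd_above_finite) auto
  then obtain R where R: "\<And>p. p \<in> F \<times> F \<Longrightarrow> r p \<le> R" unfolding bdd_above_def by blast
  have "fnorm (\<lambda>z. cj a z y) T \<le> \<gamma>"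
    if "y \<in> Y" "\<And>x x'. cmod (a x x') \<le> 1" "supp_on F a" "far y R T" for y a T
  proof -
    have "fnorm (\<lambda>z. cj a z y) T = fnorm (\<lambda>z. \<Sum>p\<in>F \<times> F. a (fst p) (snd p) * cj (eunit (fst p) (snd p)) z y) T"
      by (simp add: cj_finite[OF assms(1) that(3)] cj_eunit sum.cartesian_product case_prod_beta)
    also have "\<dots> \<le> (\<Sum>p\<in>F \<times> F. fnorm (\<lambda>z. a (fst p) (snd p) * cj (eunit (fst p) (snd p)) z y) T)"
      by (rule fnorm_sum)
    also have "\<dots> \<le> (\<Sum>p\<in>F \<times> F. k)"
    proof (rule sum_mono)
      fix p assume p: "p \<in> F \<times> F"
      have "fnorm (\<lambda>z. a (fst p) (snd p) * cj (eunit (fst p) (snd p)) z y) T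
        \<le> 1 * fnorm (\<lambda>z. cj (eunit (fst p) (snd p)) z y) T"
        unfolding fnorm_scale by (intro mult_right_mono that) auto
      also have "\<dots> \<le> k" using r[OF p that(1) far_mono[OF that(4) R[OF p]]] by simp
      finally show "fnorm (\<lambda>z. a (fst p) (snd p) * cj (eunit (fst p) (snd p)) z y) T \<le> k" .
    qed
    also have "\<dots> = real (card F * card F) * k" by (simp add: card_cartesian_product)
    also have "\<dots> \<le> (real (card F * card F) + 1) * k" using k by (simp add: mult_right_mono)
    also have "\<dots> = \<gamma>" unfolding k_def by (simp add: add_nonneg_pos less_imp_neq[symmetric])
    finally show ?thesis .
  qed
  then show ?thesis by blast
qed

text \<open>Column \<open>y\<close> of \<open>U a U*\<close> is \<open>U\<close> applied to
  \<open>a\<close> applied to the conjugated row \<open>y\<close> of \<open>U\<close>. If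
  \<open>a\<close> ignores \<open>G\<close>, only the part of that row outside \<open>G\<close>
  counts, and \<open>U\<close> and \<open>a\<close> are contractions.\<close>

lemma cj_avoiding_columns:
  assumes "bnd 1 a" "\<And>x x'. x' \<in> G \<Longrightarrow> a x x' = 0"
  shows "fnorm (\<lambda>z. cj a z y) T \<le> l2norm (\<lambda>x. if x \<in> G then 0 else U y x)"
proof -
  define v where "v = (\<lambda>x. if x \<in> G then 0 else cnj (U y x))"
  have vl: "l2 v" by (rule l2_dominated(1)[OF row_l2[of y]]) (auto simp: v_def)
  have "(\<lambda>x. rmul a (kadj U) x y) = kapp a v"
    unfolding rmul_def kapp_def v_def kadj_def using assms(2) by (intro ext infsum_cong) auto
  then have eq: "cj a z y = kapp U (kapp a v) z" for z by (simp add: cj_def rmul_kapp fun_eq_iff)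
  have "fnorm (\<lambda>z. cj a z y) T \<le> l2norm (kapp U (kapp a v))"
    unfolding eq by (intro fnorm_le_l2norm kapp_l2(1)[OF Ub] kapp_l2(1)[OF assms(1)] vl)
  also have "\<dots> \<le> 1 * l2norm (kapp a v)" by (intro kapp_l2(2)[OF Ub] kapp_l2(1)[OF assms(1)] vl)
  also have "\<dots> \<le> 1 * l2norm v" using kapp_l2(2)[OF assms(1) vl] by simp
  also have "l2norm v = l2norm (\<lambda>x. cnj (if x \<in> G then 0 else U y x))"
    unfolding v_def by (rule arg_cong[where f=l2norm]) auto
  finally show ?thesis by simp
qed

text \<open>Entries of a bad operator that meet \<open>F\<close> lie, by the propagation bound, in a
  finite neighbourhood of \<open>F\<close> and have a small far tail. Deleting them costs \<gamma>/8
  and keeps the tail above \<gamma>/2. The new set \<open>F'\<close> must contain the support of the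
  surviving block and almost all of row \<open>y\<close> of \<open>U\<close>, so that later blocks
  are invisible at \<open>y\<close>.\<close>

lemma gliding_hump_step:
  assumes fail: "\<forall>r. \<exists>y\<in>Y. \<exists>a F T. pperm t a \<and> finite F \<and> supp_on F a \<and> far y r T \<and> fnorm (\<lambda>z. cj a z y) T > \<gamma>"
    and \<gamma>: "\<gamma> > 0" and F: "finite F" "F \<subseteq> X"
  shows "\<exists>r y a T F'. y \<in> Y \<and> pperm t a \<and> supp_on F' a \<and> finite F' \<and> F' \<subseteq> X \<and> F \<subseteq> F' \<and> far y r T \<and> real n \<le> r \<and>
    fnorm (\<lambda>z. cj a z y) T > \<gamma> / 2 \<and> l2norm (\<lambda>x. if x \<in> F' then 0 else U y x) \<le> \<gamma> / 8 \<and>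
    (\<forall>x x'. a x x' \<noteq> 0 \<longrightarrow> x \<notin> F \<and> x' \<notin> F) \<and>
    (\<forall>b. (\<forall>x x'. cmod (b x x') \<le> 1) \<and> supp_on F b \<longrightarrow> fnorm (\<lambda>z. cj b z y) T \<le> \<gamma> / 8)"
proof -
  \<comment> \<open>An entry of propagation at most \<open>t\<close> with one index in
    \<open>F\<close> has both indices in \<open>F2\<close>; uniform local finiteness makes
    \<open>F2\<close> finite.\<close>
  define F2 where "F2 = F \<union> (\<Union>x\<in>F. cball_on X dX x t)"
  have F2: "finite F2" "F2 \<subseteq> X"
    unfolding F2_def using F cballX_finite by (blast, auto simp: cball_on_def)
  have g8: "\<gamma> / 8 > 0" using \<gamma> by simp
  obtain r0 where "\<forall>y\<in>Y. \<forall>a. (\<forall>x x'. cmod (a x x') \<le> 1) \<and> supp_on F2 a \<longrightarrow>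
      (\<forall>T. far y r0 T \<longrightarrow> fnorm (\<lambda>z. cj a z y) T \<le> \<gamma> / 8)"
    using finite_block_tail[OF F2 g8] ..
  then have r0: "fnorm (\<lambda>z. cj a z y) T \<le> \<gamma> / 8"
    if "y \<in> Y" "\<And>x x'. cmod (a x x') \<le> 1" "supp_on F2 a" "far y r0 T" for y a T
    using that by simp
  define r where "r = max r0 (real n)"
  obtain y a Fa T where y: "y \<in> Y" and a: "pperm t a" "finite Fa" "supp_on Fa a"
    and T: "far y r T" and big: "fnorm (\<lambda>z. cj a z y) T > \<gamma>"
    using fail by blast
  have T0: "far y r0 T" using far_mono[OF T] by (simp add: r_def)
  have a1: "cmod (a x x') \<le> 1" for x x' using a(1) by (simp add: pperm_def partial_perm_def)
  define ain where "ain = (\<lambda>x x'. if x \<in> F \<or> x' \<in> F then a x x' else 0)"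
  define aout where "aout = (\<lambda>x x'. if x \<in> F \<or> x' \<in> F then 0 else a x x')"
  have pin: "partial_perm ain" and pout: "pperm t aout"
    using a(1) by (auto simp: pperm_def partial_perm_def ain_def aout_def supp_on_def propg_le_def)
  have "supp_on F2 ain" unfolding supp_on_def
  proof (intro allI impI)
    fix x x' assume nz: "ain x x' \<noteq> 0"
    then have "a x x' \<noteq> 0" "x \<in> F \<or> x' \<in> F" by (auto simp: ain_def split: if_splits)
    then have "x \<in> X" "x' \<in> X" "dX x x' \<le> t" using a(1) by (auto simp: pperm_def supp_on_def propg_le_def)
    then have d: "x' \<in> cball_on X dX x t" "x \<in> cball_on X dX x' t"
      using metX by (auto simp: cball_on_def metric_on_def)
    show "x \<in> F2 \<and> x' \<in> F2" using \<open>x \<in> F \<or> x' \<in> F\<close> d unfolding F2_def by blast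
  qed
  moreover have "cmod (ain x x') \<le> 1" for x x' using a1 by (simp add: ain_def)
  ultimately have sm: "fnorm (\<lambda>z. cj ain z y) T \<le> \<gamma> / 8" using r0[OF y _ _ T0] by blast
  have "a = (\<lambda>x x'. ain x x' + aout x x')" by (auto simp: ain_def aout_def fun_eq_iff)
  then have "cj a z y = cj ain z y + cj aout z y" for z
    using cj_add[OF bnd_partial_perm[OF pin] bnd_partial_perm, of aout z y] pout by (simp add: pperm_def)
  then have "fnorm (\<lambda>z. cj a z y) T \<le> fnorm (\<lambda>z. cj ain z y) T + fnorm (\<lambda>z. cj aout z y) T"
    using fnorm_add[of "\<lambda>z. cj ain z y" "\<lambda>z. cj aout z y" T] by simp
  then have bigout: "fnorm (\<lambda>z. cj aout z y) T > \<gamma> / 2" using sm big \<gamma> by linarith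
  obtain G where G: "finite G" "G \<subseteq> {x. U y x \<noteq> 0}"
    "\<And>B. G \<subseteq> B \<Longrightarrow> l2norm (\<lambda>x. if x \<in> B then 0 else U y x) \<le> \<gamma> / 8"
    by (rule l2_tail[OF row_l2[of y] g8]) (rule that)
  define F' where "F' = F \<union> (Fa \<inter> X) \<union> G"
  have "supp_on F' aout"
    using a(1,3) by (auto simp: supp_on_def F'_def aout_def pperm_def)
  moreover have "finite F'" "F' \<subseteq> X" "F \<subseteq> F'" "G \<subseteq> F'" using F a(2) G(1,2) Usupp by (auto simp: F'_def)
  moreover have "fnorm (\<lambda>z. cj b z y) T \<le> \<gamma> / 8" if "\<And>x x'. cmod (b x x') \<le> 1" "supp_on F b" for b
  proof -
    have "supp_on F2 b" using that(2) by (auto simp: supp_on_def F2_def)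
    then show ?thesis by (rule r0[OF y that(1) _ T0])
  qed
  ultimately show ?thesis using y pout T bigout G(3)[of F']
    by (intro exI[of _ r] exI[of _ y] exI[of _ aout] exI[of _ T] exI[of _ F'])
      (auto simp: r_def aout_def)
qed

text \<open>A gliding hump argument: a failure of uniformity could be assembled from finite pieces with disjoint supports
  into a single operator on \<open>X\<close> whose image is not in the uniform Roe algebra of \<open>Y\<close>.\<close>

lemma uniform_tail:
  assumes \<gamma>: "\<gamma> > 0"
  shows "\<exists>r. \<forall>y\<in>Y. \<forall>a F T. pperm t a \<and> finite F \<and> supp_on F a \<and> far y r T \<longrightarrow> fnorm (\<lambda>z. cj a z y) T \<le> \<gamma>"
proof (rule ccontr)
  assume "\<not> ?thesis"
  then have fail: "\<forall>r. \<exists>y\<in>Y. \<exists>a F T. pperm t a \<and> finite F \<and> supp_on F a \<and> far y r T \<and> fnorm (\<lambda>z. cj a z y) T > \<gamma>"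
    by (simp add: not_le)
  let ?P = "\<lambda>n (r, y, a, T, F'). y \<in> Y \<and> pperm t a \<and> supp_on F' a \<and> finite F' \<and> F' \<subseteq> X \<and> far y r T \<and> real n \<le> r \<and>
    fnorm (\<lambda>z. cj a z y) T > \<gamma> / 2 \<and> l2norm (\<lambda>x. if x \<in> F' then 0 else U y x) \<le> \<gamma> / 8"
  let ?Q = "\<lambda>n (r0, y0, a0, T0, F) (r, y, a, T, F'). F \<subseteq> F' \<and> (\<forall>x x'. a x x' \<noteq> 0 \<longrightarrow> x \<notin> F \<and> x' \<notin> F) \<and>
    (\<forall>b. (\<forall>x x'. cmod (b x x') \<le> 1) \<and> supp_on F b \<longrightarrow> fnorm (\<lambda>z. cj b z y) T \<le> \<gamma> / 8)"
  have "\<exists>S. \<forall>n. ?P n (S n) \<and> ?Q n (S n) (S (Suc n))"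
  proof (rule dependent_nat_choice)
    from gliding_hump_step[OF fail \<gamma>, of "{}" 0]
    obtain r y a T F' where "y \<in> Y" "pperm t a" "supp_on F' a" "finite F'" "F' \<subseteq> X" "far y r T" "real 0 \<le> r"
      "fnorm (\<lambda>z. cj a z y) T > \<gamma> / 2" "l2norm (\<lambda>x. if x \<in> F' then 0 else U y x) \<le> \<gamma> / 8" by blast
    then show "\<exists>s. ?P 0 s" by (intro exI[of _ "(r, y, a, T, F')"]) simp
  next
    fix s n assume "?P n s"
    then obtain r0 y0 a0 T0 F where s: "s = (r0, y0, a0, T0, F)" "finite F" "F \<subseteq> X" by (cases s) auto
    from gliding_hump_step[OF fail \<gamma> s(2,3), of "Suc n"]
    obtain r y a T F' where "y \<in> Y" "pperm t a" "supp_on F' a" "finite F'" "F' \<subseteq> X" "F \<subseteq> F'" "far y r T" "real (Suc n) \<le> r"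
      "fnorm (\<lambda>z. cj a z y) T > \<gamma> / 2" "l2norm (\<lambda>x. if x \<in> F' then 0 else U y x) \<le> \<gamma> / 8"
      "\<forall>x x'. a x x' \<noteq> 0 \<longrightarrow> x \<notin> F \<and> x' \<notin> F"
      "\<forall>b. (\<forall>x x'. cmod (b x x') \<le> 1) \<and> supp_on F b \<longrightarrow> fnorm (\<lambda>z. cj b z y) T \<le> \<gamma> / 8" by blast
    then show "\<exists>s'. ?P (Suc n) s' \<and> ?Q n s s'"
      by (intro exI[of _ "(r, y, a, T, F')"]) (simp add: s)
  qed
  then obtain S where S: "\<forall>n. ?P n (S n) \<and> ?Q n (S n) (S (Suc n))" ..
  define r where "r = (\<lambda>n. fst (S n))"
  define y where "y = (\<lambda>n. fst (snd (S n)))"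
  define a where "a = (\<lambda>n. fst (snd (snd (S n))))"
  define T where "T = (\<lambda>n. fst (snd (snd (snd (S n)))))"
  define F where "F = (\<lambda>n. snd (snd (snd (snd (S n)))))"
  have Seq: "S n = (r n, y n, a n, T n, F n)" for n by (simp add: r_def y_def a_def T_def F_def)
  have P: "y n \<in> Y" "pperm t (a n)" "supp_on (F n) (a n)" "far (y n) (r n) (T n)" "real n \<le> r n"
    "fnorm (\<lambda>z. cj (a n) z (y n)) (T n) > \<gamma> / 2" "l2norm (\<lambda>x. if x \<in> F n then 0 else U (y n) x) \<le> \<gamma> / 8" for n
    using S[rule_format, of n] unfolding Seq by auto
  have Q: "F n \<subseteq> F (Suc n)" "\<forall>x x'. a (Suc n) x x' \<noteq> 0 \<longrightarrow> x \<notin> F n \<and> x' \<notin> F n"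
    "\<forall>b. (\<forall>x x'. cmod (b x x') \<le> 1) \<and> supp_on (F n) b \<longrightarrow> fnorm (\<lambda>z. cj b z (y (Suc n))) (T (Suc n)) \<le> \<gamma> / 8" for n
    using S[rule_format, of n] unfolding Seq by auto
  have Fm: "F m \<subseteq> F n" if "m \<le> n" for m n using lift_Suc_mono_le[of F, OF Q(1) that] .
  have inF: "x \<in> F n \<and> x' \<in> F n" if "a m x x' \<noteq> 0" "m \<le> n" for m n x x'
    using P(3)[of m] that Fm[of m n] by (auto simp: supp_on_def)
  have notF: "x \<notin> F n \<and> x' \<notin> F n" if "a m x x' \<noteq> 0" "n < m" for m n x x'
  proof -
    obtain k where k: "m = Suc k" "n \<le> k" using \<open>n < m\<close> by (cases m) auto
    then show ?thesis using Q(2)[of k] Fm[of n k] that(1) by blast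
  qed
  have same: "m = n" if "a m x x' \<noteq> 0" "a n z z' \<noteq> 0" "x = z \<or> x' = z'" for m n x x' z z'
    using inF[OF that(1), of m] inF[OF that(2), of n] notF[OF that(1), of n] notF[OF that(2), of m] that(3)
    by (cases m n rule: linorder_cases) auto
  \<comment> \<open>Distinct blocks share no row and no column, so each entry comes from at most one
    block and \<open>A\<close> is again a partial translation of propagation at most
    \<open>t\<close>.\<close>
  define A where "A = (\<lambda>x x'. \<Sum>n | a n x x' \<noteq> 0. a n x x')"
  have An: "A x x' = a n x x'" if "a n x x' \<noteq> 0" for n x x'
  proof -
    have "{m. a m x x' \<noteq> 0} = {n}" using same that by blast
    then show ?thesis by (simp add: A_def)
  qed
  have A0: "\<exists>n. a n x x' \<noteq> 0" if "A x x' \<noteq> 0" for x x'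
    by (rule ccontr) (use that in \<open>simp add: A_def\<close>)
  have "pperm t A"
    unfolding pperm_def partial_perm_def
  proof (intro conjI allI impI)
    fix x x'
    show "cmod (A x x') \<le> 1"
    proof (cases "A x x' = 0")
      case False
      then obtain n where n: "a n x x' \<noteq> 0" using A0 by blast
      then show ?thesis using An[OF n] P(2)[of n] by (simp add: pperm_def partial_perm_def)
    qed simp
    fix x'' assume nz: "A x x' \<noteq> 0"
    then obtain n where n: "a n x x' \<noteq> 0" using A0 by blast
    { assume "A x x'' \<noteq> 0"
      then obtain m where m: "a m x x'' \<noteq> 0" using A0 by blast
      have "m = n" using same[OF m n] by simp
      then show "x' = x''" using m n P(2)[of n] unfolding pperm_def partial_perm_def by blast }
  next
    fix x x'' x' assume nz: "A x x' \<noteq> 0" "A x'' x' \<noteq> 0"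
    then obtain n m where n: "a n x x' \<noteq> 0" "a m x'' x' \<noteq> 0" using A0 by blast
    have "n = m" using same[OF n] by simp
    then show "x = x''" using n P(2)[of n] unfolding pperm_def partial_perm_def by blast
  next
    show "supp_on X A" unfolding supp_on_def
    proof (intro allI impI)
      fix x x' assume "A x x' \<noteq> 0"
      then obtain n where n: "a n x x' \<noteq> 0" using A0 by blast
      then show "x \<in> X \<and> x' \<in> X" using P(2)[of n] by (auto simp: pperm_def supp_on_def)
    qed
    show "propg_le dX A t" unfolding propg_le_def
    proof (intro allI impI)
      fix x x' assume "A x x' \<noteq> 0"
      then obtain n where n: "a n x x' \<noteq> 0" using A0 by blast
      then show "dX x x' \<le> t" using P(2)[of n] by (auto simp: pperm_def propg_le_def)
    qed
  qed
  then have pA: "partial_perm A" and "A \<in> roe X dX"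
    by (auto simp: pperm_def intro: partial_perm_roe)
  then have "cj A \<in> roe Y dY" unfolding cj_def by (intro img)
  from roe_column_tail[OF this, of "\<gamma> / 8"] \<gamma> obtain r0 where
    r0: "\<forall>y\<in>Y. \<forall>T. far y r0 T \<longrightarrow> fnorm (\<lambda>z. cj A z y) T \<le> \<gamma> / 8" by auto
  obtain k :: nat where k: "r0 \<le> k" using real_arch_simple by blast
  \<comment> \<open>A successor, so that a preceding stage \<open>k\<close> exists whose set
    \<open>F k\<close> contains all earlier blocks; stage \<open>n\<close> also has radius beyond
    \<open>r0\<close>.\<close>
  define n where "n = Suc k"
  \<comment> \<open>At column \<open>y n\<close>, the earlier blocks are small on \<open>T n\<close>
    by the choice of \<open>T n\<close>, the later ones because they avoid \<open>F n\<close>, and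
    all of \<open>A\<close> because its image is in the Roe algebra. Block \<open>n\<close> is then
    bounded by three errors of \<gamma>/8, short of \<gamma>/2.\<close>
  define low where "low = (\<lambda>x x'. if x \<in> F k then A x x' else 0)"
  define high where "high = (\<lambda>x x'. if x \<in> F n then 0 else A x x')"
  have plow: "partial_perm low" and phigh: "partial_perm high" and pn: "partial_perm (a n)"
    using pA P(2)[of n] by (auto simp: partial_perm_def low_def high_def pperm_def)
  have split: "A x x' = low x x' + (a n x x' + high x x')" for x x'
  proof (cases "A x x' = 0")
    case True
    then have "a n x x' = 0" using An[of n x x'] by auto
    with True show ?thesis by (simp add: low_def high_def)
  next
    case False
    then obtain m where m: "a m x x' \<noteq> 0" using A0 by blast
    consider "m \<le> k" | "m = n" | "n < m" unfolding n_def by linarith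
    then show ?thesis
    proof cases
      case 1
      then have "x \<in> F k" "x \<in> F n" using inF[OF m, of k] inF[OF m, of n] by (auto simp: n_def)
      moreover have "a n x x' = 0" using same[OF m, of n x x'] 1 by (auto simp: n_def)
      ultimately show ?thesis by (simp add: low_def high_def)
    next
      case 2
      then have "x \<notin> F k" "x \<in> F n" using notF[OF m, of k] inF[OF m, of n] by (auto simp: n_def)
      then show ?thesis using An[OF m] 2 by (simp add: low_def high_def)
    next
      case 3
      then have "x \<notin> F k" "x \<notin> F n" using notF[OF m, of k] notF[OF m, of n] by (auto simp: n_def)
      moreover have "a n x x' = 0" using same[OF m, of n x x'] 3 by auto
      ultimately show ?thesis by (simp add: low_def high_def)
    qed
  qed
  have "supp_on (F k) low" unfolding supp_on_def
  proof (intro allI impI)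
    fix x x' assume "low x x' \<noteq> 0"
    then have x: "x \<in> F k" "A x x' \<noteq> 0" by (auto simp: low_def split: if_splits)
    then obtain m where m: "a m x x' \<noteq> 0" using A0 by blast
    then have "m \<le> k" using notF[OF m, of k] x by (meson not_le)
    then show "x \<in> F k \<and> x' \<in> F k" by (rule inF[OF m])
  qed
  moreover have "\<forall>x x'. cmod (low x x') \<le> 1" using plow by (simp add: partial_perm_def)
  ultimately have flow: "fnorm (\<lambda>z. cj low z (y n)) (T n) \<le> \<gamma> / 8"
    unfolding n_def by (intro Q(3)[THEN spec, THEN mp] conjI)
  have "high x x' = 0" if "x' \<in> F n" for x x'
  proof (rule ccontr)
    assume "high x x' \<noteq> 0"
    then have x: "x \<notin> F n" "A x x' \<noteq> 0" by (auto simp: high_def split: if_splits)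
    then obtain m where m: "a m x x' \<noteq> 0" using A0 by blast
    then have "n < m" using inF[OF m, of n] x by (meson not_le)
    then show False using notF[OF m, of n] that by simp
  qed
  then have fhigh: "fnorm (\<lambda>z. cj high z (y n)) (T n) \<le> \<gamma> / 8"
    by (intro order_trans[OF cj_avoiding_columns[OF bnd_partial_perm[OF phigh]] P(7)[of n]])
  have "far (y n) r0 (T n)" using P(5)[of n] k by (intro far_mono[OF P(4)]) (simp add: n_def)
  then have fA: "fnorm (\<lambda>z. cj A z (y n)) (T n) \<le> \<gamma> / 8" using r0 P(1) by blast
  have "cj A z (y n) = cj low z (y n) + (cj (a n) z (y n) + cj high z (y n))" for z
  proof -
    have "A = (\<lambda>x x'. low x x' + (a n x x' + high x x'))" using split by (intro ext)
    then show ?thesis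
      using cj_add[OF bnd_partial_perm[OF plow] bnd_add[OF bnd_partial_perm[OF pn] bnd_partial_perm[OF phigh]]]
        cj_add[OF bnd_partial_perm[OF pn] bnd_partial_perm[OF phigh]] by simp
  qed
  then have "cj (a n) z (y n) = cj A z (y n) + (-1 * cj low z (y n) + -1 * cj high z (y n))" for z by simp
  then have "fnorm (\<lambda>z. cj (a n) z (y n)) (T n) = fnorm (\<lambda>z. cj A z (y n) + (-1 * cj low z (y n) + -1 * cj high z (y n))) (T n)"
    by simp
  also have "\<dots> \<le> fnorm (\<lambda>z. cj A z (y n)) (T n) + (fnorm (\<lambda>z. -1 * cj low z (y n)) (T n) + fnorm (\<lambda>z. -1 * cj high z (y n)) (T n))"
    by (intro order_trans[OF fnorm_add] add_left_mono fnorm_add)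
  also have "\<dots> \<le> \<gamma> / 8 + (\<gamma> / 8 + \<gamma> / 8)"
    unfolding fnorm_scale using fA flow fhigh by simp
  finally show False using P(6)[of n] \<gamma> by simp
qed

end

section \<open>The coarse quotient map\<close>

text \<open>Keep the indices at which a value occurs for the first time; finite fibres leave
  infinitely many of them.\<close>

lemma inj_subsequence:
  fixes g :: "nat \<Rightarrow> 'c"
  assumes "\<And>c. finite {n. g n = c}"
  obtains s :: "nat \<Rightarrow> nat" where "strict_mono s" "inj (\<lambda>n. g (s n))"
proof -
  define A where "A = {n. \<forall>m<n. g m \<noteq> g n}"
  have inj: "inj_on g A"
  proof (rule inj_onI)
    fix m n assume "m \<in> A" "n \<in> A" "g m = g n"
    then show "m = n" by (cases m n rule: linorder_cases) (auto simp: A_def)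
  qed
  have "infinite A"
  proof
    assume fin: "finite A"
    have "\<exists>m\<in>A. g n = g m" for n
    proof
      let ?m = "LEAST m. g m = g n"
      show "g n = g ?m" by (metis (mono_tags) LeastI)
      show "?m \<in> A" unfolding A_def
        using LeastI[of "\<lambda>m. g m = g n" n] by (auto dest: not_less_Least)
    qed
    then have "UNIV = (\<Union>m\<in>A. {n. g n = g m})" by auto
    moreover have "finite (\<Union>m\<in>A. {n. g n = g m})" using fin assms by blast
    ultimately show False by simp
  qed
  have "inj (\<lambda>n. g (enumerate A n))"
  proof (rule injI)
    fix m n assume "g (enumerate A m) = g (enumerate A n)"
    then have "enumerate A m = enumerate A n"
      using inj enumerate_in_set[OF \<open>infinite A\<close>] by (auto dest: inj_onD)
    then show "m = n" using strict_mono_enumerate[OF \<open>infinite A\<close>] by (simp add: strict_mono_eq)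
  qed
  with strict_mono_enumerate[OF \<open>infinite A\<close>] show thesis by (rule that)
qed

lemma foldr_madd:
  "foldr (\<lambda>i acc. madd (g i) acc) xs mzero = (\<lambda>x y. \<Sum>i\<leftarrow>xs. g i x y)"
  by (induction xs) (auto simp: madd_def mzero_def)

locale roe_unitary_map = roe_unitary +
  fixes f :: "'a \<Rightarrow> 'b" and \<delta> :: real
  assumes \<delta>: "\<delta> > 0" and fY: "\<And>x. x \<in> X \<Longrightarrow> f x \<in> Y"
    and f\<delta>: "\<And>x. x \<in> X \<Longrightarrow> \<delta> \<le> cmod (U (f x) x)"
begin

lemma fiber:
  obtains N :: nat where "\<And>y. finite {x\<in>X. f x = y} \<and> card {x\<in>X. f x = y} \<le> N"
proof -
  obtain N :: nat where N: "1 / \<delta>\<^sup>2 \<le> N" using real_arch_simple by blast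
  have "card A \<le> N" if A: "A \<subseteq> {x\<in>X. f x = y}" "finite A" for A y
  proof -
    have "real (card A) * \<delta>\<^sup>2 = (\<Sum>x\<in>A. \<delta>\<^sup>2)" by simp
    also have "\<dots> \<le> (\<Sum>x\<in>A. (cmod (U y x))\<^sup>2)"
      using A f\<delta> \<delta> by (intro sum_mono power_mono) auto
    also have "\<dots> = (fnorm (U y) A)\<^sup>2" by (simp add: fnorm_sq)
    also have "\<dots> \<le> 1\<^sup>2"
      using fnorm_le_l2norm[OF row_l2, of y A] bnd_row(2)[OF Ub, of y] by (intro power_mono) auto
    finally have "real (card A) \<le> 1 / \<delta>\<^sup>2" using \<delta> by (simp add: field_simps)
    then show ?thesis using N by linarith
  qed
  then have "finite {x\<in>X. f x = y} \<and> card {x\<in>X. f x = y} \<le> N" for y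
    using finite_if_finite_subsets_card_bdd[of "{x\<in>X. f x = y}" N] by blast
  then show thesis by (rule that)
qed

text \<open>The image of \<open>eunit x' x\<close> has at position \<open>(f x', f x)\<close> an
  entry of modulus at least \<delta>^2. A uniform tail estimate with threshold \<delta>^2/2 forbids
  that position from being far from the diagonal.\<close>

lemma coarse: "coarse_map X dX dY f"
  unfolding coarse_map_def
proof
  fix t
  have "\<delta>\<^sup>2 / 2 > 0" using \<delta> by simp
  from uniform_tail[OF this, of t] obtain r where
    r: "\<And>y a F T. y \<in> Y \<Longrightarrow> pperm t a \<Longrightarrow> finite F \<Longrightarrow> supp_on F a \<Longrightarrow> far y r T \<Longrightarrow> fnorm (\<lambda>z. cj a z y) T \<le> \<delta>\<^sup>2 / 2"
    by blast
  have "dY (f x) (f x') \<le> r" if x: "x \<in> X" "x' \<in> X" "dX x x' \<le> t" for x x'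
  proof (rule ccontr)
    assume "\<not> ?thesis"
    then have "far (f x) r {f x'}" using x fY by (simp add: far_def)
    moreover have "pperm t (eunit x' x)"
    proof -
      have "dX x' x \<le> t" using x metX by (simp add: metric_on_def)
      then show ?thesis using x
        by (auto simp: pperm_def partial_perm_def eunit_def supp_on_def propg_le_def split: if_splits)
    qed
    moreover have "supp_on {x, x'} (eunit x' x)" by (auto simp: supp_on_def eunit_def)
    ultimately have "cmod (U (f x') x' * cnj (U (f x) x)) \<le> \<delta>\<^sup>2 / 2"
      using r[of "f x" "eunit x' x" "{x, x'}" "{f x'}"] fY[OF x(1)] by (simp add: cj_eunit)
    moreover have "\<delta> * \<delta> \<le> cmod (U (f x') x') * cmod (U (f x) x)"
      using f\<delta> x \<delta> by (intro mult_mono) auto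
    ultimately have "\<delta>\<^sup>2 \<le> \<delta>\<^sup>2 / 2" by (simp add: norm_mult power2_eq_square)
    then show False using \<open>\<delta>\<^sup>2 / 2 > 0\<close> by simp
  qed
  then show "\<exists>s. \<forall>x\<in>X. \<forall>y\<in>X. dX x y \<le> t \<longrightarrow> dY (f x) (f y) \<le> s" by blast
qed

text \<open>Column \<open>f x\<close> of the image of \<open>eunit x x\<close> is the column
  \<open>x\<close> of \<open>U\<close> times a scalar of modulus at least \<delta>. The threshold
  \<delta>/2 thus leaves a tail of norm at most 1/2, and 3/4 of the square mass stays in the
  ball.\<close>

lemma column_concentration:
  obtains r where "\<And>x. x \<in> X \<Longrightarrow> (\<Sum>z\<in>cball_on Y dY (f x) r. (cmod (U z x))\<^sup>2) \<ge> 1/2"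
proof -
  have "\<delta> / 2 > 0" using \<delta> by simp
  from uniform_tail[OF this, of 0] obtain r where
    r: "\<And>y a F T. y \<in> Y \<Longrightarrow> pperm 0 a \<Longrightarrow> finite F \<Longrightarrow> supp_on F a \<Longrightarrow> far y r T \<Longrightarrow> fnorm (\<lambda>z. cj a z y) T \<le> \<delta> / 2"
    by blast
  have "(\<Sum>z\<in>cball_on Y dY (f x) r. (cmod (U z x))\<^sup>2) \<ge> 1/2" if x: "x \<in> X" for x
  proof -
    let ?B = "cball_on Y dY (f x) r"
    have pe: "pperm 0 (eunit x x)" "supp_on {x} (eunit x x)"
      using x dX_self by (auto simp: pperm_def partial_perm_def eunit_def supp_on_def propg_le_def split: if_splits)
    have tl: "fnorm (\<lambda>z. U z x) T \<le> 1/2" if "far (f x) r T" for T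
    proof -
      have "\<delta> * fnorm (\<lambda>z. U z x) T \<le> cmod (cnj (U (f x) x)) * fnorm (\<lambda>z. U z x) T"
        using f\<delta>[OF x] by (intro mult_right_mono) auto
      also have "\<dots> = fnorm (\<lambda>z. cj (eunit x x) z (f x)) T"
        unfolding fnorm_scale[symmetric] cj_eunit by (simp only: mult.commute)
      also have "\<dots> \<le> \<delta> / 2" using r[OF fY[OF x] pe(1) _ pe(2) that] by simp
      finally show ?thesis using \<delta> by simp
    qed
    have "fnorm (\<lambda>z. U z x) A \<le> sqrt ((\<Sum>z\<in>?B. (cmod (U z x))\<^sup>2) + 1/4)" if A: "finite A" for A
    proof -
      have "far (f x) r ((A - ?B) \<inter> Y)" using A by (auto simp: far_def cball_on_def)
      then have "(fnorm (\<lambda>z. U z x) ((A - ?B) \<inter> Y))\<^sup>2 \<le> (1/2)\<^sup>2" by (intro power_mono tl) auto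
      then have 1: "(\<Sum>z\<in>(A - ?B) \<inter> Y. (cmod (U z x))\<^sup>2) \<le> 1/4" by (simp add: fnorm_sq power_divide)
      have "(\<Sum>z\<in>A. (cmod (U z x))\<^sup>2) = (\<Sum>z\<in>A \<inter> Y. (cmod (U z x))\<^sup>2)"
        using A Usupp by (intro sum.mono_neutral_right) auto
      also have "\<dots> \<le> (\<Sum>z\<in>?B \<union> ((A - ?B) \<inter> Y). (cmod (U z x))\<^sup>2)"
        using A cballY_finite[OF fY[OF x]] by (intro sum_mono2) auto
      also have "\<dots> = (\<Sum>z\<in>?B. (cmod (U z x))\<^sup>2) + (\<Sum>z\<in>(A - ?B) \<inter> Y. (cmod (U z x))\<^sup>2)"
        using A cballY_finite[OF fY[OF x]] by (intro sum.union_disjoint) auto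
      also have "\<dots> \<le> (\<Sum>z\<in>?B. (cmod (U z x))\<^sup>2) + 1/4" using 1 by simp
      finally show ?thesis unfolding L2_set_def by (rule real_sqrt_le_mono)
    qed
    then have "l2norm (\<lambda>z. U z x) \<le> sqrt ((\<Sum>z\<in>?B. (cmod (U z x))\<^sup>2) + 1/4)" by (rule l2norm_leI(2))
    then have "1 \<le> (\<Sum>z\<in>?B. (cmod (U z x))\<^sup>2) + 1/4" using col_norm[OF x] by simp
    then show ?thesis by linarith
  qed
  then show thesis by (rule that)
qed

text \<open>Averaging over signs turns the uniform tail estimate into a bound for \<open>\<Sum> |U y x|\<^sup>2 \<parallel>\<xi>\<^sub>x|\<^sub>T\<parallel>\<^sup>2\<close>; the mass of the
  columns \<open>\<xi>\<^sub>x\<close> sits near \<open>f x\<close>, far from \<open>y\<close>.\<close>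

lemma row_tail:
  assumes "\<gamma> > 0"
  shows "\<exists>r. \<forall>y\<in>Y. \<forall>S. finite S \<and> S \<subseteq> X \<and> (\<forall>x\<in>S. dY (f x) y > r) \<longrightarrow> fnorm (U y) S \<le> \<gamma>"
proof -
  obtain r0 where r0: "\<And>x. x \<in> X \<Longrightarrow> (\<Sum>z\<in>cball_on Y dY (f x) r0. (cmod (U z x))\<^sup>2) \<ge> 1/2"
    by (rule column_concentration) (rule that)
  have "\<gamma> / 2 > 0" using assms by simp
  from uniform_tail[OF this, of 0] obtain r1 where
    r1: "\<And>y a F T. y \<in> Y \<Longrightarrow> pperm 0 a \<Longrightarrow> finite F \<Longrightarrow> supp_on F a \<Longrightarrow> far y r1 T \<Longrightarrow> fnorm (\<lambda>z. cj a z y) T \<le> \<gamma> / 2"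
    by blast
  have "fnorm (U y) S \<le> \<gamma>"
    if y: "y \<in> Y" and S: "finite S" "S \<subseteq> X" "\<And>x. x \<in> S \<Longrightarrow> dY (f x) y > r0 + r1" for y S
  proof -
    \<comment> \<open>\<open>T\<close> collects the places where the columns indexed by
      \<open>S\<close> concentrate; subtracting the ball radius \<open>r0\<close> from the distance
      leaves \<open>T\<close> farther than \<open>r1\<close> from \<open>y\<close>.\<close>
    define T where "T = (\<Union>x\<in>S. cball_on Y dY (f x) r0)"
    have Tfin: "finite T" unfolding T_def using S fY cballY_finite by blast
    have "dY y z > r1" if z: "z \<in> T" for z
    proof -
      obtain x where x: "x \<in> S" "z \<in> Y" "dY (f x) z \<le> r0" using z by (auto simp: T_def cball_on_def)
      have "f x \<in> Y" using x S fY by blast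
      then have "dY (f x) y \<le> dY (f x) z + dY z y" "dY z y = dY y z"
        using dY_tri dY_sym x(2) y by blast+
      then show ?thesis using S(3)[OF x(1)] x(3) by linarith
    qed
    then have far: "far y r1 T" using Tfin by (auto simp: far_def T_def cball_on_def)
    obtain \<sigma> where \<sigma>: "\<And>x. cmod (\<sigma> x) = 1"
      "(\<Sum>x\<in>S. \<Sum>z\<in>T. (cmod (U z x * cnj (U y x)))\<^sup>2) \<le> (\<Sum>z\<in>T. (cmod (\<Sum>x\<in>S. \<sigma> x * (U z x * cnj (U y x))))\<^sup>2)"
      using exists_signs[OF S(1), where T=T and w="\<lambda>x z. U z x * cnj (U y x)"] by blast
    \<comment> \<open>The signs sit on the diagonal, so this is a partial translation of propagation
      0, to which the uniform tail estimate applies irrespective of the size of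
      \<open>S\<close>.\<close>
    define a where "a = (\<lambda>x x'. if x = x' \<and> x \<in> S then \<sigma> x else 0)"
    have a: "pperm 0 a" "supp_on S a"
      using S(2) \<sigma>(1) dX_self
      by (auto simp: pperm_def partial_perm_def a_def supp_on_def propg_le_def subset_eq split: if_splits)
    have "cj a z y = (\<Sum>x\<in>S. \<sigma> x * (U z x * cnj (U y x)))" for z
      unfolding cj_finite[OF S(1) a(2)] unfolding a_def using S(1)
      by (intro sum.cong refl) (simp add: if_distrib if_distribR sum.delta cong: if_cong)
    then have "(\<Sum>z\<in>T. (cmod (\<Sum>x\<in>S. \<sigma> x * (U z x * cnj (U y x))))\<^sup>2) = (fnorm (\<lambda>z. cj a z y) T)\<^sup>2"
      by (simp add: fnorm_sq)
    also have "\<dots> \<le> (\<gamma> / 2)\<^sup>2" by (intro power_mono r1[OF y a(1) S(1) a(2) far]) simp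
    finally have up: "(\<Sum>x\<in>S. \<Sum>z\<in>T. (cmod (U z x * cnj (U y x)))\<^sup>2) \<le> (\<gamma> / 2)\<^sup>2" using \<sigma>(2) by linarith
    have "(fnorm (U y) S)\<^sup>2 / 2 = (\<Sum>x\<in>S. (cmod (U y x))\<^sup>2 * (1/2))"
      by (simp add: fnorm_sq sum_divide_distrib)
    also have "\<dots> \<le> (\<Sum>x\<in>S. (cmod (U y x))\<^sup>2 * (\<Sum>z\<in>T. (cmod (U z x))\<^sup>2))"
    proof (intro sum_mono mult_left_mono)
      fix x assume x: "x \<in> S"
      have "(1/2::real) \<le> (\<Sum>z\<in>cball_on Y dY (f x) r0. (cmod (U z x))\<^sup>2)" using r0 S x by blast
      also have "\<dots> \<le> (\<Sum>z\<in>T. (cmod (U z x))\<^sup>2)" using Tfin x by (intro sum_mono2) (auto simp: T_def)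
      finally show "(1/2::real) \<le> (\<Sum>z\<in>T. (cmod (U z x))\<^sup>2)" .
    qed simp
    also have "\<dots> = (\<Sum>x\<in>S. \<Sum>z\<in>T. (cmod (U z x * cnj (U y x)))\<^sup>2)"
      by (simp add: norm_mult power_mult_distrib sum_distrib_left mult.commute)
    also note up
    finally have "2 * (fnorm (U y) S)\<^sup>2 \<le> \<gamma>\<^sup>2" by (simp add: power_divide)
    then have "(fnorm (U y) S)\<^sup>2 \<le> \<gamma>\<^sup>2" using zero_le_power2[of "fnorm (U y) S"] by linarith
    then show ?thesis by (rule power2_le_imp_le) (use assms in simp)
  qed
  then show ?thesis by (intro exI[of _ "r0 + r1"]) blast
qed

text \<open>If no \<open>f x\<close> were near \<open>y\<close>, the tail estimate would cover the
  whole row \<open>y\<close> and give it norm at most 1/2, although rows over Y are unit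
  vectors.\<close>

lemma coarsely_onto:
  obtains r where "\<And>y. y \<in> Y \<Longrightarrow> \<exists>x\<in>X. dY (f x) y \<le> r"
proof -
  obtain r where r: "\<forall>y\<in>Y. \<forall>S. finite S \<and> S \<subseteq> X \<and> (\<forall>x\<in>S. dY (f x) y > r) \<longrightarrow> fnorm (U y) S \<le> 1/2"
    using row_tail[of "1/2"] by auto
  have "\<exists>x\<in>X. dY (f x) y \<le> r" if y: "y \<in> Y" for y
  proof (rule ccontr)
    assume no: "\<not> ?thesis"
    have "fnorm (U y) A \<le> 1/2" if "finite A" for A
    proof -
      have "(\<Sum>x\<in>A. (cmod (U y x))\<^sup>2) = (\<Sum>x\<in>A \<inter> X. (cmod (U y x))\<^sup>2)"
        using that Usupp by (intro sum.mono_neutral_right) auto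
      then have "fnorm (U y) A = fnorm (U y) (A \<inter> X)" by (simp add: L2_set_def)
      also have "\<dots> \<le> 1/2" using r y no that by (auto simp: not_le)
      finally show ?thesis .
    qed
    then have "l2norm (U y) \<le> 1/2" by (rule l2norm_leI(2))
    then show False using row_norm[OF y] by simp
  qed
  then show thesis by (rule that)
qed

section \<open>Matrix coefficients of products with conjugated operators\<close>

lemma cj_bnd:
  assumes "bnd C a"
  shows "bnd C (cj a)"
  using bnd_rmul[OF Ub bnd_rmul[OF assms Uab]] by (simp add: cj_def)

lemma cj_U:
  assumes "bnd C a" "supp_on X a"
  shows "rmul (cj a) U = rmul U a"
proof -
  have "rmul (cj a) U = rmul U (rmul a (rmul (kadj U) U))"
    unfolding cj_def rmul_assoc[OF Ub bnd_rmul[OF assms(1) Uab] Ub] rmul_assoc[OF assms(1) Uab Ub] ..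
  also have "rmul a (rmul (kadj U) U) = a"
    unfolding orth by (rule rmul_kid_right) (use assms(2) in \<open>auto simp: supp_on_def\<close>)
  finally show ?thesis .
qed

text \<open>Conjugation by \<open>U\<close> is isometric. Strong coboundedness bounds the norms of
  images, while the pairing estimates need the bounds on X.\<close>

lemma cj_bnd_iff:
  assumes "bnd C a" "supp_on X a" "bnd D (cj a)"
  shows "bnd D a"
proof -
  have "rmul (kadj U) (rmul (cj a) U) = rmul (kid X) a"
    unfolding cj_U[OF assms(1,2)] rmul_assoc[OF Uab Ub assms(1), symmetric] orth ..
  also have "\<dots> = a" by (rule rmul_kid_left) (use assms(2) in \<open>auto simp: supp_on_def\<close>)
  finally show ?thesis using bnd_rmul[OF Uab bnd_rmul[OF assms(3) Ub]] by simp
qed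

text \<open>The entry pairs row \<open>z\<close> of \<open>U\<close> with column \<open>x\<close> of
  \<open>a\<close>. That column is within \<open>e\<close> of being supported in the
  \<open>r\<close>-ball around \<open>x\<close>, and on this ball the row has norm at most
  \<open>g\<close>.\<close>

lemma row_pairing_small:
  assumes e: "0 < e" and g: "0 \<le> g"
    and a: "bnd \<kappa> a" and b: "supp_on X b" "propg_le dX b r" "bnd e (\<lambda>x x'. a x x' - b x x')"
    and x: "x \<in> X" and tail: "fnorm (U z) (cball_on X dX x r) \<le> g"
  shows "cmod (rmul U a z x) \<le> e + g * \<kappa>"
proof -
  let ?B = "cball_on X dX x r"
  define v where "v = (\<lambda>s. a s x)"
  define v1 where "v1 = (\<lambda>s. if s \<in> ?B then v s else 0)"
  define v2 where "v2 = (\<lambda>s. if s \<in> ?B then 0 else v s)"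
  have vl: "l2 v" "l2norm v \<le> \<kappa>" unfolding v_def by (rule bnd_col[OF a])+
  have l1: "l2 v1" by (rule l2_dominated(1)[OF vl(1)]) (simp add: v1_def)
  have "cmod (v2 s) \<le> cmod (a s x - b s x)" for s
  proof (cases "s \<in> ?B \<or> b s x = 0")
    case False
    then have "s \<in> X" "dX s x \<le> r" using b(1,2) by (auto simp: supp_on_def propg_le_def)
    then have "s \<in> ?B" using metX x by (simp add: cball_on_def metric_on_def)
    then show ?thesis using False by simp
  qed (auto simp: v2_def v_def)
  then have l2: "l2 v2" "l2norm v2 \<le> e"
    using l2_dominated[OF bnd_col(1)[OF b(3), of x], of v2] bnd_col(2)[OF b(3), of x] by auto
  have "v = (\<lambda>s. v1 s + v2 s)" by (auto simp: v1_def v2_def)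
  then have "rmul U a z x = kapp U v1 z + kapp U v2 z"
    unfolding rmul_kapp v_def[symmetric] using kapp_add[OF Ub l1 l2(1), of z] by simp
  also have "cmod \<dots> \<le> cmod (kapp U v1 z) + cmod (kapp U v2 z)" by (rule norm_triangle_ineq)
  also have "cmod (kapp U v2 z) \<le> e"
    using fnorm_le_l2norm[OF kapp_l2(1)[OF Ub l2(1)], of "{z}"] kapp_l2(2)[OF Ub l2(1)] l2(2) by simp
  also have "cmod (kapp U v1 z) \<le> g * \<kappa>"
  proof -
    have "kapp U v1 z = (\<Sum>s\<in>?B. U z s * v1 s)"
      by (rule kapp_finite_support[OF cballX_finite[OF x]]) (simp add: v1_def)
    also have "\<dots> = (\<Sum>s\<in>?B. U z s * v s)" by (intro sum.cong) (auto simp: v1_def)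
    also have "cmod \<dots> \<le> fnorm (U z) ?B * fnorm v ?B" by (rule fnorm_CS)
    also have "\<dots> \<le> g * \<kappa>"
      using fnorm_le_l2norm[OF vl(1), of ?B] vl(2) g by (intro mult_mono tail) auto
    finally show ?thesis .
  qed
  finally show ?thesis by simp
qed

text \<open>Since \<open>cj a\<close> applied to column \<open>x\<close> of \<open>U\<close> gives
  column \<open>x\<close> of \<open>U a\<close>, only the entries of that column within \<kappa> of
  \<open>y\<close> are seen by \<open>c\<close>: at most \<open>N\<close> of them, each with a
  weight bounded by \<kappa>.\<close>

lemma pairing_small:
  assumes M: "0 \<le> M" and c: "bnd \<kappa> c" "supp_on Y c" "propg_le dY c \<kappa>"
    and a: "bnd C a" "supp_on X a" and y: "y \<in> Y"
    and N: "card (cball_on Y dY y \<kappa>) \<le> (N::nat)"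
    and h: "\<And>z. z \<in> cball_on Y dY y \<kappa> \<Longrightarrow> cmod (rmul U a z x) \<le> M"
  shows "cmod (kapp (rmul c (cj a)) (\<lambda>s. U s x) y) \<le> \<kappa> * N * M"
proof -
  let ?B = "cball_on Y dY y \<kappa>"
  have "kapp (cj a) (\<lambda>s. U s x) = (\<lambda>z. rmul U a z x)"
    using cj_U[OF a] by (simp add: rmul_kapp[symmetric] fun_eq_iff)
  then have "kapp (rmul c (cj a)) (\<lambda>s. U s x) y = kapp c (\<lambda>z. rmul U a z x) y"
    using kapp_rmul[OF c(1) cj_bnd[OF a(1)] col_l2[of x]] by simp
  also have "\<dots> = (\<Sum>z\<in>?B. c y z * rmul U a z x)"
    unfolding kapp_def
  proof (intro infsumI has_sum_finite_neutralI)
    fix z assume "z \<in> UNIV - ?B"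
    then have "c y z = 0" using c(2,3) by (auto simp: cball_on_def supp_on_def propg_le_def)
    then show "c y z * rmul U a z x = 0" by simp
  qed (use cballY_finite[OF y] in auto)
  also have "cmod \<dots> \<le> (\<Sum>z\<in>?B. \<kappa> * M)"
    using bnd_nonneg[OF c(1)] M
    by (intro order_trans[OF norm_sum] sum_mono) (auto simp: norm_mult intro!: mult_mono h bnd_entry[OF c(1)])
  also have "\<dots> \<le> real N * (\<kappa> * M)" using N bnd_nonneg[OF c(1)] M by (simp add: mult_right_mono)
  finally show ?thesis by (simp add: ac_simps)
qed

text \<open>One operator must witness all bad pairs at once, because the elements \<open>a i\<close>
  depend on the operator being approximated. Pairing the approximation of \<open>b\<close> with
  column \<open>x n\<close> of \<open>U\<close> at \<open>y n\<close> gives a contradiction for a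
  single large \<open>n\<close>.\<close>

lemma quotient:
  assumes cob: "strongly_cobounded Y dY (cj ` roe X dX) (roe Y dY)"
  shows "coarse_quotient X dX Y dY f"
proof -
  obtain k :: nat where k: "\<And>e b. e > 0 \<Longrightarrow> b \<in> roe Y dY \<Longrightarrow> opnorm Y b \<le> 1 \<Longrightarrow>
     (\<exists>a c :: nat \<Rightarrow> 'b cmat.
        (\<forall>i\<in>{1..k}. a i \<in> cj ` roe X dX \<and> opnorm Y (a i) \<le> real k \<and>
           c i \<in> roe Y dY \<and> propg_le dY (c i) (real k) \<and> opnorm Y (c i) \<le> real k) \<and>
        opnorm Y (msub b (foldr (\<lambda>i acc. madd (mmul (c i) (a i)) acc) [1..<Suc k] mzero)) \<le> e)"
    using cob unfolding strongly_cobounded_def by blast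
  obtain N :: nat where N: "\<And>y. y \<in> Y \<Longrightarrow> card (cball_on Y dY y (real k)) \<le> N"
    using ulfY unfolding ulf_def by blast
  \<comment> \<open>The constants make \<open>k\<close> terms, each bounded by
    \<open>k * N * (e + g * k)\<close>, sum to less than \<delta>/2; the added 1 makes
    \<open>D\<close> positive and the final inequality strict.\<close>
  define D where "D = real k * (real k * N) + 1"
  define e where "e = \<delta> / (4 * D)"
  define g where "g = \<delta> / (4 * D * (real k + 1))"
  have D: "D > 0" by (simp add: D_def add_nonneg_pos)
  have e: "e > 0" and g: "g > 0" using \<delta> D by (simp_all add: e_def g_def add_nonneg_pos)
  have small: "real k * (real k * N * (e + g * k)) < \<delta> / 2"
  proof -
    have "g * k \<le> g * (real k + 1)" using g by simp
    also have "\<dots> = e" using D by (simp add: g_def e_def add_nonneg_pos less_imp_neq[symmetric])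
    finally have "e + g * k \<le> \<delta> / (2 * D)" by (simp add: e_def)
    then have "real k * (real k * N) * (e + g * k) \<le> real k * (real k * N) * (\<delta> / (2 * D))"
      by (intro mult_left_mono) auto
    also have "\<dots> < D * (\<delta> / (2 * D))" using \<delta> D by (intro mult_strict_right_mono) (auto simp: D_def)
    also have "\<dots> = \<delta> / 2" using D by simp
    finally show ?thesis by (simp only: mult.assoc)
  qed
  obtain R1 where R1: "\<forall>y\<in>Y. \<forall>S. finite S \<and> S \<subseteq> X \<and> (\<forall>x\<in>S. dY (f x) y > R1) \<longrightarrow> fnorm (U y) S \<le> g"
    using row_tail[OF g] by blast
  obtain R2 where R2: "\<And>y. y \<in> Y \<Longrightarrow> \<exists>x\<in>X. dY (f x) y \<le> R2" by (rule coarsely_onto) (rule that)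
  \<comment> \<open>\<open>R1 + k\<close> keeps points within \<open>k\<close> of \<open>y n\<close>
    at distance more than \<open>R1\<close> from \<open>f\<close> of the ball; \<open>R2\<close>
    makes the image of \<open>f\<close> \<open>K\<close>-dense in Y, which rules out recurring
    \<open>y n\<close>; 1 ensures positivity.\<close>
  define K where "K = max (max (R1 + k) R2) 1"
  have "\<exists>\<delta>'>0. \<forall>x\<in>X. \<forall>y\<in>cball_on Y dY (f x) \<epsilon>. \<exists>x'\<in>cball_on X dX x \<delta>'. dY y (f x') \<le> K" for \<epsilon>
  proof (rule ccontr)
    assume "\<not> ?thesis"
    then have "\<forall>n::nat. \<exists>x y. x \<in> X \<and> y \<in> cball_on Y dY (f x) \<epsilon> \<and> (\<forall>x'\<in>cball_on X dX x (real n + 1). K < dY y (f x'))"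
      by (metis add_nonneg_pos linorder_not_le of_nat_0_le_iff zero_less_one)
    then obtain x0 y0 where x0: "\<And>n. x0 n \<in> X" and y0: "\<And>n. y0 n \<in> cball_on Y dY (f (x0 n)) \<epsilon>"
      and no0: "\<And>n x'. x' \<in> cball_on X dX (x0 n) (real n + 1) \<Longrightarrow> K < dY (y0 n) (f x')" by metis
    have y0Y: "y0 n \<in> Y" and d0: "dY (f (x0 n)) (y0 n) \<le> \<epsilon>" for n using y0[of n] by (auto simp: cball_on_def)
    obtain Nf where Nf: "\<And>y. finite {x\<in>X. f x = y} \<and> card {x\<in>X. f x = y} \<le> Nf" by (rule fiber) (rule that)
    \<comment> \<open>If \<open>y\<close> recurred for large \<open>n\<close>, the points
      \<open>x0 n\<close> would range over finitely many fibres of \<open>f\<close>, hence over a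
      finite set. A point \<open>x'\<close> with \<open>f x'\<close> within \<open>R2\<close> of
      \<open>y\<close> would eventually lie in the growing balls around them, contrary to
      \<open>no0\<close>.\<close>
    have fin1: "finite {n. y0 n = y}" for y
    proof (cases "y \<in> Y")
      case False
      then have "{n. y0 n = y} = {}" using y0Y by auto
      then show ?thesis by simp
    next
      case y: True
      obtain x' where x': "x' \<in> X" "dY (f x') y \<le> R2" using R2[OF y] by blast
      define P where "P = (\<Union>z\<in>cball_on Y dY y \<epsilon>. {x\<in>X. f x = z})"
      have "finite P" unfolding P_def using cballY_finite[OF y] Nf by blast
      then have "bdd_above ((\<lambda>x. dX x x') ` P)" by (intro bdd_above_finite) auto
      then obtain b where b: "\<And>x. x \<in> P \<Longrightarrow> dX x x' \<le> b" unfolding bdd_above_def by blast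
      obtain m :: nat where m: "b \<le> m" using real_arch_simple by blast
      have "n \<le> m" if n: "y0 n = y" for n
      proof (rule ccontr)
        assume "\<not> n \<le> m"
        have "f (x0 n) \<in> cball_on Y dY y \<epsilon>"
          using d0[of n] n fY[OF x0] dY_sym[OF y fY[OF x0], of n] by (simp add: cball_on_def)
        then have "x0 n \<in> P" using x0 by (auto simp: P_def)
        then have "dX (x0 n) x' \<le> real n + 1" using b m \<open>\<not> n \<le> m\<close> by fastforce
        then have "K < dY (y0 n) (f x')" using x' by (intro no0) (simp add: cball_on_def)
        then show False using x'(2) dY_sym[OF y fY[OF x'(1)]] n by (simp add: K_def)
      qed
      then have "{n. y0 n = y} \<subseteq> {..m}" by auto
      then show ?thesis by (rule finite_subset) simp
    qed
    obtain s1 :: "nat \<Rightarrow> nat" where s1: "strict_mono s1" "inj (\<lambda>n. y0 (s1 n))" by (rule inj_subsequence[OF fin1]) (rule that)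
    \<comment> \<open>The points \<open>y0 (s1 n)\<close> with \<open>f (x0 (s1 n)) = z\<close> are
      distinct and lie in one ball around \<open>z\<close>.\<close>
    have fin2: "finite {n. f (x0 (s1 n)) = z}" for z
    proof (cases "z \<in> Y")
      case False
      then have "{n. f (x0 (s1 n)) = z} = {}" using fY[OF x0] by auto
      then show ?thesis by simp
    next
      case True
      have "(\<lambda>n. y0 (s1 n)) ` {n. f (x0 (s1 n)) = z} \<subseteq> cball_on Y dY z \<epsilon>"
        using y0 by auto
      then have "finite ((\<lambda>n. y0 (s1 n)) ` {n. f (x0 (s1 n)) = z})"
        using cballY_finite[OF True] finite_subset by blast
      then show ?thesis using s1(2) by (auto intro: finite_imageD inj_on_subset)
    qed
    obtain s2 :: "nat \<Rightarrow> nat" where s2: "strict_mono s2" "inj (\<lambda>n. f (x0 (s1 (s2 n))))" by (rule inj_subsequence[OF fin2]) (rule that)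
    define x where "x = (\<lambda>n. x0 (s1 (s2 n)))"
    define y where "y = (\<lambda>n. y0 (s1 (s2 n)))"
    have xX: "x n \<in> X" and yY: "y n \<in> Y" and dyx: "dY (y n) (f (x n)) \<le> \<epsilon>" for n
      using x0 y0Y d0 dY_sym[OF y0Y fY[OF x0]] by (simp_all add: x_def y_def)
    have no: "K < dY (y n) (f x')" if "x' \<in> X" "dX (x n) x' \<le> real n" for n x'
    proof -
      \<comment> \<open>Passing to subsequences only enlarges the radii, so the
        \<open>n\<close>-ball around \<open>x n\<close> is still avoided.\<close>
      have "n \<le> s1 (s2 n)"
        using seq_suble[OF s1(1)] seq_suble[OF s2(1)] by (meson order_trans)
      then show ?thesis unfolding y_def using that by (intro no0) (simp add: cball_on_def x_def)
    qed
    have fxinj: "f (x m) = f (x n) \<Longrightarrow> m = n" for m n using s2(2) by (auto simp: x_def inj_def)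
    have yinj: "y m = y n \<Longrightarrow> m = n" for m n
      using s1(2) strict_mono_eq[OF s2(1)] by (auto simp: y_def inj_def)
    define b where "b = (\<lambda>s t. if \<exists>n. s = y n \<and> t = f (x n) then 1 else (0::complex))"
    have pb: "partial_perm b"
      unfolding partial_perm_def by (auto simp: b_def dest: fxinj yinj split: if_splits)
    have bR: "b \<in> roe Y dY"
      by (rule partial_perm_roe[OF pb, of _ _ \<epsilon>])
        (use yY fY[OF xX] dyx in \<open>auto simp: supp_on_def propg_le_def b_def split: if_splits\<close>)
    obtain a c where ac: "\<forall>i\<in>{1..k}. a i \<in> cj ` roe X dX \<and> opnorm Y (a i) \<le> real k \<and>
           c i \<in> roe Y dY \<and> propg_le dY (c i) (real k) \<and> opnorm Y (c i) \<le> real k"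
      and app: "opnorm Y (msub b (foldr (\<lambda>i acc. madd (mmul (c i) (a i)) acc) [1..<Suc k] mzero)) \<le> \<delta> / 2"
      using k[of "\<delta> / 2" b] \<delta> bR opnorm_le[OF bnd_partial_perm[OF pb], of Y] by auto
    have "\<forall>i\<in>{1..k}. \<exists>a'. a' \<in> roe X dX \<and> a i = cj a'" using ac by blast
    then obtain a' where a': "\<And>i. i \<in> {1..k} \<Longrightarrow> a' i \<in> roe X dX" "\<And>i. i \<in> {1..k} \<Longrightarrow> a i = cj (a' i)" by metis
    have cb: "bnd k (c i)" "supp_on Y (c i)" "propg_le dY (c i) k" if "i \<in> {1..k}" for i
      using ac that roe_bnd[of "c i" Y dY] roe_supp[of "c i" Y dY] by (auto intro: bnd_mono)
    have aR: "a i \<in> roe Y dY" if "i \<in> {1..k}" for i using img[OF a'(1)[OF that]] a'(2)[OF that] by (simp add: cj_def)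
    have ab: "bnd k (cj (a' i))" if "i \<in> {1..k}" for i
    proof -
      have "opnorm Y (a i) \<le> real k" using ac that by blast
      then have "bnd k (a i)" by (rule bnd_mono[OF roe_bnd[OF aR[OF that]]])
      then show ?thesis using a'(2)[OF that] by simp
    qed
    have ab': "bnd k (a' i)" if "i \<in> {1..k}" for i
      by (rule cj_bnd_iff[OF roe_bnd[OF a'(1)[OF that]] roe_supp[OF a'(1)[OF that]] ab[OF that]])
    define s where "s = (\<lambda>u v. \<Sum>i\<in>{1..k}. rmul (c i) (cj (a' i)) u v)"
    have "foldr (\<lambda>i acc. madd (mmul (c i) (a i)) acc) [1..<Suc k] mzero = s"
    proof -
      have "(\<Sum>i\<leftarrow>[1..<Suc k]. mmul (c i) (a i) u v) = (\<Sum>i\<in>set [1..<Suc k]. mmul (c i) (a i) u v)" for u v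
        by (rule sum_list_distinct_conv_sum_set) (rule distinct_upt)
      moreover have "set [1..<Suc k] = {1..k}" by auto
      ultimately show ?thesis unfolding foldr_madd s_def using a'(2) by (simp add: mmul_rmul)
    qed
    then have ns: "opnorm Y (\<lambda>u v. b u v - s u v) \<le> \<delta> / 2" using app by (simp add: msub_def)
    have sb: "bnd (\<Sum>i\<in>{1..k}. real k * real k) s"
      unfolding s_def by (intro bnd_sum bnd_rmul cb ab) auto
    have "supp_on Y s" unfolding supp_on_def
    proof (intro allI impI)
      fix u v assume "s u v \<noteq> 0"
      then obtain i where i: "i \<in> {1..k}" "rmul (c i) (cj (a' i)) u v \<noteq> 0"
        unfolding s_def by (rule sum.not_neutral_contains_not_neutral)
      have "\<exists>r. c i u r * cj (a' i) r v \<noteq> 0"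
      proof (rule ccontr)
        assume "\<not> ?thesis"
        then have "rmul (c i) (cj (a' i)) u v = 0" unfolding rmul_def by (intro infsum_0) blast
        then show False using i(2) by simp
      qed
      then obtain r where "c i u r \<noteq> 0" "cj (a' i) r v \<noteq> 0" by auto
      then show "u \<in> Y \<and> v \<in> Y" using cb(2)[OF i(1)] roe_supp[OF aR[OF i(1)]] a'(2)[OF i(1)]
        by (auto simp: supp_on_def)
    qed
    then have "bounded_op Y (\<lambda>u v. b u v - s u v)"
      by (intro bounded_opI[OF supp_on_diff bnd_diff[OF bnd_partial_perm[OF pb] sb]] roe_supp[OF bR])
    from bnd_mono[OF bounded_op_bnd[OF this] ns] have bs: "bnd (\<delta> / 2) (\<lambda>u v. b u v - s u v)" .
    \<comment> \<open>The \<open>a' i\<close> are now fixed, and being finitely many they have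
      approximants of a common propagation \<open>r0\<close>. Only here is \<open>n\<close>
      chosen.\<close>
    have "\<forall>i\<in>{1..k}. \<exists>b' r. supp_on X b' \<and> propg_le dX b' r \<and> bnd e (\<lambda>x x'. a' i x x' - b' x x')"
      using roe_approx[OF a'(1) e] by metis
    then obtain b' r where b': "\<And>i. i \<in> {1..k} \<Longrightarrow> supp_on X (b' i)" "\<And>i. i \<in> {1..k} \<Longrightarrow> propg_le dX (b' i) (r i)"
      "\<And>i. i \<in> {1..k} \<Longrightarrow> bnd e (\<lambda>x x'. a' i x x' - b' i x x')" by metis
    have "bdd_above (r ` {1..k})" by (intro bdd_above_finite) auto
    then obtain r0 where r0: "\<And>i. i \<in> {1..k} \<Longrightarrow> r i \<le> r0" unfolding bdd_above_def by blast
    obtain n :: nat where n: "r0 \<le> n" using real_arch_simple by blast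
    have each: "cmod (kapp (rmul (c i) (cj (a' i))) (\<lambda>u. U u (x n)) (y n)) \<le> real k * N * (e + g * k)"
      if i: "i \<in> {1..k}" for i
    proof (rule pairing_small[OF _ cb[OF i] roe_bnd[OF a'(1)[OF i]] roe_supp[OF a'(1)[OF i]] yY N[OF yY]])
      show "0 \<le> e + g * k" using e g by simp
      fix z assume z: "z \<in> cball_on Y dY (y n) (real k)"
      have "propg_le dX (b' i) n" using b'(2)[OF i] r0[OF i] n by (force simp: propg_le_def)
      moreover have "fnorm (U z) (cball_on X dX (x n) n) \<le> g"
      proof -
        have "dY (f u) z > R1" if u: "u \<in> cball_on X dX (x n) n" for u
        proof -
          have uX: "u \<in> X" "dX (x n) u \<le> n" and zY: "z \<in> Y" "dY (y n) z \<le> k" using u z by (auto simp: cball_on_def)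
          have "K < dY (y n) (f u)" using no uX by blast
          moreover have "dY (y n) (f u) \<le> dY (y n) z + dY z (f u)" "dY z (f u) = dY (f u) z"
            using dY_tri dY_sym yY zY(1) fY[OF uX(1)] by blast+
          ultimately show ?thesis using zY(2) by (simp add: K_def)
        qed
        moreover have "z \<in> Y" using z by (simp add: cball_on_def)
        ultimately show ?thesis using R1 cballX_finite[OF xX, of n n] by (auto simp: cball_on_def)
      qed
      ultimately show "cmod (rmul U (a' i) z (x n)) \<le> e + g * k"
        using row_pairing_small[OF e less_imp_le[OF g] ab'[OF i] b'(1)[OF i] _ b'(3)[OF i] xX] by simp
    qed
    define \<xi> where "\<xi> = (\<lambda>u. U u (x n))"
    have \<xi>: "l2 \<xi>" "l2norm \<xi> = 1" using col_l2 col_norm[OF xX] by (simp_all add: \<xi>_def)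
    have "kapp s \<xi> (y n) = (\<Sum>i\<in>{1..k}. kapp (rmul (c i) (cj (a' i))) \<xi> (y n))"
    proof -
      have "((\<lambda>v. \<Sum>i\<in>{1..k}. rmul (c i) (cj (a' i)) (y n) v * \<xi> v) has_sum (\<Sum>i\<in>{1..k}. kapp (rmul (c i) (cj (a' i))) \<xi> (y n))) UNIV"
        unfolding kapp_def
        by (intro has_sum_sum has_sum_infsum kapp_summable[OF bnd_rmul[OF cb(1) ab] \<xi>(1)]) auto
      moreover have "kapp s \<xi> (y n) = infsum (\<lambda>v. \<Sum>i\<in>{1..k}. rmul (c i) (cj (a' i)) (y n) v * \<xi> v) UNIV"
        by (simp add: kapp_def s_def sum_distrib_right)
      ultimately show ?thesis by (simp only: infsumI)
    qed
    also have "cmod \<dots> \<le> (\<Sum>i\<in>{1..k}. real k * N * (e + g * k))"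
      by (intro order_trans[OF norm_sum] sum_mono) (use each in \<open>simp add: \<xi>_def\<close>)
    also have "\<dots> < \<delta> / 2" using small by simp
    finally have 1: "cmod (kapp s \<xi> (y n)) < \<delta> / 2" .
    \<comment> \<open>Injectivity of \<open>y\<close> leaves a single nonzero entry in row
      \<open>y n\<close> of \<open>b\<close>; the coefficient therefore has modulus at least
      \<delta>, whereas the approximation allows less than \<delta>/2 + \<delta>/2.\<close>
    have "kapp b \<xi> (y n) = b (y n) (f (x n)) * \<xi> (f (x n))"
      unfolding kapp_def by (rule infsum_single) (auto simp: b_def dest: yinj)
    moreover have "b (y n) (f (x n)) = 1" by (auto simp: b_def)
    ultimately have 2: "\<delta> \<le> cmod (kapp b \<xi> (y n))" using f\<delta>[OF xX, of n] by (simp add: \<xi>_def)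
    have "kapp b \<xi> (y n) = kapp (\<lambda>u v. b u v - s u v) \<xi> (y n) + kapp s \<xi> (y n)"
      unfolding kapp_def
      using infsum_add[OF kapp_summable[OF bs \<xi>(1), of "y n"] kapp_summable[OF sb \<xi>(1), of "y n"]]
      by (simp add: left_diff_distrib)
    moreover have "cmod (kapp (\<lambda>u v. b u v - s u v) \<xi> (y n)) \<le> \<delta> / 2"
      using fnorm_le_l2norm[OF kapp_l2(1)[OF bs \<xi>(1)], of "{y n}"] kapp_l2(2)[OF bs \<xi>(1)] \<xi>(2) by simp
    ultimately show False
      using 1 2 norm_triangle_ineq[of "kapp (\<lambda>u v. b u v - s u v) \<xi> (y n)" "kapp s \<xi> (y n)"] by simp
  qed
  note main = this
  show ?thesis unfolding coarse_quotient_def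
  proof (rule conjI[OF coarse], rule exI[of _ K], intro conjI allI impI)
    show "K > 0" by (simp add: K_def)
    fix \<epsilon> :: real
    obtain \<delta>' where \<delta>': "\<delta>' > 0" "\<forall>x\<in>X. \<forall>y\<in>cball_on Y dY (f x) \<epsilon>. \<exists>x'\<in>cball_on X dX x \<delta>'. dY y (f x') \<le> K"
      using main by blast
    have "cball_on Y dY (f x) \<epsilon> \<subseteq> thicken Y dY K (f ` cball_on X dX x \<delta>')" if x: "x \<in> X" for x
    proof
      fix y assume y: "y \<in> cball_on Y dY (f x) \<epsilon>"
      then have yY: "y \<in> Y" by (simp add: cball_on_def)
      obtain x' where x': "x' \<in> cball_on X dX x \<delta>'" "dY y (f x') \<le> K" using \<delta>'(2) x y by blast
      have "setdist dY y (f ` cball_on X dX x \<delta>') \<le> dY y (f x')" unfolding setdist_def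
      proof (rule cInf_lower)
        show "bdd_below {dY y a |a. a \<in> f ` cball_on X dX x \<delta>'}"
          using metY yY fY by (intro bdd_belowI[of _ 0]) (auto simp: metric_on_def cball_on_def)
      qed (use x' in blast)
      then show "y \<in> thicken Y dY K (f ` cball_on X dX x \<delta>')" using x'(2) yY by (simp add: thicken_def)
    qed
    then show "\<exists>\<delta>'>0. \<forall>x\<in>X. cball_on Y dY (f x) \<epsilon> \<subseteq> thicken Y dY K (f ` cball_on X dX x \<delta>')"
      using \<delta>'(1) by blast
  qed
qed

end

theorem theorem1p4:
  fixes X :: "'a set" and dX :: "'a \<Rightarrow> 'a \<Rightarrow> real"
    and Y :: "'b set" and dY :: "'b \<Rightarrow> 'b \<Rightarrow> real"
    and \<Phi> :: "'a cmat \<Rightarrow> 'b cmat"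
  assumes "metric_on X dX" and "ulf X dX"
    and "metric_on Y dY" and "ulf Y dY"
    and "\<forall>Z. Z \<subseteq> Y \<and> sparse Z dY \<longrightarrow> only_compact_ghost_projections Z dY"
    and "cstar_embedding X dX Y dY \<Phi>"
    and "cartan Y (roe Y dY) (\<Phi> ` linf X)"
    and "coseparable Y (roe Y dY) (\<Phi> ` linf X)"
    and "strongly_cobounded Y dY (\<Phi> ` roe X dX) (roe Y dY)"
  shows "\<exists>f. f ` X \<subseteq> Y \<and> unif_fin_to_one X Y f \<and> coarse_quotient X dX Y dY f"
proof (cases "X = {}")
  \<comment> \<open>There is no base point here, and every condition on a map defined on X is
    vacuous.\<close>
  case True
  then show ?thesis
    by (intro exI[of _ "\<lambda>_. undefined"])
      (auto simp: unif_fin_to_one_def coarse_quotient_def coarse_map_def intro!: exI[of _ 1])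
next
  case False
  then obtain x0 where x0: "x0 \<in> X" by blast
  interpret E: cartan_embedding X dX Y dY \<Phi> x0
    by unfold_locales (use assms x0 in auto)
  obtain U where U: "\<And>y x. U y x \<noteq> 0 \<Longrightarrow> y \<in> Y \<and> x \<in> X" "bnd 1 U"
    "rmul (kadj U) U = kid X" "rmul U (kadj U) = kid Y"
    "\<And>a. a \<in> roe X dX \<Longrightarrow> \<Phi> a = rmul U (rmul a (kadj U))"
    by (rule E.implementing_unitary) (rule that)
  interpret V: roe_unitary X dX Y dY U
  proof unfold_locales
    show "rmul U (rmul a (kadj U)) \<in> roe Y dY" if "a \<in> roe X dX" for a
      using E.Phi_roe[OF that] U(5)[OF that] by simp
  qed (use assms U(1-4) in auto)
  obtain \<delta> where \<delta>: "\<delta> > 0" "\<forall>x\<in>X. \<exists>y. \<delta> \<le> cmod (U y x)"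
    using V.columns_bounded_below[OF assms(5)] by blast
  then obtain f where f: "\<And>x. x \<in> X \<Longrightarrow> \<delta> \<le> cmod (U (f x) x)" by metis
  have fY: "f x \<in> Y" if "x \<in> X" for x using f[OF that] \<delta>(1) U(1)[of "f x" x] by force
  interpret M: roe_unitary_map X dX Y dY U f \<delta>
    by unfold_locales (use \<delta>(1) f fY in auto)
  have "\<Phi> ` roe X dX = V.cj ` roe X dX" using U(5) by (simp add: V.cj_def)
  then have "coarse_quotient X dX Y dY f" using assms(9) by (intro M.quotient) simp
  moreover have "unif_fin_to_one X Y f"
    unfolding unif_fin_to_one_def by (rule M.fiber) blast
  ultimately show ?thesis using fY by (intro exI[of _ f]) auto
qed

end
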